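(* Let $\{S_n\}_{n=1}^\infty$ be a sequence of densely defined closed symmetric operators, $S_n$ acting in a Hilbert space $\mathfrak H_n$ and having equal deficiency indices, and suppose that there are $a\in\mathbb R$ and $\varepsilon>0$ with $(a-\varepsilon,a+\varepsilon)\subset\bigcap_{n=1}^\infty\widehat\rho(S_n)$. For each $n\in\mathbb N$ let $\widetilde\Pi_n=\{\mathcal H_n,\widetilde\Gamma_0^{(n)},\widetilde\Gamma_1^{(n)}\}$ be a boundary triplet for $S_n^*$ such that $(a-\varepsilon,a+\varepsilon)\subset\rho(S_{n0})$, where $S_{n0}=S_n^*\upharpoonright\ker(\widetilde\Gamma_0^{(n)})$, and let $\widetilde M_n(\cdot)$ be the corresponding Weyl function. Then: (i) The operator $\widetilde M_n'(a)$ (the derivative of $\widetilde M_n$ at $a$) is positive definite, $n\in\mathbb N$. (ii) For any factorization $\widetilde M_n'(a)=R_n^*R_n$, where $R_n$ is a bounded operator in $\mathcal H_n$ with $0\in\rho(R_n)$, the triplet $\Pi_n=\{\mathcal H_n,\Gamma_0^{(n)},\Gamma_1^{(n)}\}$ with $$\Gamma_0^{(n)}:=R_n\widetilde\Gamma_0^{(n)},\qquad \Gamma_1^{(n)}:=(R_n^{-1})^*\bigl(\widetilde\Gamma_1^{(n)}-\widetilde M_n(a)\widetilde\Gamma_0^{(n)}\bigr)$$ is a boundary triplet for $S_n^*$. (iii) The direct sum $\Pi=\bigoplus_{n=1}^\infty\Pi_n$ of the triplets from (ii) forms a boundary triplet for $A^*=\bigoplus_{n=1}^\infty S_n^*$.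
   Context: $\widehat\rho(S)$ is the set of regular type points of $S$: those $\lambda\in\mathbb C$ for which there is $c>0$ with $\|(S-\lambda)f\|\ge c\|f\|$ for all $f\in\operatorname{dom}(S)$. A bounded self-adjoint operator $T$ is positive definite if $T\ge cI$ for some $c>0$. Boundary triplet: for a densely defined closed symmetric operator $S$ in a Hilbert space with equal deficiency indices, $\{\mathcal G,\Gamma_0,\Gamma_1\}$ is an (ordinary) boundary triplet for $S^*$ if $\mathcal G$ is a Hilbert space and $\Gamma_0,\Gamma_1:\operatorname{dom}(S^* )\to\mathcal G$ are linear mappings defined on all of $\operatorname{dom}(S^* )$, bounded with respect to the graph norm, such that $(S^*f,g)-(f,S^*g)=(\Gamma_1f,\Gamma_0g)_{\mathcal G}-(\Gamma_0f,\Gamma_1g)_{\mathcal G}$ for all $f,g\in\operatorname{dom}(S^* )$ and $\{\Gamma_0,\Gamma_1\}:\operatorname{dom}(S^* )\to\mathcal G\oplus\mathcal G$ is surjective. The corresponding Weyl function is $M(z)=\Gamma_1(\Gamma_0\upharpoonright\ker(S^*-z))^{-1}$ for $z\in\rho(S^*\upharpoonright\ker\Gamma_0)$; it is holomorphic with values in the bounded operators on $\mathcal G$. Direct sum: $A=\bigoplus_nS_n$ acts in $\mathfrak H=\bigoplus_n\mathfrak H_n$; $\operatorname{dom}(A^* )=\{\bigoplus f_n\in\mathfrak H: f_n\in\operatorname{dom}(S_n^* ),\ \sum\|S_n^*f_n\|^2<\infty\}$. $\bigoplus_n\Pi_n=\{\mathcal H,\Gamma_0,\Gamma_1\}$ with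 $\mathcal H=\bigoplus_n\mathcal H_n$, $\Gamma_j=\bigoplus_n\Gamma_j^{(n)}$, $\operatorname{dom}(\Gamma_j)=\{f=\bigoplus f_n\in\operatorname{dom}(A^* ):\sum_n\|\Gamma_j^{(n)}f_n\|^2<\infty\}$. That it is a boundary triplet for $A^*$ includes the requirement $\operatorname{dom}(\Gamma_0)=\operatorname{dom}(\Gamma_1)=\operatorname{dom}(A^* )$. *)

theory Defs
  imports Complex_Main "HOL-Algebra.Module" "HOL-Library.Equipollence"
begin

section \<open>Complex Hilbert spaces\<close>

definition complex_ring :: "complex ring" where
  "complex_ring = \<lparr>carrier = UNIV, monoid.mult = (*), one = 1, zero = 0, add = (+)\<rparr>"

text \<open>
  The spaces of a sequence are different objects, so a Hilbert space is a structure with an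
  explicit carrier rather than a type. The fields \<open>monoid.mult\<close> and \<open>one\<close> inherited from
  the record of modules carry no information. Inner products are linear in the first and
  conjugate-linear in the second argument.
\<close>

record 'a hilbert = "(complex, 'a) module" +
  ip :: "'a \<Rightarrow> 'a \<Rightarrow> complex"

definition vnorm :: "'a hilbert \<Rightarrow> 'a \<Rightarrow> real" where
  "vnorm H x = sqrt (Re (ip H x x))"

locale hilbert_space = module complex_ring H for H :: "'a hilbert" (structure) +
  assumes ip_add: "\<lbrakk>x \<in> carrier H; y \<in> carrier H; z \<in> carrier H\<rbrakk>
      \<Longrightarrow> ip H (x \<oplus> y) z = ip H x z + ip H y z"
    and ip_smult: "\<lbrakk>x \<in> carrier H; z \<in> carrier H\<rbrakk> \<Longrightarrow> ip H (c \<odot> x) z = c * ip H x z"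
    and ip_commute: "\<lbrakk>x \<in> carrier H; y \<in> carrier H\<rbrakk> \<Longrightarrow> ip H x y = cnj (ip H y x)"
    and ip_pos: "\<lbrakk>x \<in> carrier H; x \<noteq> \<zero>\<rbrakk> \<Longrightarrow> 0 < Re (ip H x x)"
    and complete:
      "\<lbrakk>\<And>n. X n \<in> carrier H;
        \<And>e. 0 < e \<Longrightarrow> \<exists>N. \<forall>m\<ge>N. \<forall>n\<ge>N. vnorm H (X m \<ominus> X n) < e\<rbrakk>
      \<Longrightarrow> \<exists>x\<in>carrier H. (\<lambda>n. vnorm H (X n \<ominus> x)) \<longlonglongrightarrow> 0"

text \<open>Maximal orthonormal subsets; in a closed subspace of a Hilbert space these are exactly
  the orthonormal bases.\<close>

definition orthonormal_basis :: "'a hilbert \<Rightarrow> 'a set \<Rightarrow> 'a set \<Rightarrow> bool" where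
  "orthonormal_basis H N B \<longleftrightarrow> B \<subseteq> N \<and>
     (\<forall>x\<in>B. \<forall>y\<in>B. ip H x y = (if x = y then 1 else 0)) \<and>
     (\<forall>x\<in>N. (\<forall>y\<in>B. ip H x y = 0) \<longrightarrow> x = \<zero>\<^bsub>H\<^esub>)"

definition hilbert_sum :: "(nat \<Rightarrow> 'a hilbert) \<Rightarrow> (nat \<Rightarrow> 'a) hilbert" where
  "hilbert_sum H =
     \<lparr>carrier = {f. (\<forall>n. f n \<in> carrier (H n)) \<and> summable (\<lambda>n. (vnorm (H n) (f n))\<^sup>2)},
      monoid.mult = undefined, one = undefined,
      zero = (\<lambda>n. \<zero>\<^bsub>H n\<^esub>),
      add = (\<lambda>f g n. f n \<oplus>\<^bsub>H n\<^esub> g n),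
      smult = (\<lambda>c f n. c \<odot>\<^bsub>H n\<^esub> f n),
      ip = (\<lambda>f g. \<Sum>n. ip (H n) (f n) (g n))\<rparr>"


section \<open>Unbounded operators\<close>

text \<open>
  An operator is a partial map, \<open>dom\<close> being its domain of definition; so equality of operators
  includes equality of domains, \<open>T |` D\<close> is restriction, and \<open>\<circ>\<^sub>m\<close> is the product with its
  natural domain.
\<close>

type_synonym ('a, 'b) operator = "'a \<Rightarrow> 'b option"

abbreviation app :: "('a, 'b) operator \<Rightarrow> 'a \<Rightarrow> 'b" (infixl "\<cdot>" 90) where
  "T \<cdot> x \<equiv> the (T x)"

definition linear_operator :: "'a hilbert \<Rightarrow> 'b hilbert \<Rightarrow> ('a, 'b) operator \<Rightarrow> bool" where
  "linear_operator H K T \<longleftrightarrow> submodule (dom T) complex_ring H \<and> ran T \<subseteq> carrier K \<and>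
     (\<forall>x\<in>dom T. \<forall>y\<in>dom T. T \<cdot> (x \<oplus>\<^bsub>H\<^esub> y) = T \<cdot> x \<oplus>\<^bsub>K\<^esub> T \<cdot> y) \<and>
     (\<forall>c. \<forall>x\<in>dom T. T \<cdot> (c \<odot>\<^bsub>H\<^esub> x) = c \<odot>\<^bsub>K\<^esub> T \<cdot> x)"

definition bounded_operator :: "'a hilbert \<Rightarrow> 'b hilbert \<Rightarrow> ('a, 'b) operator \<Rightarrow> bool" where
  "bounded_operator H K T \<longleftrightarrow> linear_operator H K T \<and> dom T = carrier H \<and>
     (\<exists>C. \<forall>x\<in>carrier H. vnorm K (T \<cdot> x) \<le> C * vnorm H x)"

definition op_ker :: "'b hilbert \<Rightarrow> ('a, 'b) operator \<Rightarrow> 'a set" where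
  "op_ker K T = {x \<in> dom T. T \<cdot> x = \<zero>\<^bsub>K\<^esub>}"

definition op_minus :: "'b hilbert \<Rightarrow> ('a, 'b) operator \<Rightarrow> ('a, 'b) operator \<Rightarrow> ('a, 'b) operator"
  where "op_minus K S T =
     (\<lambda>x. if x \<in> dom S \<inter> dom T then Some (S \<cdot> x \<ominus>\<^bsub>K\<^esub> T \<cdot> x) else None)"

text \<open>The operator \<open>T - z\<close>.\<close>

definition op_shift :: "'a hilbert \<Rightarrow> ('a, 'a) operator \<Rightarrow> complex \<Rightarrow> ('a, 'a) operator" where
  "op_shift H T z = (\<lambda>x. map_option (\<lambda>y. y \<ominus>\<^bsub>H\<^esub> z \<odot>\<^bsub>H\<^esub> x) (T x))"

text \<open>Meaningful for operators that are injective on their domain.\<close>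

definition op_inverse :: "('a, 'b) operator \<Rightarrow> ('b, 'a) operator" where
  "op_inverse T = (\<lambda>y. if y \<in> ran T then Some (inv_into (dom T) (app T) y) else None)"

definition densely_defined :: "'a hilbert \<Rightarrow> ('a, 'a) operator \<Rightarrow> bool" where
  "densely_defined H S \<longleftrightarrow>
     (\<forall>x\<in>carrier H. \<forall>e>0. \<exists>y\<in>dom S. vnorm H (x \<ominus>\<^bsub>H\<^esub> y) < e)"

definition closed_operator :: "'a hilbert \<Rightarrow> ('a, 'a) operator \<Rightarrow> bool" where
  "closed_operator H S \<longleftrightarrow>
     (\<forall>X. \<forall>x\<in>carrier H. \<forall>y\<in>carrier H.
        (\<forall>n. X n \<in> dom S) \<and> (\<lambda>n. vnorm H (X n \<ominus>\<^bsub>H\<^esub> x)) \<longlonglongrightarrow> 0 \<and>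
        (\<lambda>n. vnorm H (S \<cdot> (X n) \<ominus>\<^bsub>H\<^esub> y)) \<longlonglongrightarrow> 0
        \<longrightarrow> S x = Some y)"

definition symmetric_operator :: "'a hilbert \<Rightarrow> ('a, 'a) operator \<Rightarrow> bool" where
  "symmetric_operator H S \<longleftrightarrow> (\<forall>f\<in>dom S. \<forall>g\<in>dom S. ip H (S \<cdot> f) g = ip H f (S \<cdot> g))"

text \<open>Meaningful for densely defined operators, for which the vector \<open>h\<close> is unique.\<close>

definition op_adjoint :: "'a hilbert \<Rightarrow> ('a, 'a) operator \<Rightarrow> ('a, 'a) operator" where
  "op_adjoint H S = (\<lambda>g.
     let P = (\<lambda>h. h \<in> carrier H \<and> (\<forall>f\<in>dom S. ip H (S \<cdot> f) g = ip H f h))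
     in if g \<in> carrier H \<and> (\<exists>h. P h) then Some (THE h. P h) else None)"

definition regular_points :: "'a hilbert \<Rightarrow> ('a, 'a) operator \<Rightarrow> complex set" where
  "regular_points H S =
     {z. \<exists>c>0. \<forall>f\<in>dom S. vnorm H (op_shift H S z \<cdot> f) \<ge> c * vnorm H f}"

definition resolvent_set :: "'a hilbert \<Rightarrow> ('a, 'a) operator \<Rightarrow> complex set" where
  "resolvent_set H T = {z. inj_on (app (op_shift H T z)) (dom T) \<and>
     bounded_operator H H (op_inverse (op_shift H T z))}"

definition positive_definite :: "'a hilbert \<Rightarrow> ('a, 'a) operator \<Rightarrow> bool" where
  "positive_definite H T \<longleftrightarrow> bounded_operator H H T \<and> op_adjoint H T = T \<and>
     (\<exists>c>0. \<forall>x\<in>carrier H. Re (ip H (T \<cdot> x) x) \<ge> c * (vnorm H x)\<^sup>2)"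

text \<open>\<open>S\<close> has equal deficiency indices if the Hilbert dimensions of the two defect subspaces
  \<open>ker (S\<^sup>* - \<i>)\<close> and \<open>ker (S\<^sup>* + \<i>)\<close> are the same cardinal.\<close>

definition defect_space :: "'a hilbert \<Rightarrow> ('a, 'a) operator \<Rightarrow> complex \<Rightarrow> 'a set" where
  "defect_space H S z = op_ker H (op_shift H (op_adjoint H S) z)"

definition equal_deficiency_indices :: "'a hilbert \<Rightarrow> ('a, 'a) operator \<Rightarrow> bool" where
  "equal_deficiency_indices H S \<longleftrightarrow>
     (\<exists>B C. orthonormal_basis H (defect_space H S \<i>) B \<and>
            orthonormal_basis H (defect_space H S (- \<i>)) C \<and> B \<approx> C)"

text \<open>The derivative of an operator-valued function with respect to the operator norm; the
  estimate says that the norm of \<open>F w - F z - (w - z) D\<close> is at most \<open>e * cmod (w - z)\<close>.\<close>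

definition has_op_derivative ::
  "'a hilbert \<Rightarrow> (complex \<Rightarrow> ('a, 'a) operator) \<Rightarrow> ('a, 'a) operator \<Rightarrow> complex \<Rightarrow> bool" where
  "has_op_derivative G F D z \<longleftrightarrow> bounded_operator G G D \<and> bounded_operator G G (F z) \<and>
     (\<forall>\<^sub>F w in at z. bounded_operator G G (F w)) \<and>
     (\<forall>e>0. \<forall>\<^sub>F w in at z. \<forall>h\<in>carrier G.
        vnorm G ((F w \<cdot> h \<ominus>\<^bsub>G\<^esub> F z \<cdot> h) \<ominus>\<^bsub>G\<^esub> (w - z) \<odot>\<^bsub>G\<^esub> (D \<cdot> h))
          \<le> e * cmod (w - z) * vnorm G h)"

definition op_deriv ::
  "'a hilbert \<Rightarrow> (complex \<Rightarrow> ('a, 'a) operator) \<Rightarrow> complex \<Rightarrow> ('a, 'a) operator" where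
  "op_deriv G F z = (THE D. has_op_derivative G F D z)"


section \<open>Boundary triplets\<close>

definition dd_closed_symmetric :: "'a hilbert \<Rightarrow> ('a, 'a) operator \<Rightarrow> bool" where
  "dd_closed_symmetric H S \<longleftrightarrow> linear_operator H H S \<and> densely_defined H S \<and>
     closed_operator H S \<and> symmetric_operator H S"

text \<open>\<open>boundary_triplet H S G \<Gamma>0 \<Gamma>1\<close> says that \<open>{G, \<Gamma>0, \<Gamma>1}\<close> is a boundary triplet for the
  adjoint of \<open>S\<close>. It includes the standing assumptions on \<open>S\<close> under which the notion is
  defined.\<close>

definition boundary_triplet ::
  "'a hilbert \<Rightarrow> ('a, 'a) operator \<Rightarrow> 'b hilbert \<Rightarrow> ('a, 'b) operator \<Rightarrow> ('a, 'b) operator \<Rightarrow> bool"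
  where "boundary_triplet H S G \<Gamma>0 \<Gamma>1 \<longleftrightarrow>
     hilbert_space H \<and> dd_closed_symmetric H S \<and> equal_deficiency_indices H S \<and>
     hilbert_space G \<and>
     (\<forall>\<Gamma>\<in>{\<Gamma>0, \<Gamma>1}. linear_operator H G \<Gamma> \<and> dom \<Gamma> = dom (op_adjoint H S) \<and>
        (\<exists>C. \<forall>f\<in>dom (op_adjoint H S). vnorm G (\<Gamma> \<cdot> f)
            \<le> C * sqrt ((vnorm H f)\<^sup>2 + (vnorm H (op_adjoint H S \<cdot> f))\<^sup>2))) \<and>
     (\<forall>f\<in>dom (op_adjoint H S). \<forall>g\<in>dom (op_adjoint H S).
        ip H (op_adjoint H S \<cdot> f) g - ip H f (op_adjoint H S \<cdot> g)
          = ip G (\<Gamma>1 \<cdot> f) (\<Gamma>0 \<cdot> g) - ip G (\<Gamma>0 \<cdot> f) (\<Gamma>1 \<cdot> g)) \<and>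
     (\<forall>h0\<in>carrier G. \<forall>h1\<in>carrier G.
        \<exists>f\<in>dom (op_adjoint H S). \<Gamma>0 \<cdot> f = h0 \<and> \<Gamma>1 \<cdot> f = h1)"

text \<open>The extension \<open>S\<^sub>0\<close>, the restriction of the adjoint of \<open>S\<close> to the kernel of \<open>\<Gamma>0\<close>.\<close>

definition op0 ::
  "'a hilbert \<Rightarrow> ('a, 'a) operator \<Rightarrow> 'b hilbert \<Rightarrow> ('a, 'b) operator \<Rightarrow> ('a, 'a) operator" where
  "op0 H S G \<Gamma>0 = op_adjoint H S |` op_ker G \<Gamma>0"

text \<open>Meaningful for \<open>z\<close> in the resolvent set of \<open>S\<^sub>0\<close>.\<close>

definition weyl_function ::
  "'a hilbert \<Rightarrow> ('a, 'a) operator \<Rightarrow> ('a, 'b) operator \<Rightarrow> ('a, 'b) operator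
    \<Rightarrow> complex \<Rightarrow> ('b, 'b) operator" where
  "weyl_function H S \<Gamma>0 \<Gamma>1 z = \<Gamma>1 \<circ>\<^sub>m op_inverse (\<Gamma>0 |` defect_space H S z)"


section \<open>Direct sums of operators and triplets\<close>

definition op_sum ::
  "(nat \<Rightarrow> 'a hilbert) \<Rightarrow> (nat \<Rightarrow> 'b hilbert) \<Rightarrow> (nat \<Rightarrow> ('a, 'b) operator)
    \<Rightarrow> (nat \<Rightarrow> 'a, nat \<Rightarrow> 'b) operator" where
  "op_sum H K T = (\<lambda>f.
     if f \<in> carrier (hilbert_sum H) \<and> (\<forall>n. f n \<in> dom (T n)) \<and>
        (\<lambda>n. T n \<cdot> (f n)) \<in> carrier (hilbert_sum K)
     then Some (\<lambda>n. T n \<cdot> (f n)) else None)"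

text \<open>The direct sum of boundary maps lives on the domain of the adjoint of \<open>\<Oplus> S\<^sub>n\<close>.\<close>

definition boundary_map_sum ::
  "(nat \<Rightarrow> 'a hilbert) \<Rightarrow> (nat \<Rightarrow> ('a, 'a) operator) \<Rightarrow> (nat \<Rightarrow> 'b hilbert)
    \<Rightarrow> (nat \<Rightarrow> ('a, 'b) operator) \<Rightarrow> (nat \<Rightarrow> 'a, nat \<Rightarrow> 'b) operator" where
  "boundary_map_sum H S G \<Gamma> =
     op_sum H G \<Gamma> |` dom (op_adjoint (hilbert_sum H) (op_sum H H S))"

definition regularized_\<Gamma>0 :: "('b, 'b) operator \<Rightarrow> ('a, 'b) operator \<Rightarrow> ('a, 'b) operator" where
  "regularized_\<Gamma>0 R \<Gamma>0 = R \<circ>\<^sub>m \<Gamma>0"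

definition regularized_\<Gamma>1 ::
  "'b hilbert \<Rightarrow> ('b, 'b) operator \<Rightarrow> ('b, 'b) operator \<Rightarrow> ('a, 'b) operator \<Rightarrow> ('a, 'b) operator
    \<Rightarrow> ('a, 'b) operator" where
  "regularized_\<Gamma>1 G R Ma \<Gamma>0 \<Gamma>1 =
     op_adjoint G (op_inverse R) \<circ>\<^sub>m op_minus G \<Gamma>1 (Ma \<circ>\<^sub>m \<Gamma>0)"

text \<open>\<open>R\<close> is a factor in \<open>T = R\<^sup>* R\<close> with \<open>R\<close> bounded and \<open>0\<close> in its resolvent set.\<close>

definition factorizes :: "'b hilbert \<Rightarrow> ('b, 'b) operator \<Rightarrow> ('b, 'b) operator \<Rightarrow> bool" where
  "factorizes G T R \<longleftrightarrow> bounded_operator G G R \<and> 0 \<in> resolvent_set G R \<and>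
     T = op_adjoint G R \<circ>\<^sub>m R"

end

theory Submission
  imports Defs
begin

text \<open>
  Let \<open>T = S\<^sup>*\<close>, \<open>res = (S\<^sub>0 - a)\<^sup>-\<^sup>1\<close> and let \<open>gam h\<close> be the element of \<open>ker (T - a)\<close> with boundary
  value \<open>\<Gamma>0 (gam h) = h\<close>. Green's identity gives \<open>gam\<^sup>* = \<Gamma>1 res\<close>, and with it
  \<open>M'(a) = \<Gamma>1 res gam = gam\<^sup>* gam\<close>; so a factorization \<open>M'(a) = R\<^sup>* R\<close> means \<open>\<parallel>R h\<parallel> = \<parallel>gam h\<parallel>\<close>.
  From \<open>f = res (T - a) f + gam (\<Gamma>0 f)\<close> the regularized boundary values are therefore bounded by
  \<open>\<parallel>f\<parallel> + \<parallel>res (T - a) f\<parallel>\<close> and \<open>\<parallel>(T - a) f\<parallel>\<close>, and they are inverted by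
  \<open>f = gam (R\<^sup>-\<^sup>1 h0) + res (gam (R\<^sup>-\<^sup>1 h1))\<close>. Since \<open>res\<close> is symmetric, the gap of length \<open>2 \<epsilon>\<close> around \<open>a\<close>
  forces \<open>\<parallel>res\<parallel> \<le> 1 / \<epsilon>\<close>. All constants thus depend on \<open>a\<close> and \<open>\<epsilon>\<close> only, which is what the direct sum
  needs.
\<close>

section \<open>Hilbert spaces\<close>

text \<open>The bounds for the given maps and for their right inverses may blow up with n, and then
  the direct sum of the given triplets may fail to be a boundary triplet. The normalization cures
  this because \<open>gam\<close> composed with the inverse of R is an isometry. The given constants
  yield only qualitative facts (\<open>gam\<close> is bounded and bounded below); quantitative
  estimates for the new maps use R and \<open>gam\<close> only through this isometry. Subtracting
  M(a) \<Gamma>0 removes from \<Gamma>1 what it sees of ker (T - a), so the second new map depends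
  on (T - a) f only. The bound 1/\<epsilon> is found without spectral theory: a bounded symmetric B
  of norm K > 0 cannot have both B - K and B + K bounded below, while the gap makes res - \<mu>
  bounded below for |\<mu>| > 1/\<epsilon>. Apart from completeness of the Hilbert sum itself,
  completeness enters only through the contraction principle: for complex points near a, and for
  inverting M'(a). The summation must also rebuild the standing assumptions on the summed operator,
  among them equality of its deficiency indices.\<close>

lemma cring_complex_ring: "cring complex_ring"
proof (rule cringI)
  show "abelian_group complex_ring"
  proof (rule abelian_groupI)
    fix x :: complex
    show "\<exists>y\<in>carrier complex_ring. y \<oplus>\<^bsub>complex_ring\<^esub> x = \<zero>\<^bsub>complex_ring\<^esub>"
      by (rule bexI[of _ "-x"]) (auto simp: complex_ring_def)
  qed (auto simp: complex_ring_def)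
  show "comm_monoid complex_ring"
    by (rule comm_monoidI) (auto simp: complex_ring_def)
qed (auto simp: complex_ring_def algebra_simps)

context hilbert_space
begin

lemma scalars [simp]:
  "carrier complex_ring = UNIV" "\<one>\<^bsub>complex_ring\<^esub> = 1" "\<zero>\<^bsub>complex_ring\<^esub> = 0"
  by (simp_all add: complex_ring_def)

lemma smult_in [simp]: "x \<in> carrier H \<Longrightarrow> c \<odot> x \<in> carrier H"
  by simp

lemma minus_in [simp]: "x \<in> carrier H \<Longrightarrow> y \<in> carrier H \<Longrightarrow> x \<ominus> y \<in> carrier H"
  by simp

lemma smult_zero_left [simp]: "x \<in> carrier H \<Longrightarrow> 0 \<odot> x = \<zero>"
  and smult_one_left [simp]: "x \<in> carrier H \<Longrightarrow> 1 \<odot> x = x"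
  and smult_zero_right [simp]: "c \<odot> \<zero> = \<zero>"
  using smult_l_null[of x] smult_one[of x] smult_r_null[of c] by simp_all

lemma ip_zero_left [simp]: "z \<in> carrier H \<Longrightarrow> ip H \<zero> z = 0"
  using ip_add[of \<zero> \<zero> z] by simp

lemma ip_zero_right [simp]: "z \<in> carrier H \<Longrightarrow> ip H z \<zero> = 0"
  using ip_commute[of z \<zero>] by simp

lemma ip_uminus_left:
  assumes "x \<in> carrier H" "z \<in> carrier H"
  shows "ip H (\<ominus> x) z = - ip H x z"
proof -
  have "ip H (\<ominus> x) z + ip H x z = 0"
    using ip_add[of "\<ominus> x" x z] assms by (simp add: l_neg)
  thus ?thesis by (simp add: eq_neg_iff_add_eq_0)
qed

lemma ip_minus_left:
  "\<lbrakk>x \<in> carrier H; y \<in> carrier H; z \<in> carrier H\<rbrakk> \<Longrightarrow> ip H (x \<ominus> y) z = ip H x z - ip H y z"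
  by (simp add: a_minus_def ip_add ip_uminus_left)

lemma ip_add_right:
  "\<lbrakk>x \<in> carrier H; y \<in> carrier H; z \<in> carrier H\<rbrakk> \<Longrightarrow> ip H z (x \<oplus> y) = ip H z x + ip H z y"
  using ip_commute[of z "x \<oplus> y"] ip_commute[of z x] ip_commute[of z y] by (simp add: ip_add)

lemma ip_minus_right:
  "\<lbrakk>x \<in> carrier H; y \<in> carrier H; z \<in> carrier H\<rbrakk> \<Longrightarrow> ip H z (x \<ominus> y) = ip H z x - ip H z y"
  using ip_commute[of z "x \<ominus> y"] ip_commute[of z x] ip_commute[of z y] by (simp add: ip_minus_left)

lemma ip_uminus_right:
  "\<lbrakk>x \<in> carrier H; z \<in> carrier H\<rbrakk> \<Longrightarrow> ip H z (\<ominus> x) = - ip H z x"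
  using ip_commute[of z "\<ominus> x"] ip_commute[of z x] by (simp add: ip_uminus_left)

lemma ip_smult_right:
  "\<lbrakk>x \<in> carrier H; z \<in> carrier H\<rbrakk> \<Longrightarrow> ip H z (c \<odot> x) = cnj c * ip H z x"
  using ip_commute[of z "c \<odot> x"] ip_commute[of z x] by (simp add: ip_smult)

lemmas ip_linear = ip_add ip_smult ip_minus_left ip_uminus_left
  ip_add_right ip_smult_right ip_minus_right ip_uminus_right

lemma minus_eq_zeroD:
  assumes "x \<in> carrier H" "y \<in> carrier H" "x \<ominus> y = \<zero>"
  shows "x = y"
  using assms by (metis a_minus_def minus_equality minus_minus a_inv_closed)

text \<open>The workhorse for vector identities: testing against z turns them into identities of
  complex numbers, where \<open>ip_linear\<close> and ring arithmetic apply.\<close>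

lemma ip_eqI:
  assumes "x \<in> carrier H" "y \<in> carrier H" "\<And>z. z \<in> carrier H \<Longrightarrow> ip H x z = ip H y z"
  shows "x = y"
proof -
  have "ip H (x \<ominus> y) (x \<ominus> y) = 0"
    using assms(3)[of "x \<ominus> y"] assms(1,2) by (subst ip_minus_left) simp_all
  hence "x \<ominus> y = \<zero>"
    using ip_pos[of "x \<ominus> y"] assms by fastforce
  thus ?thesis using minus_eq_zeroD assms by blast
qed

lemma minus_zero_right [simp]: "x \<in> carrier H \<Longrightarrow> x \<ominus> \<zero> = x"
  by (rule ip_eqI) (simp_all add: ip_minus_left)

section \<open>Norm, Cauchy-Schwarz and triangle inequalities\<close>

lemma ip_self_nonneg: "x \<in> carrier H \<Longrightarrow> 0 \<le> Re (ip H x x)"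
  using ip_pos[of x] by (cases "x = \<zero>") auto

lemma vnorm_nonneg [simp]: "x \<in> carrier H \<Longrightarrow> 0 \<le> vnorm H x"
  by (simp add: vnorm_def ip_self_nonneg)

lemma vnorm_sq: "x \<in> carrier H \<Longrightarrow> (vnorm H x)\<^sup>2 = Re (ip H x x)"
  by (simp add: vnorm_def ip_self_nonneg)

lemma ip_self: "x \<in> carrier H \<Longrightarrow> ip H x x = complex_of_real ((vnorm H x)\<^sup>2)"
  using ip_commute[of x x] vnorm_sq[of x] by (simp add: complex_eq_iff)

lemma vnorm_zero [simp]: "vnorm H \<zero> = 0"
  by (simp add: vnorm_def)

lemma vnorm_eq_zero: "x \<in> carrier H \<Longrightarrow> vnorm H x = 0 \<longleftrightarrow> x = \<zero>"
  using ip_pos[of x] vnorm_sq[of x] by (cases "x = \<zero>") auto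

lemma vnorm_le_zeroD: "x \<in> carrier H \<Longrightarrow> vnorm H x \<le> 0 \<Longrightarrow> x = \<zero>"
  using vnorm_eq_zero[of x] order_antisym[OF _ vnorm_nonneg[of x]] by blast

lemma vnorm_smult: "x \<in> carrier H \<Longrightarrow> vnorm H (c \<odot> x) = cmod c * vnorm H x"
proof -
  assume x: "x \<in> carrier H"
  have "ip H (c \<odot> x) (c \<odot> x) = (c * cnj c) * ip H x x"
    using x by (simp add: ip_smult ip_smult_right)
  also have "\<dots> = complex_of_real ((cmod c * vnorm H x)\<^sup>2)"
    by (simp only: ip_self[OF x] complex_norm_square[symmetric]) (simp add: power_mult_distrib)
  finally show ?thesis
    using x by (simp add: vnorm_def[of H "c \<odot> x"])
qed

lemma vnorm_minus_commute:
  assumes "x \<in> carrier H" "y \<in> carrier H"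
  shows "vnorm H (x \<ominus> y) = vnorm H (y \<ominus> x)"
proof -
  have "x \<ominus> y = (-1) \<odot> (y \<ominus> x)"
    using assms by (intro ip_eqI) (simp_all add: ip_linear)
  thus ?thesis using assms by (simp add: vnorm_smult)
qed

lemma cauchy_schwarz:
  assumes x: "x \<in> carrier H" and y: "y \<in> carrier H"
  shows "cmod (ip H x y) \<le> vnorm H x * vnorm H y"
proof (cases "y = \<zero>")
  case True
  thus ?thesis using x by simp
next
  case False
  let ?b = "(vnorm H y)\<^sup>2"
  have b: "?b > 0" using False y vnorm_eq_zero[of y] by simp
  let ?c = "ip H x y"
  \<comment> \<open>\<open>?b\<close> times the component of x orthogonal to y. Its squared norm is
    \<open>?b\<close> times the difference of the two sides of the squared inequality.\<close>
  let ?w = "complex_of_real ?b \<odot> x \<ominus> ?c \<odot> y"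
  have cc: "ip H y x = cnj ?c" using ip_commute[OF y x] .
  have "ip H ?w ?w = complex_of_real ?b * (complex_of_real ?b * ip H x x) - complex_of_real ?b * (?c * cnj ?c)"
    using x y by (simp add: ip_linear cc ip_self[OF y]) (simp add: algebra_simps)
  also have "\<dots> = complex_of_real (?b * (?b * (vnorm H x)\<^sup>2 - (cmod ?c)\<^sup>2))"
    by (simp only: ip_self[OF x] complex_norm_square[symmetric]) (simp add: algebra_simps)
  finally have "Re (ip H ?w ?w) = ?b * (?b * (vnorm H x)\<^sup>2 - (cmod ?c)\<^sup>2)"
    by simp
  moreover have "0 \<le> Re (ip H ?w ?w)"
    by (rule ip_self_nonneg) (use x y in simp)
  ultimately have "0 \<le> ?b * (vnorm H x)\<^sup>2 - (cmod ?c)\<^sup>2"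
    using b by (simp add: zero_le_mult_iff)
  hence "(cmod ?c)\<^sup>2 \<le> (vnorm H x * vnorm H y)\<^sup>2"
    by (simp add: power_mult_distrib mult.commute)
  thus ?thesis using x y by (simp add: power2_le_iff_abs_le)
qed

lemma vnorm_add_sq:
  "\<lbrakk>x \<in> carrier H; y \<in> carrier H\<rbrakk> \<Longrightarrow>
     (vnorm H (x \<oplus> y))\<^sup>2 = (vnorm H x)\<^sup>2 + 2 * Re (ip H x y) + (vnorm H y)\<^sup>2"
  using ip_commute[of y x] by (simp add: vnorm_sq ip_linear)

lemma vnorm_minus_sq:
  "\<lbrakk>x \<in> carrier H; y \<in> carrier H\<rbrakk> \<Longrightarrow>
     (vnorm H (x \<ominus> y))\<^sup>2 = (vnorm H x)\<^sup>2 - 2 * Re (ip H x y) + (vnorm H y)\<^sup>2"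
  using ip_commute[of y x] by (simp add: vnorm_sq ip_linear)

lemma vnorm_triangle:
  assumes x: "x \<in> carrier H" and y: "y \<in> carrier H"
  shows "vnorm H (x \<oplus> y) \<le> vnorm H x + vnorm H y"
proof -
  have "Re (ip H x y) \<le> vnorm H x * vnorm H y"
    using cauchy_schwarz[OF x y] complex_Re_le_cmod order_trans by blast
  hence "(vnorm H (x \<oplus> y))\<^sup>2 \<le> (vnorm H x + vnorm H y)\<^sup>2"
    using vnorm_add_sq[OF x y] by (simp add: power2_sum)
  thus ?thesis using x y by (simp add: power2_le_iff_abs_le)
qed

lemma vnorm_uminus: "x \<in> carrier H \<Longrightarrow> vnorm H (\<ominus> x) = vnorm H x"
  by (simp add: vnorm_def ip_linear)

lemma vnorm_triangle_minus:
  assumes x: "x \<in> carrier H" and y: "y \<in> carrier H"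
  shows "vnorm H (x \<ominus> y) \<le> vnorm H x + vnorm H y"
  using vnorm_triangle[of x "\<ominus> y"] x y by (simp add: a_minus_def vnorm_uminus)

lemma vnorm_triangle3:
  assumes "x \<in> carrier H" "y \<in> carrier H" "z \<in> carrier H"
  shows "vnorm H (x \<ominus> z) \<le> vnorm H (x \<ominus> y) + vnorm H (y \<ominus> z)"
proof -
  have "x \<ominus> z = (x \<ominus> y) \<oplus> (y \<ominus> z)"
    using assms by (intro ip_eqI) (simp_all add: ip_linear)
  thus ?thesis using assms vnorm_triangle[of "x \<ominus> y" "y \<ominus> z"] by simp
qed

section \<open>Limits and the contraction principle\<close>

lemma tendsto_unique:
  assumes "\<And>n. X n \<in> carrier H" "x \<in> carrier H" "y \<in> carrier H"
    and "(\<lambda>n. vnorm H (X n \<ominus> x)) \<longlonglongrightarrow> 0" "(\<lambda>n. vnorm H (X n \<ominus> y)) \<longlonglongrightarrow> 0"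
  shows "x = y"
proof -
  have "(\<lambda>n. vnorm H (X n \<ominus> x) + vnorm H (X n \<ominus> y)) \<longlonglongrightarrow> 0"
    using tendsto_add[OF assms(4,5)] by simp
  moreover have "vnorm H (x \<ominus> y) \<le> vnorm H (X n \<ominus> x) + vnorm H (X n \<ominus> y)" for n
    using vnorm_triangle3[of x "X n" y] vnorm_minus_commute[of x "X n"] assms by simp
  ultimately have "vnorm H (x \<ominus> y) \<le> 0"
    by (intro LIMSEQ_le_const) auto
  hence "x \<ominus> y = \<zero>"
    using assms by (intro vnorm_le_zeroD) simp_all
  thus ?thesis using assms minus_eq_zeroD by blast
qed

text \<open>Picard iteration from zero. Contracting the pair \<open>X k\<close>, \<open>X 0\<close>
  n times bounds the distance of \<open>X (n + k)\<close> and \<open>X n\<close> by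
  \<open>q ^ n * ?d\<close> uniformly in k, so the sequence is Cauchy.\<close>

lemma fixed_point:
  assumes f: "\<And>x. x \<in> carrier H \<Longrightarrow> f x \<in> carrier H"
    and q: "0 \<le> q" "q < 1"
    and lip: "\<And>x y. \<lbrakk>x \<in> carrier H; y \<in> carrier H\<rbrakk>
      \<Longrightarrow> vnorm H (f x \<ominus> f y) \<le> q * vnorm H (x \<ominus> y)"
  obtains x where "x \<in> carrier H" "f x = x"
proof -
  define X where "X n = (f ^^ n) \<zero>" for n
  have X: "X n \<in> carrier H" for n
    by (induction n) (auto simp: X_def f)
  have XS: "X (Suc n) = f (X n)" for n by (simp add: X_def)
  \<comment> \<open>The sum of the geometric series. As
    \<open>q * ?d + \<parallel>X 1 - X 0\<parallel> = ?d\<close>, all iterates stay within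
    \<open>?d\<close> of \<open>X 0\<close>.\<close>
  let ?d = "vnorm H (X 1 \<ominus> X 0) / (1 - q)"
  have d0: "?d \<ge> 0" using X q by simp
  have step: "vnorm H (X k \<ominus> X 0) \<le> ?d" for k
  proof (induction k)
    case 0
    have "X 0 \<ominus> X 0 = \<zero>" using X by (simp add: r_neg a_minus_def)
    thus ?case using d0 by simp
  next
    case (Suc k)
    have "vnorm H (X (Suc k) \<ominus> X 0) \<le> vnorm H (X (Suc k) \<ominus> X 1) + vnorm H (X 1 \<ominus> X 0)"
      using X by (intro vnorm_triangle3)
    also have "vnorm H (X (Suc k) \<ominus> X 1) \<le> q * vnorm H (X k \<ominus> X 0)"
      using lip[OF X X, of k 0] by (simp add: XS)
    also have "\<dots> \<le> q * ?d" using Suc q by (intro mult_left_mono) auto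
    also have "q * ?d + vnorm H (X 1 \<ominus> X 0) = ?d" using q by (simp add: field_simps)
    finally show ?case by simp
  qed
  have bound: "vnorm H (X (n + k) \<ominus> X n) \<le> q ^ n * ?d" for n k
  proof (induction n)
    case 0 show ?case using step[of k] by simp
  next
    case (Suc n)
    have "vnorm H (X (Suc n + k) \<ominus> X (Suc n)) \<le> q * vnorm H (X (n + k) \<ominus> X n)"
      using lip[OF X X, of "n + k" n] by (simp add: XS)
    also have "\<dots> \<le> q * (q ^ n * ?d)" using Suc q by (intro mult_left_mono) auto
    finally show ?case by (simp add: mult.assoc)
  qed
  have lim: "(\<lambda>n. q ^ n * ?d) \<longlonglongrightarrow> 0"
    using q by (intro tendsto_mult_left_zero LIMSEQ_realpow_zero)
  have "\<exists>x\<in>carrier H. (\<lambda>n. vnorm H (X n \<ominus> x)) \<longlonglongrightarrow> 0"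
  proof (rule complete[OF X])
    fix e :: real assume "e > 0"
    then obtain N where N: "\<And>n. n \<ge> N \<Longrightarrow> q ^ n * ?d < e"
      using order_tendstoD(2)[OF lim] by (auto simp: eventually_sequentially)
    have "vnorm H (X m \<ominus> X n) < e" if "m \<ge> n" "n \<ge> N" for m n
      using bound[of n "m - n"] N[OF that(2)] that(1) by simp
    thus "\<exists>N. \<forall>m\<ge>N. \<forall>n\<ge>N. vnorm H (X m \<ominus> X n) < e"
      using vnorm_minus_commute[OF X X] by (metis nle_le)
  qed
  then obtain x where x: "x \<in> carrier H" "(\<lambda>n. vnorm H (X n \<ominus> x)) \<longlonglongrightarrow> 0" by blast
  have "(\<lambda>n. vnorm H (X (Suc n) \<ominus> f x)) \<longlonglongrightarrow> 0"
  proof (rule tendsto_sandwich[OF _ _ tendsto_const])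
    show "(\<lambda>n. q * vnorm H (X n \<ominus> x)) \<longlonglongrightarrow> 0"
      using tendsto_mult_right_zero[OF x(2)] by simp
    show "\<forall>\<^sub>F n in sequentially. vnorm H (X (Suc n) \<ominus> f x) \<le> q * vnorm H (X n \<ominus> x)"
      using lip[OF X x(1)] by (simp add: XS)
  qed (use X f x in simp)
  hence "(\<lambda>n. vnorm H (X n \<ominus> f x)) \<longlonglongrightarrow> 0"
    by (rule LIMSEQ_imp_Suc)
  hence "f x = x" using tendsto_unique[OF X f[OF x(1)] x(1) _ x(2)] by simp
  thus thesis using that x by blast
qed

end

section \<open>Unbounded operators\<close>

context hilbert_space
begin

text \<open>With K the norm of B, suppose K > r. Then B - K and B + K are both bounded below, hence
  so is their product B^2 - K^2. Expanding \<parallel>(B^2 - K^2) x\<parallel>^2 and using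
  \<parallel>B (B x)\<parallel> \<le> K \<parallel>B x\<parallel> bounds \<parallel>B x\<parallel>
  by a constant smaller than K times \<parallel>x\<parallel>, against the choice of K.\<close>

lemma symmetric_norm_bound:
  assumes B: "\<And>x. x \<in> carrier H \<Longrightarrow> B x \<in> carrier H"
    and sym: "\<And>x y. \<lbrakk>x \<in> carrier H; y \<in> carrier H\<rbrakk> \<Longrightarrow> ip H (B x) y = ip H x (B y)"
    and bnd: "\<And>x. x \<in> carrier H \<Longrightarrow> vnorm H (B x) \<le> C * vnorm H x"
    and r: "0 \<le> r"
    and below: "\<And>\<mu> :: real. r < \<bar>\<mu>\<bar> \<Longrightarrow>
      \<exists>c>0. \<forall>x\<in>carrier H. c * vnorm H x \<le> vnorm H (B x \<ominus> complex_of_real \<mu> \<odot> x)"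
    and x: "x \<in> carrier H"
  shows "vnorm H (B x) \<le> r * vnorm H x"
proof -
  define A where "A = {vnorm H (B x) |x. x \<in> carrier H \<and> vnorm H x = 1}"
  \<comment> \<open>Adjoining 0 covers the trivial space, where A is empty.\<close>
  define K where "K = Sup (insert 0 A)"
  \<comment> \<open>Linearity comes from symmetry: both sides have the same inner products.\<close>
  have Bsmult: "B (c \<odot> x) = c \<odot> B x" if "x \<in> carrier H" for c x
    using that B by (intro ip_eqI) (simp_all add: sym ip_linear)
  have Badd: "B (x \<oplus> y) = B x \<oplus> B y" if "x \<in> carrier H" "y \<in> carrier H" for x y
    using that B by (intro ip_eqI) (simp_all add: sym ip_linear)
  have bddA: "bdd_above (insert 0 A)"
  proof (rule bdd_aboveI[of _ "\<bar>C\<bar>"])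
    show "a \<le> \<bar>C\<bar>" if "a \<in> insert 0 A" for a
      using that bnd unfolding A_def by fastforce
  qed
  have K0: "0 \<le> K" unfolding K_def using bddA by (intro cSup_upper) auto
  have scale: "vnorm H (B x) \<le> k * vnorm H x"
    if k: "\<And>a. a \<in> A \<Longrightarrow> a \<le> k" and x: "x \<in> carrier H" for x k
  proof (cases "x = \<zero>")
    case True
    thus ?thesis using bnd[of x] x B[of x] by (simp add: vnorm_eq_zero)
  next
    case False
    let ?t = "vnorm H x"
    have t: "?t > 0" using False x vnorm_eq_zero[of x] vnorm_nonneg[of x] by linarith
    let ?y = "complex_of_real (1 / ?t) \<odot> x"
    have "vnorm H ?y = 1" using t x by (simp add: vnorm_smult norm_divide)
    hence "vnorm H (B ?y) \<in> A" using x smult_in unfolding A_def by blast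
    hence "vnorm H (B ?y) \<le> k" by (rule k)
    moreover have "vnorm H (B ?y) = vnorm H (B x) / ?t"
      using t x B by (subst Bsmult) (simp_all add: vnorm_smult norm_divide)
    ultimately show ?thesis using t by (simp add: pos_divide_le_eq)
  qed
  have BK: "vnorm H (B x) \<le> K * vnorm H x" if "x \<in> carrier H" for x
    using that bddA unfolding K_def by (intro scale cSup_upper) auto
  have "K \<le> r"
  proof (rule ccontr)
    assume "\<not> K \<le> r"
    hence Kr: "K > r" "K > 0" using r by auto
    from below[of K] Kr obtain c where c: "c > 0"
      "\<And>x. x \<in> carrier H \<Longrightarrow> c * vnorm H x \<le> vnorm H (B x \<ominus> complex_of_real K \<odot> x)"
      by auto
    from below[of "-K"] Kr obtain c' where c': "c' > 0"
      "\<And>x. x \<in> carrier H \<Longrightarrow> c' * vnorm H x \<le> vnorm H (B x \<ominus> complex_of_real (-K) \<odot> x)"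
      by auto
    define d where "d = (c * c')\<^sup>2"
    have d: "d > 0" using c c' by (simp add: d_def)
    have key: "(vnorm H (B x))\<^sup>2 \<le> (K\<^sup>2 - d / K\<^sup>2) * (vnorm H x)\<^sup>2" if x: "x \<in> carrier H" for x
    proof -
      let ?y = "B x \<ominus> complex_of_real (-K) \<odot> x"
      have y: "?y \<in> carrier H" using x B by simp
      have eq: "B ?y \<ominus> complex_of_real K \<odot> ?y = B (B x) \<ominus> complex_of_real (K\<^sup>2) \<odot> x"
        using x B by (intro ip_eqI) (simp_all add: sym ip_linear power2_eq_square algebra_simps)
      have "c * (c' * vnorm H x) \<le> c * vnorm H ?y"
        using c c'(2)[OF x] by (intro mult_left_mono) auto
      also have "\<dots> \<le> vnorm H (B (B x) \<ominus> complex_of_real (K\<^sup>2) \<odot> x)"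
        using c(2)[OF y] eq by simp
      finally have "(c * (c' * vnorm H x))\<^sup>2 \<le> (vnorm H (B (B x) \<ominus> complex_of_real (K\<^sup>2) \<odot> x))\<^sup>2"
        using c c' x by (intro power_mono) auto
      also have "\<dots> = (vnorm H (B (B x)))\<^sup>2 - 2 * K\<^sup>2 * (vnorm H (B x))\<^sup>2 + K\<^sup>2 * K\<^sup>2 * (vnorm H x)\<^sup>2"
      proof -
        have "ip H (B (B x)) (complex_of_real k \<odot> x) = complex_of_real (k * (vnorm H (B x))\<^sup>2)" for k
          using x B sym[of "B x" x] by (simp add: ip_smult_right ip_self)
        hence "(vnorm H (B (B x) \<ominus> complex_of_real k \<odot> x))\<^sup>2
          = (vnorm H (B (B x)))\<^sup>2 - 2 * k * (vnorm H (B x))\<^sup>2 + k * k * (vnorm H x)\<^sup>2" for k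
          using x B by (subst vnorm_minus_sq) (simp_all add: vnorm_smult power_mult_distrib power2_eq_square)
        thus ?thesis .
      qed
      also have "(vnorm H (B (B x)))\<^sup>2 \<le> (K * vnorm H (B x))\<^sup>2"
        using BK[of "B x"] x B by (intro power_mono) auto
      finally have "d * (vnorm H x)\<^sup>2 \<le> K\<^sup>2 * (K\<^sup>2 * (vnorm H x)\<^sup>2 - (vnorm H (B x))\<^sup>2)"
        by (simp add: d_def power_mult_distrib algebra_simps)
      hence "d * (vnorm H x)\<^sup>2 / K\<^sup>2 \<le> K\<^sup>2 * (vnorm H x)\<^sup>2 - (vnorm H (B x))\<^sup>2"
        using Kr by (simp add: pos_divide_le_eq mult.commute)
      thus ?thesis by (simp add: algebra_simps)
    qed
    \<comment> \<open>\<open>max\<close> keeps the radicand nonnegative when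
      \<open>d > K ^ 4\<close>. An upper bound \<open>?k < K\<close> for A contradicts the
      supremum.\<close>
    let ?k = "sqrt (max 0 (K\<^sup>2 - d / K\<^sup>2))"
    have "max 0 (K\<^sup>2 - d / K\<^sup>2) < K\<^sup>2" using d Kr by simp
    hence k: "?k < K" using Kr real_sqrt_less_mono[of "max 0 (K\<^sup>2 - d / K\<^sup>2)" "K\<^sup>2"] by simp
    have "a \<le> ?k" if a: "a \<in> insert 0 A" for a
    proof (cases "a = 0")
      case False
      then obtain x where x: "x \<in> carrier H" "vnorm H x = 1" "a = vnorm H (B x)"
        using a unfolding A_def by auto
      have "a\<^sup>2 \<le> max 0 (K\<^sup>2 - d / K\<^sup>2)" using key[OF x(1)] x by simp
      thus ?thesis by (rule real_le_rsqrt)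
    qed simp
    hence "K \<le> ?k" unfolding K_def by (intro cSup_least) auto
    thus False using k by simp
  qed
  hence "K * vnorm H x \<le> r * vnorm H x" using x by (intro mult_right_mono) auto
  thus ?thesis using BK[OF x] by simp
qed

text \<open>Lax-Milgram by iteration: for suitable t > 0 the map that sends x to x - t (D x - y) is
  a contraction, because coercivity makes the first-order term in t negative. Its fixed point solves
  D x = y.\<close>

lemma surj_of_coercive:
  assumes D: "\<And>x. x \<in> carrier H \<Longrightarrow> D x \<in> carrier H"
    and minus: "\<And>x y. \<lbrakk>x \<in> carrier H; y \<in> carrier H\<rbrakk> \<Longrightarrow> D (x \<ominus> y) = D x \<ominus> D y"
    and bnd: "\<And>x. x \<in> carrier H \<Longrightarrow> vnorm H (D x) \<le> C * vnorm H x"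
    and c: "c > 0" "\<And>x. x \<in> carrier H \<Longrightarrow> c * (vnorm H x)\<^sup>2 \<le> Re (ip H (D x) x)"
    and y: "y \<in> carrier H"
  obtains x where "x \<in> carrier H" "D x = y"
proof -
  \<comment> \<open>Adding c ensures K > 0 and c \<le> K, so that the radicand in q is nonnegative.
    The step t = c/K^2 minimizes 1 - 2 t c + t^2 K^2, and the minimum is q^2.\<close>
  define K where "K = \<bar>C\<bar> + c"
  have K: "K > 0" "c \<le> K" using c by (auto simp: K_def)
  have BK: "vnorm H (D x) \<le> K * vnorm H x" if "x \<in> carrier H" for x
  proof -
    have "C * vnorm H x \<le> K * vnorm H x" using that c by (intro mult_right_mono) (auto simp: K_def)
    thus ?thesis using bnd[OF that] by simp
  qed
  define t where "t = c / K\<^sup>2"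
  have t: "t > 0" using c K by (simp add: t_def)
  define q where "q = sqrt (1 - c\<^sup>2 / K\<^sup>2)"
  have "c\<^sup>2 / K\<^sup>2 \<le> 1" using K c by (simp add: power_mono)
  hence q: "0 \<le> q" "q < 1" "q\<^sup>2 = 1 - c\<^sup>2 / K\<^sup>2" using c K by (auto simp: q_def)
  let ?f = "\<lambda>x. x \<ominus> complex_of_real t \<odot> (D x \<ominus> y)"
  have "vnorm H (?f u \<ominus> ?f v) \<le> q * vnorm H (u \<ominus> v)" if u: "u \<in> carrier H" and v: "v \<in> carrier H" for u v
  proof -
    let ?w = "u \<ominus> v"
    have w: "?w \<in> carrier H" using u v by simp
    have eq: "?f u \<ominus> ?f v = ?w \<ominus> complex_of_real t \<odot> D ?w"
      using u v D y by (intro ip_eqI) (simp_all add: minus ip_linear algebra_simps)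
    have "(vnorm H (?f u \<ominus> ?f v))\<^sup>2
        = (vnorm H ?w)\<^sup>2 - 2 * t * Re (ip H (D ?w) ?w) + t\<^sup>2 * (vnorm H (D ?w))\<^sup>2"
      unfolding eq using w D ip_commute[OF w D[OF w]]
      by (simp add: vnorm_minus_sq vnorm_smult ip_smult_right power_mult_distrib del: minus_in)
    also have "\<dots> \<le> (vnorm H ?w)\<^sup>2 - 2 * t * (c * (vnorm H ?w)\<^sup>2) + t\<^sup>2 * (K * vnorm H ?w)\<^sup>2"
      using c(2)[OF w] BK[OF w] t w D
      by (intro add_mono diff_mono mult_left_mono power_mono) auto
    also have "\<dots> = q\<^sup>2 * (vnorm H ?w)\<^sup>2"
      unfolding q(3) t_def using K by (simp add: field_simps power2_eq_square)
    also have "\<dots> = (q * vnorm H ?w)\<^sup>2" by (simp add: power_mult_distrib)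
    finally show ?thesis using q w by (simp add: power2_le_iff_abs_le)
  qed
  moreover have "?f x \<in> carrier H" if "x \<in> carrier H" for x using that y D by simp
  ultimately obtain x where x: "x \<in> carrier H" "?f x = x"
    using fixed_point[of ?f q] q by blast
  have "ip H (D x) z = ip H y z" if z: "z \<in> carrier H" for z
  proof -
    have "ip H (?f x) z = ip H x z - complex_of_real t * (ip H (D x) z - ip H y z)"
      using x(1) z D y by (simp add: ip_linear)
    thus ?thesis unfolding x(2) using t by simp
  qed
  hence "D x = y" using x D y by (intro ip_eqI) auto
  thus thesis using that x by blast
qed

end

section \<open>Linear operators as partial maps\<close>

locale linear_op = H: hilbert_space H + K: hilbert_space K
  for H :: "'a hilbert" and K :: "'b hilbert" and T :: "('a, 'b) operator" +
  assumes lin: "linear_operator H K T"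
begin

lemma subm: "submodule (dom T) complex_ring H"
  using lin by (simp add: linear_operator_def)

lemma dom_in [simp]: "x \<in> dom T \<Longrightarrow> x \<in> carrier H"
  using H.submoduleE(1)[OF subm] by blast

lemma app_in [simp]: "x \<in> dom T \<Longrightarrow> T \<cdot> x \<in> carrier K"
  using lin by (auto simp: linear_operator_def ran_def)

lemma dom_smult [simp]: "x \<in> dom T \<Longrightarrow> c \<odot>\<^bsub>H\<^esub> x \<in> dom T"
  using H.submoduleE(4)[OF subm] by simp

lemma dom_add [simp]: "x \<in> dom T \<Longrightarrow> y \<in> dom T \<Longrightarrow> x \<oplus>\<^bsub>H\<^esub> y \<in> dom T"
  using H.submoduleE(5)[OF subm] by blast

lemma dom_minus [simp]: "x \<in> dom T \<Longrightarrow> y \<in> dom T \<Longrightarrow> x \<ominus>\<^bsub>H\<^esub> y \<in> dom T"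
  using H.submoduleE(3)[OF subm] by (simp add: a_minus_def)

lemma dom_zero [simp]: "\<zero>\<^bsub>H\<^esub> \<in> dom T"
  using subgroup.one_closed[OF submodule.axioms(1)[OF subm]] by simp

lemma app_add: "x \<in> dom T \<Longrightarrow> y \<in> dom T \<Longrightarrow> T \<cdot> (x \<oplus>\<^bsub>H\<^esub> y) = T \<cdot> x \<oplus>\<^bsub>K\<^esub> T \<cdot> y"
  using lin by (simp add: linear_operator_def)

lemma app_smult: "x \<in> dom T \<Longrightarrow> T \<cdot> (c \<odot>\<^bsub>H\<^esub> x) = c \<odot>\<^bsub>K\<^esub> T \<cdot> x"
  using lin by (simp add: linear_operator_def)

lemma app_minus:
  assumes "x \<in> dom T" "y \<in> dom T"
  shows "T \<cdot> (x \<ominus>\<^bsub>H\<^esub> y) = T \<cdot> x \<ominus>\<^bsub>K\<^esub> T \<cdot> y"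
proof -
  have "x \<ominus>\<^bsub>H\<^esub> y = x \<oplus>\<^bsub>H\<^esub> (-1) \<odot>\<^bsub>H\<^esub> y"
    using assms by (intro H.ip_eqI) (simp_all add: H.ip_linear)
  hence "T \<cdot> (x \<ominus>\<^bsub>H\<^esub> y) = T \<cdot> x \<oplus>\<^bsub>K\<^esub> (-1) \<odot>\<^bsub>K\<^esub> T \<cdot> y"
    using assms by (simp add: app_add app_smult)
  also have "\<dots> = T \<cdot> x \<ominus>\<^bsub>K\<^esub> T \<cdot> y"
    using assms by (intro K.ip_eqI) (simp_all add: K.ip_linear)
  finally show ?thesis .
qed

lemma app_zero [simp]: "T \<cdot> \<zero>\<^bsub>H\<^esub> = \<zero>\<^bsub>K\<^esub>"
proof -
  have "T \<cdot> (0 \<odot>\<^bsub>H\<^esub> \<zero>\<^bsub>H\<^esub>) = 0 \<odot>\<^bsub>K\<^esub> T \<cdot> \<zero>\<^bsub>H\<^esub>" by (rule app_smult) simp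
  thus ?thesis using app_in[OF dom_zero] by simp
qed

end

lemma linear_operatorI:
  assumes "hilbert_space H"
    and "\<And>x. x \<in> dom T \<Longrightarrow> x \<in> carrier H"
    and "\<zero>\<^bsub>H\<^esub> \<in> dom T"
    and "\<And>x y. \<lbrakk>x \<in> dom T; y \<in> dom T\<rbrakk> \<Longrightarrow> x \<oplus>\<^bsub>H\<^esub> y \<in> dom T"
    and "\<And>c x. x \<in> dom T \<Longrightarrow> c \<odot>\<^bsub>H\<^esub> x \<in> dom T"
    and "\<And>x. x \<in> dom T \<Longrightarrow> T \<cdot> x \<in> carrier K"
    and "\<And>x y. \<lbrakk>x \<in> dom T; y \<in> dom T\<rbrakk> \<Longrightarrow> T \<cdot> (x \<oplus>\<^bsub>H\<^esub> y) = T \<cdot> x \<oplus>\<^bsub>K\<^esub> T \<cdot> y"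
    and "\<And>c x. x \<in> dom T \<Longrightarrow> T \<cdot> (c \<odot>\<^bsub>H\<^esub> x) = c \<odot>\<^bsub>K\<^esub> T \<cdot> x"
  shows "linear_operator H K T"
proof -
  interpret hilbert_space H by fact
  have "submodule (dom T) complex_ring H"
  proof (rule submoduleI)
    fix x assume x: "x \<in> dom T"
    have "\<ominus>\<^bsub>H\<^esub> x = (-1) \<odot>\<^bsub>H\<^esub> x"
      using assms(2)[OF x] by (intro ip_eqI) (simp_all add: ip_linear)
    thus "\<ominus>\<^bsub>H\<^esub> x \<in> dom T" using assms(5)[OF x] by simp
  qed (use assms in auto)
  moreover have "ran T \<subseteq> carrier K"
    using assms(6) by (force simp: ran_def dom_def)
  ultimately show ?thesis
    unfolding linear_operator_def using assms(7,8) by blast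
qed

lemma bounded_operator_iff:
  "bounded_operator H K T \<longleftrightarrow> linear_operator H K T \<and> dom T = carrier H \<and>
     (\<exists>C>0. \<forall>x\<in>carrier H. vnorm K (T \<cdot> x) \<le> C * vnorm H x)" if "hilbert_space H"
proof -
  interpret hilbert_space H by fact
  have "\<exists>C>0. \<forall>x\<in>carrier H. vnorm K (T \<cdot> x) \<le> C * vnorm H x"
    if C: "\<forall>x\<in>carrier H. vnorm K (T \<cdot> x) \<le> C * vnorm H x" for C
  proof (intro exI[of _ "\<bar>C\<bar> + 1"] conjI ballI)
    fix x assume x: "x \<in> carrier H"
    have "C * vnorm H x \<le> (\<bar>C\<bar> + 1) * vnorm H x" using x by (intro mult_right_mono) auto
    thus "vnorm K (T \<cdot> x) \<le> (\<bar>C\<bar> + 1) * vnorm H x" using C x by fastforce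
  qed simp
  thus ?thesis unfolding bounded_operator_def by blast
qed

section \<open>Shifts, inverses and resolvent points\<close>

lemma dom_op_shift [simp]: "dom (op_shift H T z) = dom T"
  by (auto simp: op_shift_def dom_def)

lemma app_op_shift: "x \<in> dom T \<Longrightarrow> op_shift H T z \<cdot> x = T \<cdot> x \<ominus>\<^bsub>H\<^esub> z \<odot>\<^bsub>H\<^esub> x"
  by (auto simp: op_shift_def dom_def)

lemma ran_eq_image: "ran T = app T ` dom T"
  by (force simp: ran_def dom_def)

lemma dom_op_inverse [simp]: "dom (op_inverse T) = ran T"
  by (auto simp: op_inverse_def dom_def)

lemma op_inverse_app:
  assumes "inj_on (app T) (dom T)" "x \<in> dom T"
  shows "op_inverse T (T \<cdot> x) = Some x"
  using assms(2) by (simp add: op_inverse_def ran_eq_image inv_into_f_f[OF assms])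

lemma op_inverse_SomeD:
  assumes "op_inverse T y = Some x"
  shows "x \<in> dom T" "T \<cdot> x = y"
proof -
  have y: "y \<in> app T ` dom T" and x: "x = inv_into (dom T) (app T) y"
    using assms by (simp_all add: op_inverse_def ran_eq_image split: if_splits)
  show "x \<in> dom T" "T \<cdot> x = y"
    unfolding x using inv_into_into[OF y] f_inv_into_f[OF y] by blast+
qed

text \<open>The partial inverse is replaced by the two facts used later: its domain is the range of
  T - z, which gives solvability, and its boundedness is a lower bound for T - z.\<close>

lemma resolvent_setD:
  assumes H: "hilbert_space H" and z: "z \<in> resolvent_set H T"
  shows "g \<in> carrier H \<Longrightarrow> \<exists>f\<in>dom T. T \<cdot> f \<ominus>\<^bsub>H\<^esub> z \<odot>\<^bsub>H\<^esub> f = g"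
    and "\<exists>C>0. \<forall>f\<in>dom T. vnorm H f \<le> C * vnorm H (T \<cdot> f \<ominus>\<^bsub>H\<^esub> z \<odot>\<^bsub>H\<^esub> f)"
proof -
  let ?R = "op_inverse (op_shift H T z)"
  have inj: "inj_on (app (op_shift H T z)) (dom (op_shift H T z))"
    and bdd: "bounded_operator H H ?R"
    using z by (simp_all add: resolvent_set_def)
  have ran: "ran (op_shift H T z) = carrier H"
    using bdd by (simp add: bounded_operator_def)
  show "\<exists>f\<in>dom T. T \<cdot> f \<ominus>\<^bsub>H\<^esub> z \<odot>\<^bsub>H\<^esub> f = g" if g: "g \<in> carrier H"
  proof -
    obtain f where "f \<in> dom T" "g = op_shift H T z \<cdot> f"
      using g unfolding ran[symmetric] ran_eq_image dom_op_shift by blast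
    thus ?thesis using app_op_shift by metis
  qed
  obtain C where C: "C > 0" "\<forall>x\<in>carrier H. vnorm H (?R \<cdot> x) \<le> C * vnorm H x"
    using bdd unfolding bounded_operator_iff[OF H] by blast
  have "vnorm H f \<le> C * vnorm H (T \<cdot> f \<ominus>\<^bsub>H\<^esub> z \<odot>\<^bsub>H\<^esub> f)" if f: "f \<in> dom T" for f
  proof -
    have "op_shift H T z \<cdot> f \<in> carrier H"
      using f unfolding ran[symmetric] ran_eq_image by simp
    moreover have "?R \<cdot> (op_shift H T z \<cdot> f) = f"
      using op_inverse_app[OF inj, of f] f by simp
    ultimately have "vnorm H f \<le> C * vnorm H (op_shift H T z \<cdot> f)"
      using C(2) by metis
    thus ?thesis unfolding app_op_shift[OF f] .
  qed
  thus "\<exists>C>0. \<forall>f\<in>dom T. vnorm H f \<le> C * vnorm H (T \<cdot> f \<ominus>\<^bsub>H\<^esub> z \<odot>\<^bsub>H\<^esub> f)"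
    using C by blast
qed

section \<open>Adjoints and defect spaces\<close>

context hilbert_space
begin

text \<open>Pythagoras: a y in the domain that is closer to x than \<parallel>x\<parallel> is
  incompatible with \<parallel>x - y\<parallel>^2 = \<parallel>x\<parallel>^2 +
  \<parallel>y\<parallel>^2.\<close>

lemma orthogonal_dense_zero:
  assumes dense: "densely_defined H S" and sub: "dom S \<subseteq> carrier H"
    and x: "x \<in> carrier H" "\<And>f. f \<in> dom S \<Longrightarrow> ip H f x = 0"
  shows "x = \<zero>"
proof (rule ccontr)
  assume "x \<noteq> \<zero>"
  hence "vnorm H x > 0" using x vnorm_eq_zero[of x] vnorm_nonneg[of x] by linarith
  then obtain y where y: "y \<in> dom S" "vnorm H (x \<ominus> y) < vnorm H x"
    using dense x unfolding densely_defined_def by blast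
  have yc: "y \<in> carrier H" using sub y by blast
  have "(vnorm H (x \<ominus> y))\<^sup>2 = (vnorm H x)\<^sup>2 + (vnorm H y)\<^sup>2"
    using x y yc ip_commute[of x y] by (simp add: vnorm_minus_sq)
  moreover have "(vnorm H (x \<ominus> y))\<^sup>2 < (vnorm H x)\<^sup>2"
    using x yc y by (intro power_strict_mono) auto
  ultimately show False using zero_le_power2[of "vnorm H y"] by linarith
qed

text \<open>Density makes the vector of the definite description unique. Later arguments about
  adjoints use this equivalence in place of the description.\<close>

lemma op_adjoint_eq_Some_iff:
  assumes dense: "densely_defined H S" and sub: "dom S \<subseteq> carrier H"
  shows "op_adjoint H S g = Some h \<longleftrightarrow> g \<in> carrier H \<and> h \<in> carrier H \<and>
    (\<forall>f\<in>dom S. ip H (S \<cdot> f) g = ip H f h)" (is "?L \<longleftrightarrow> ?R")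
proof -
  let ?P = "\<lambda>h. h \<in> carrier H \<and> (\<forall>f\<in>dom S. ip H (S \<cdot> f) g = ip H f h)"
  have uniq: "h = h'" if h: "?P h" and h': "?P h'" for h h'
  proof -
    have "ip H f (h \<ominus> h') = 0" if f: "f \<in> dom S" for f
    proof -
      have "f \<in> carrier H" using f sub by blast
      moreover have "ip H f h = ip H f h'" using h h' f by metis
      ultimately show ?thesis using h h' by (simp add: ip_minus_right)
    qed
    hence "h \<ominus> h' = \<zero>"
      using orthogonal_dense_zero[OF dense sub, of "h \<ominus> h'"] h h' by blast
    thus ?thesis using minus_eq_zeroD h h' by blast
  qed
  have the: "(THE h. ?P h) = h" if "?P h" for h
    using that uniq by (intro the_equality) blast+
  show ?thesis
  proof
    assume L: ?L
    hence ex: "g \<in> carrier H" "\<exists>h. ?P h" and h: "h = (THE h. ?P h)"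
      by (auto simp: op_adjoint_def Let_def split: if_splits)
    from ex(2) obtain k where k: "?P k" by blast
    hence "h = k" using the h by simp
    thus ?R using ex k by blast
  next
    assume R: ?R
    hence P: "?P h" and g: "g \<in> carrier H" by blast+
    hence ex: "\<exists>h. ?P h" by blast
    show ?L unfolding op_adjoint_def Let_def using ex g the[OF P] by auto
  qed
qed

end

lemma linear_op_adjoint:
  assumes H: "hilbert_space H" and S: "linear_operator H H S" and dense: "densely_defined H S"
  shows "linear_operator H H (op_adjoint H S)"
proof -
  interpret S: linear_op H H S by (intro linear_op.intro linear_op_axioms.intro H S)
  let ?T = "op_adjoint H S"
  have iff: "?T g = Some h \<longleftrightarrow> g \<in> carrier H \<and> h \<in> carrier H \<and>
    (\<forall>f\<in>dom S. ip H (S \<cdot> f) g = ip H f h)" for g h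
    by (rule S.H.op_adjoint_eq_Some_iff[OF dense]) (auto intro: S.dom_in)
  have add: "?T (x \<oplus>\<^bsub>H\<^esub> y) = Some (u \<oplus>\<^bsub>H\<^esub> v)" if "?T x = Some u" "?T y = Some v" for x y u v
    using that unfolding iff by (auto simp: S.H.ip_linear)
  have smult: "?T (c \<odot>\<^bsub>H\<^esub> x) = Some (c \<odot>\<^bsub>H\<^esub> u)" if "?T x = Some u" for x u c
    using that unfolding iff by (auto simp: S.H.ip_linear)
  have zero: "?T \<zero>\<^bsub>H\<^esub> = Some \<zero>\<^bsub>H\<^esub>" unfolding iff by auto
  show ?thesis
  proof (rule linear_operatorI[OF H])
    show "x \<in> carrier H" if "x \<in> dom ?T" for x using that iff by auto
    show "\<zero>\<^bsub>H\<^esub> \<in> dom ?T" using zero by auto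
    fix x y c assume x: "x \<in> dom ?T"
    then obtain u where u: "?T x = Some u" by blast
    have "u \<in> carrier H" using u unfolding iff by blast
    thus "?T \<cdot> x \<in> carrier H" using u by simp
    show "c \<odot>\<^bsub>H\<^esub> x \<in> dom ?T" "?T \<cdot> (c \<odot>\<^bsub>H\<^esub> x) = c \<odot>\<^bsub>H\<^esub> ?T \<cdot> x"
      using smult[OF u] u by auto
    assume "y \<in> dom ?T"
    then obtain v where v: "?T y = Some v" by blast
    show "x \<oplus>\<^bsub>H\<^esub> y \<in> dom ?T" "?T \<cdot> (x \<oplus>\<^bsub>H\<^esub> y) = ?T \<cdot> x \<oplus>\<^bsub>H\<^esub> ?T \<cdot> y"
      using add[OF u v] u v by auto
  qed
qed

lemma mem_defect_space_iff:
  assumes H: "hilbert_space H" and S: "linear_operator H H S" "densely_defined H S"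
  shows "f \<in> defect_space H S z \<longleftrightarrow> f \<in> dom (op_adjoint H S) \<and> op_adjoint H S \<cdot> f = z \<odot>\<^bsub>H\<^esub> f"
proof -
  let ?T = "op_adjoint H S"
  interpret T: linear_op H H ?T
    by (intro linear_op.intro linear_op_axioms.intro H linear_op_adjoint S)
  have "?T \<cdot> f \<ominus>\<^bsub>H\<^esub> z \<odot>\<^bsub>H\<^esub> f = \<zero>\<^bsub>H\<^esub> \<longleftrightarrow> ?T \<cdot> f = z \<odot>\<^bsub>H\<^esub> f" if f: "f \<in> dom ?T"
    using T.app_in[OF f] T.dom_in[OF f] T.H.minus_eq_zeroD[of "?T \<cdot> f" "z \<odot>\<^bsub>H\<^esub> f"]
    by (auto simp: a_minus_def T.H.r_neg simp del: domIff)
  thus ?thesis unfolding defect_space_def op_ker_def mem_Collect_eq dom_op_shift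
    using app_op_shift[of f ?T H z] by metis
qed

section \<open>Boundary triplets with a spectral gap\<close>

locale triplet =
  fixes H :: "'a hilbert" and S :: "('a, 'a) operator" and G :: "'b hilbert"
    and \<Gamma>0 \<Gamma>1 :: "('a, 'b) operator"
  assumes bt: "boundary_triplet H S G \<Gamma>0 \<Gamma>1"
begin

abbreviation T where "T \<equiv> op_adjoint H S"

lemma hilbert_H: "hilbert_space H" and hilbert_G: "hilbert_space G"
  and dd_closed_symmetric: "dd_closed_symmetric H S"
  and equal_deficiency_indices: "equal_deficiency_indices H S"
  and linear_\<Gamma>0: "linear_operator H G \<Gamma>0" and linear_\<Gamma>1: "linear_operator H G \<Gamma>1"
  and dom_\<Gamma>0 [simp]: "dom \<Gamma>0 = dom T" and dom_\<Gamma>1 [simp]: "dom \<Gamma>1 = dom T"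
  using bt by (simp_all add: boundary_triplet_def)

lemma \<Gamma>1_bounded:
  "\<exists>C. \<forall>f\<in>dom T. vnorm G (\<Gamma>1 \<cdot> f) \<le> C * sqrt ((vnorm H f)\<^sup>2 + (vnorm H (T \<cdot> f))\<^sup>2)"
  and \<Gamma>0_bounded:
  "\<exists>C. \<forall>f\<in>dom T. vnorm G (\<Gamma>0 \<cdot> f) \<le> C * sqrt ((vnorm H f)\<^sup>2 + (vnorm H (T \<cdot> f))\<^sup>2)"
  using bt unfolding boundary_triplet_def by blast+

lemma green:
  "\<lbrakk>f \<in> dom T; g \<in> dom T\<rbrakk> \<Longrightarrow> ip H (T \<cdot> f) g - ip H f (T \<cdot> g)
     = ip G (\<Gamma>1 \<cdot> f) (\<Gamma>0 \<cdot> g) - ip G (\<Gamma>0 \<cdot> f) (\<Gamma>1 \<cdot> g)"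
  using bt unfolding boundary_triplet_def by blast

lemma surj:
  "\<lbrakk>h0 \<in> carrier G; h1 \<in> carrier G\<rbrakk> \<Longrightarrow> \<exists>f\<in>dom T. \<Gamma>0 \<cdot> f = h0 \<and> \<Gamma>1 \<cdot> f = h1"
  using bt unfolding boundary_triplet_def by blast

lemma linear_T: "linear_operator H H T"
  by (rule linear_op_adjoint[OF hilbert_H])
    (use dd_closed_symmetric in \<open>simp_all add: dd_closed_symmetric_def\<close>)

end

sublocale triplet \<subseteq> H: hilbert_space H by (rule hilbert_H)
sublocale triplet \<subseteq> G: hilbert_space G by (rule hilbert_G)
sublocale triplet \<subseteq> T: linear_op H H "op_adjoint H S"
  by (intro linear_op.intro linear_op_axioms.intro hilbert_H linear_T)
text \<open>The rewrite states domain conditions for the boundary map in terms of the adjoint, so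
  that one membership fact serves \<open>T\<close>, \<open>\<Gamma>0\<close> and
  \<open>\<Gamma>1\<close>.\<close>

sublocale triplet \<subseteq> \<Gamma>0: linear_op H G \<Gamma>0
  rewrites "dom \<Gamma>0 = dom (op_adjoint H S)"
  by (intro linear_op.intro linear_op_axioms.intro hilbert_H hilbert_G linear_\<Gamma>0) simp
sublocale triplet \<subseteq> \<Gamma>1: linear_op H G \<Gamma>1
  rewrites "dom \<Gamma>1 = dom (op_adjoint H S)"
  by (intro linear_op.intro linear_op_axioms.intro hilbert_H hilbert_G linear_\<Gamma>1) simp

locale triplet_gap = triplet +
  fixes a \<epsilon> :: real
  assumes \<epsilon>_pos: "\<epsilon> > 0"
    and gap: "complex_of_real ` {a - \<epsilon> <..< a + \<epsilon>} \<subseteq> resolvent_set H (op0 H S G \<Gamma>0)"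
begin

section \<open>The resolvent at a\<close>

lemma dom_op0: "dom (op0 H S G \<Gamma>0) = {f \<in> dom T. \<Gamma>0 \<cdot> f = \<zero>\<^bsub>G\<^esub>}"
  by (auto simp: op0_def op_ker_def)

lemma app_op0: "\<lbrakk>f \<in> dom T; \<Gamma>0 \<cdot> f = \<zero>\<^bsub>G\<^esub>\<rbrakk> \<Longrightarrow> op0 H S G \<Gamma>0 \<cdot> f = T \<cdot> f"
  unfolding op0_def op_ker_def by (subst restrict_in) auto

text \<open>The constant depends on \<nu> and is not controlled near the ends of the gap. Only its
  existence is used; the explicit 1/\<epsilon> comes out of
  \<open>symmetric_norm_bound\<close>.\<close>

lemma gap_bounded_below:
  assumes "\<bar>\<nu>\<bar> < \<epsilon>"
  obtains C where "C > 0" "\<And>f. \<lbrakk>f \<in> dom T; \<Gamma>0 \<cdot> f = \<zero>\<^bsub>G\<^esub>\<rbrakk>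
    \<Longrightarrow> vnorm H f \<le> C * vnorm H (T \<cdot> f \<ominus>\<^bsub>H\<^esub> complex_of_real (a + \<nu>) \<odot>\<^bsub>H\<^esub> f)"
proof -
  have "complex_of_real (a + \<nu>) \<in> resolvent_set H (op0 H S G \<Gamma>0)"
    using assms gap by (intro subsetD[OF gap] imageI) auto
  from resolvent_setD(2)[OF hilbert_H this] obtain C where "C > 0"
    and C: "\<forall>f\<in>dom (op0 H S G \<Gamma>0). vnorm H f
      \<le> C * vnorm H (op0 H S G \<Gamma>0 \<cdot> f \<ominus>\<^bsub>H\<^esub> complex_of_real (a + \<nu>) \<odot>\<^bsub>H\<^esub> f)" by blast
  show thesis
  proof (rule that[OF \<open>C > 0\<close>])
    fix f assume f: "f \<in> dom T" "\<Gamma>0 \<cdot> f = \<zero>\<^bsub>G\<^esub>"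
    hence "f \<in> dom (op0 H S G \<Gamma>0)" unfolding dom_op0 by blast
    from bspec[OF C this]
    show "vnorm H f \<le> C * vnorm H (T \<cdot> f \<ominus>\<^bsub>H\<^esub> complex_of_real (a + \<nu>) \<odot>\<^bsub>H\<^esub> f)"
      unfolding app_op0[OF f] .
  qed
qed

lemma gap_surj:
  assumes "g \<in> carrier H"
  shows "\<exists>f. f \<in> dom T \<and> \<Gamma>0 \<cdot> f = \<zero>\<^bsub>G\<^esub> \<and> T \<cdot> f \<ominus>\<^bsub>H\<^esub> complex_of_real a \<odot>\<^bsub>H\<^esub> f = g"
proof -
  have "complex_of_real a \<in> resolvent_set H (op0 H S G \<Gamma>0)"
    using \<epsilon>_pos by (intro subsetD[OF gap] imageI) auto
  from resolvent_setD(1)[OF hilbert_H this assms] obtain f where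
    f: "f \<in> dom (op0 H S G \<Gamma>0)" "op0 H S G \<Gamma>0 \<cdot> f \<ominus>\<^bsub>H\<^esub> complex_of_real a \<odot>\<^bsub>H\<^esub> f = g" by blast
  from f(1) have f1: "f \<in> dom T" "\<Gamma>0 \<cdot> f = \<zero>\<^bsub>G\<^esub>" unfolding dom_op0 by blast+
  with f(2) show ?thesis unfolding app_op0[OF f1] by blast
qed

text \<open>A total function obtained by choice; \<open>res_unique\<close> shows that on the carrier
  the choice is forced.\<close>

definition res :: "'a \<Rightarrow> 'a" where
  "res g = (SOME f. f \<in> dom T \<and> \<Gamma>0 \<cdot> f = \<zero>\<^bsub>G\<^esub> \<and> T \<cdot> f \<ominus>\<^bsub>H\<^esub> complex_of_real a \<odot>\<^bsub>H\<^esub> f = g)"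

lemma res_dom [simp]: "g \<in> carrier H \<Longrightarrow> res g \<in> dom T"
  and res_\<Gamma>0 [simp]: "g \<in> carrier H \<Longrightarrow> \<Gamma>0 \<cdot> res g = \<zero>\<^bsub>G\<^esub>"
  and res_eq: "g \<in> carrier H \<Longrightarrow> T \<cdot> res g \<ominus>\<^bsub>H\<^esub> complex_of_real a \<odot>\<^bsub>H\<^esub> res g = g"
  using someI_ex[OF gap_surj[of g]] unfolding res_def by blast+

lemma res_in [simp]: "g \<in> carrier H \<Longrightarrow> res g \<in> carrier H"
  by (rule T.dom_in) (rule res_dom)

lemma T_res:
  assumes "g \<in> carrier H"
  shows "T \<cdot> res g = g \<oplus>\<^bsub>H\<^esub> complex_of_real a \<odot>\<^bsub>H\<^esub> res g"
proof (rule H.ip_eqI)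
  note [simp] = T.app_in[OF res_dom[OF assms]]
  fix z assume z: "z \<in> carrier H"
  have "ip H g z = ip H (T \<cdot> res g \<ominus>\<^bsub>H\<^esub> complex_of_real a \<odot>\<^bsub>H\<^esub> res g) z"
    using res_eq[OF assms] by simp
  thus "ip H (T \<cdot> res g) z = ip H (g \<oplus>\<^bsub>H\<^esub> complex_of_real a \<odot>\<^bsub>H\<^esub> res g) z"
    using assms z by (simp add: H.ip_linear)
qed (use assms in \<open>auto simp del: domIff\<close>)

lemma res_unique:
  assumes f: "f \<in> dom T" "\<Gamma>0 \<cdot> f = \<zero>\<^bsub>G\<^esub>"
  shows "res (T \<cdot> f \<ominus>\<^bsub>H\<^esub> complex_of_real a \<odot>\<^bsub>H\<^esub> f) = f"
proof -
  let ?g = "T \<cdot> f \<ominus>\<^bsub>H\<^esub> complex_of_real a \<odot>\<^bsub>H\<^esub> f"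
  note [simp] = T.dom_in[OF f(1)] T.app_in[OF f(1)]
  have g [simp]: "?g \<in> carrier H" by simp
  note r [simp] = res_dom[OF g] res_in[OF g] T.app_in[OF res_dom[OF g]]
  obtain C where C: "C > 0" "\<And>f. \<lbrakk>f \<in> dom T; \<Gamma>0 \<cdot> f = \<zero>\<^bsub>G\<^esub>\<rbrakk>
    \<Longrightarrow> vnorm H f \<le> C * vnorm H (T \<cdot> f \<ominus>\<^bsub>H\<^esub> complex_of_real (a + 0) \<odot>\<^bsub>H\<^esub> f)"
    using gap_bounded_below[of 0] \<epsilon>_pos by auto
  let ?d = "res ?g \<ominus>\<^bsub>H\<^esub> f"
  have d: "?d \<in> dom T" by (rule T.dom_minus[OF res_dom[OF g] f(1)])
  have Td: "T \<cdot> ?d = T \<cdot> res ?g \<ominus>\<^bsub>H\<^esub> T \<cdot> f" by (rule T.app_minus[OF res_dom[OF g] f(1)])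
  have G: "\<Gamma>0 \<cdot> ?d = \<zero>\<^bsub>G\<^esub>"
    using \<Gamma>0.app_minus[OF res_dom[OF g] f(1)] res_\<Gamma>0[OF g] f(2) by (simp add: a_minus_def)
  have "T \<cdot> ?d \<ominus>\<^bsub>H\<^esub> complex_of_real (a + 0) \<odot>\<^bsub>H\<^esub> ?d = \<zero>\<^bsub>H\<^esub>"
    unfolding Td T_res[OF g] by (rule H.ip_eqI) (simp_all add: H.ip_linear algebra_simps)
  with C(2)[OF d G] have "vnorm H ?d \<le> 0" by simp
  hence "?d = \<zero>\<^bsub>H\<^esub>" by (intro H.vnorm_le_zeroD) simp_all
  thus ?thesis using H.minus_eq_zeroD by simp
qed

text \<open>Both boundary terms in Green's identity vanish on ker \<Gamma>0, and a is real.
  Linearity of \<open>res\<close> is then read off from symmetry, with no further look at how its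
  values were chosen.\<close>

lemma res_sym:
  assumes x: "x \<in> carrier H" and y: "y \<in> carrier H"
  shows "ip H (res x) y = ip H x (res y)"
proof -
  note [simp] = x y T.app_in[OF res_dom[OF x]] T.app_in[OF res_dom[OF y]]
  have "ip H (T \<cdot> res x) (res y) = ip H (res x) (T \<cdot> res y)"
    using green[OF res_dom[OF x] res_dom[OF y]] \<Gamma>1.app_in[OF res_dom[OF x]]
      \<Gamma>1.app_in[OF res_dom[OF y]] by simp
  thus ?thesis by (simp add: T_res H.ip_linear)
qed

lemma res_add: "\<lbrakk>x \<in> carrier H; y \<in> carrier H\<rbrakk> \<Longrightarrow> res (x \<oplus>\<^bsub>H\<^esub> y) = res x \<oplus>\<^bsub>H\<^esub> res y"
  by (rule H.ip_eqI) (simp_all add: res_sym H.ip_linear)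

lemma res_minus: "\<lbrakk>x \<in> carrier H; y \<in> carrier H\<rbrakk> \<Longrightarrow> res (x \<ominus>\<^bsub>H\<^esub> y) = res x \<ominus>\<^bsub>H\<^esub> res y"
  by (rule H.ip_eqI) (simp_all add: res_sym H.ip_linear)

lemma res_smult: "x \<in> carrier H \<Longrightarrow> res (c \<odot>\<^bsub>H\<^esub> x) = c \<odot>\<^bsub>H\<^esub> res x"
  by (rule H.ip_eqI) (simp_all add: res_sym H.ip_linear)

lemma res_bound:
  assumes g: "g \<in> carrier H"
  shows "vnorm H (res g) \<le> 1 / \<epsilon> * vnorm H g"
proof -
  obtain C where C: "C > 0" "\<And>f. \<lbrakk>f \<in> dom T; \<Gamma>0 \<cdot> f = \<zero>\<^bsub>G\<^esub>\<rbrakk>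
    \<Longrightarrow> vnorm H f \<le> C * vnorm H (T \<cdot> f \<ominus>\<^bsub>H\<^esub> complex_of_real (a + 0) \<odot>\<^bsub>H\<^esub> f)"
    using gap_bounded_below[of 0] \<epsilon>_pos by auto
  show ?thesis
  proof (rule H.symmetric_norm_bound[OF _ res_sym _ _ _ g])
    show "vnorm H (res x) \<le> C * vnorm H x" if "x \<in> carrier H" for x
      using C(2)[OF res_dom[OF that] res_\<Gamma>0[OF that]] that by (simp add: res_eq)
    show "0 \<le> 1 / \<epsilon>" using \<epsilon>_pos by simp
    fix \<mu> :: real assume \<mu>: "1 / \<epsilon> < \<bar>\<mu>\<bar>"
    have \<mu>0: "\<mu> \<noteq> 0" using \<mu> \<epsilon>_pos by (auto simp: field_simps)
    \<comment> \<open>For \<nu> = 1/\<mu> one has res - \<mu> = - \<mu> (T - a - \<nu>) res, and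
      |\<mu>| > 1/\<epsilon> puts a + \<nu> inside the gap.\<close>
    define \<nu> where "\<nu> = 1 / \<mu>"
    have "\<bar>\<nu>\<bar> < \<epsilon>" using \<mu> \<mu>0 \<epsilon>_pos by (simp add: \<nu>_def field_simps)
    then obtain K where K: "K > 0" "\<And>f. \<lbrakk>f \<in> dom T; \<Gamma>0 \<cdot> f = \<zero>\<^bsub>G\<^esub>\<rbrakk>
      \<Longrightarrow> vnorm H f \<le> K * vnorm H (T \<cdot> f \<ominus>\<^bsub>H\<^esub> complex_of_real (a + \<nu>) \<odot>\<^bsub>H\<^esub> f)"
      using gap_bounded_below by metis
    show "\<exists>c>0. \<forall>x\<in>carrier H. c * vnorm H x \<le> vnorm H (res x \<ominus>\<^bsub>H\<^esub> complex_of_real \<mu> \<odot>\<^bsub>H\<^esub> x)"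
    \<comment> \<open>With w = (T - a - \<nu>) res x, the identity x = w + \<nu> res x gives
      \<parallel>x\<parallel> \<le> (1 + |\<nu>| K) \<parallel>w\<parallel>, while (res - \<mu>) x
      has norm |\<mu>| \<parallel>w\<parallel>.\<close>
    proof (intro exI[of _ "\<bar>\<mu>\<bar> / (1 + \<bar>\<nu>\<bar> * K)"] conjI ballI)
      have pos: "1 + \<bar>\<nu>\<bar> * K > 0" using K by (simp add: add_pos_nonneg)
      show "\<bar>\<mu>\<bar> / (1 + \<bar>\<nu>\<bar> * K) > 0" using \<mu>0 pos by simp
      fix x assume x: "x \<in> carrier H"
      let ?w = "T \<cdot> res x \<ominus>\<^bsub>H\<^esub> complex_of_real (a + \<nu>) \<odot>\<^bsub>H\<^esub> res x"
      note [simp] = x T.app_in[OF res_dom[OF x]]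
      have w: "?w \<in> carrier H" by simp
      have "x = ?w \<oplus>\<^bsub>H\<^esub> complex_of_real \<nu> \<odot>\<^bsub>H\<^esub> res x"
        by (rule H.ip_eqI) (simp_all add: T_res H.ip_linear algebra_simps)
      hence "vnorm H x \<le> vnorm H ?w + \<bar>\<nu>\<bar> * vnorm H (res x)"
        using H.vnorm_triangle[OF w, of "complex_of_real \<nu> \<odot>\<^bsub>H\<^esub> res x"]
        by (simp add: H.vnorm_smult)
      also have "\<dots> \<le> vnorm H ?w + \<bar>\<nu>\<bar> * (K * vnorm H ?w)"
        using K(2)[OF res_dom[OF x] res_\<Gamma>0[OF x]] by (intro add_left_mono mult_left_mono) auto
      finally have 1: "vnorm H x \<le> (1 + \<bar>\<nu>\<bar> * K) * vnorm H ?w" by (simp add: algebra_simps)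
      have "res x \<ominus>\<^bsub>H\<^esub> complex_of_real \<mu> \<odot>\<^bsub>H\<^esub> x = complex_of_real (-\<mu>) \<odot>\<^bsub>H\<^esub> ?w"
        using \<mu>0 by (intro H.ip_eqI) (simp_all add: T_res H.ip_linear algebra_simps \<nu>_def)
      hence 2: "vnorm H (res x \<ominus>\<^bsub>H\<^esub> complex_of_real \<mu> \<odot>\<^bsub>H\<^esub> x) = \<bar>\<mu>\<bar> * vnorm H ?w"
        by (simp add: H.vnorm_smult)
      have "\<bar>\<mu>\<bar> * vnorm H x \<le> \<bar>\<mu>\<bar> * ((1 + \<bar>\<nu>\<bar> * K) * vnorm H ?w)"
        using 1 by (intro mult_left_mono) auto
      thus "\<bar>\<mu>\<bar> / (1 + \<bar>\<nu>\<bar> * K) * vnorm H x \<le> vnorm H (res x \<ominus>\<^bsub>H\<^esub> complex_of_real \<mu> \<odot>\<^bsub>H\<^esub> x)"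
        unfolding 2 using pos by (simp add: pos_divide_le_eq algebra_simps)
    qed
  qed simp_all
qed

section \<open>The gamma field at a\<close>

lemma gam_ex:
  assumes "h \<in> carrier G"
  shows "\<exists>f. f \<in> dom T \<and> T \<cdot> f = complex_of_real a \<odot>\<^bsub>H\<^esub> f \<and> \<Gamma>0 \<cdot> f = h"
proof -
  \<comment> \<open>Any f with \<Gamma>0 f = h will do: subtracting res ((T - a) f) moves it into
    ker (T - a) and leaves its \<Gamma>0 value unchanged.\<close>
  obtain f where f: "f \<in> dom T" "\<Gamma>0 \<cdot> f = h" using surj[OF assms assms] by metis
  note [simp] = T.dom_in[OF f(1)] T.app_in[OF f(1)]
  let ?u = "T \<cdot> f \<ominus>\<^bsub>H\<^esub> complex_of_real a \<odot>\<^bsub>H\<^esub> f"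
  have u [simp]: "?u \<in> carrier H" by simp
  let ?v = "f \<ominus>\<^bsub>H\<^esub> res ?u"
  have Tv: "T \<cdot> ?v = T \<cdot> f \<ominus>\<^bsub>H\<^esub> (?u \<oplus>\<^bsub>H\<^esub> complex_of_real a \<odot>\<^bsub>H\<^esub> res ?u)"
    using T.app_minus[OF f(1) res_dom[OF u]] T_res[OF u] by simp
  have "T \<cdot> ?v = complex_of_real a \<odot>\<^bsub>H\<^esub> ?v"
    unfolding Tv using u res_in[OF u] by (intro H.ip_eqI) (simp_all add: H.ip_linear algebra_simps)
  moreover have "\<Gamma>0 \<cdot> ?v = h"
    using \<Gamma>0.app_minus[OF f(1) res_dom[OF u]] f(2) assms res_\<Gamma>0[OF u] by (simp add: a_minus_def)
  ultimately show ?thesis using T.dom_minus[OF f(1) res_dom[OF u]] by blast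
qed

definition gam :: "'b \<Rightarrow> 'a" where
  "gam h = (SOME f. f \<in> dom T \<and> T \<cdot> f = complex_of_real a \<odot>\<^bsub>H\<^esub> f \<and> \<Gamma>0 \<cdot> f = h)"

lemma gam_dom [simp]: "h \<in> carrier G \<Longrightarrow> gam h \<in> dom T"
  and T_gam: "h \<in> carrier G \<Longrightarrow> T \<cdot> gam h = complex_of_real a \<odot>\<^bsub>H\<^esub> gam h"
  and \<Gamma>0_gam [simp]: "h \<in> carrier G \<Longrightarrow> \<Gamma>0 \<cdot> gam h = h"
  using someI_ex[OF gam_ex[of h]] unfolding gam_def by blast+

lemma gam_in [simp]: "h \<in> carrier G \<Longrightarrow> gam h \<in> carrier H"
  by (rule T.dom_in) (rule gam_dom)

text \<open>The vector f - gam (\<Gamma>0 f) lies in ker \<Gamma>0, where \<open>res\<close> inverts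
  T - a, and T - a annihilates the \<open>gam\<close> part.\<close>

lemma decomposition:
  assumes f: "f \<in> dom T"
  shows "f = res (T \<cdot> f \<ominus>\<^bsub>H\<^esub> complex_of_real a \<odot>\<^bsub>H\<^esub> f) \<oplus>\<^bsub>H\<^esub> gam (\<Gamma>0 \<cdot> f)"
proof -
  note [simp] = T.dom_in[OF f] T.app_in[OF f] \<Gamma>0.app_in[OF f]
  let ?g = "gam (\<Gamma>0 \<cdot> f)"
  have g: "?g \<in> dom T" by (rule gam_dom) simp
  have d: "f \<ominus>\<^bsub>H\<^esub> ?g \<in> dom T" by (rule T.dom_minus[OF f g])
  have "\<Gamma>0 \<cdot> (f \<ominus>\<^bsub>H\<^esub> ?g) = \<zero>\<^bsub>G\<^esub>"
    using \<Gamma>0.app_minus[OF f g] by (simp add: a_minus_def G.r_neg)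
  from res_unique[OF d this]
  have "f \<ominus>\<^bsub>H\<^esub> ?g = res (T \<cdot> (f \<ominus>\<^bsub>H\<^esub> ?g) \<ominus>\<^bsub>H\<^esub> complex_of_real a \<odot>\<^bsub>H\<^esub> (f \<ominus>\<^bsub>H\<^esub> ?g))" by simp
  also have "T \<cdot> (f \<ominus>\<^bsub>H\<^esub> ?g) \<ominus>\<^bsub>H\<^esub> complex_of_real a \<odot>\<^bsub>H\<^esub> (f \<ominus>\<^bsub>H\<^esub> ?g)
      = T \<cdot> f \<ominus>\<^bsub>H\<^esub> complex_of_real a \<odot>\<^bsub>H\<^esub> f"
    unfolding T.app_minus[OF f g] T_gam[OF \<Gamma>0.app_in[OF f]]
    by (rule H.ip_eqI) (simp_all add: H.ip_linear algebra_simps)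
  finally have eq: "f \<ominus>\<^bsub>H\<^esub> ?g = res (T \<cdot> f \<ominus>\<^bsub>H\<^esub> complex_of_real a \<odot>\<^bsub>H\<^esub> f)" .
  show ?thesis unfolding eq[symmetric]
    by (rule H.ip_eqI) (simp_all add: H.ip_linear)
qed

text \<open>By \<open>decomposition\<close> an element of ker (T - a) has no \<open>res\<close>
  part. Linearity of \<open>gam\<close> follows, since sums and multiples of its values stay in ker
  (T - a).\<close>

lemma gam_unique:
  assumes f: "f \<in> dom T" "T \<cdot> f = complex_of_real a \<odot>\<^bsub>H\<^esub> f"
  shows "gam (\<Gamma>0 \<cdot> f) = f"
proof -
  note [simp] = T.dom_in[OF f(1)]
  have "T \<cdot> f \<ominus>\<^bsub>H\<^esub> complex_of_real a \<odot>\<^bsub>H\<^esub> f = \<zero>\<^bsub>H\<^esub>"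
    unfolding f(2) by (rule H.ip_eqI) (simp_all add: H.ip_linear)
  moreover have "res \<zero>\<^bsub>H\<^esub> = \<zero>\<^bsub>H\<^esub>"
    using res_smult[of "\<zero>\<^bsub>H\<^esub>" 0] by simp
  ultimately show ?thesis
    using decomposition[OF f(1)] gam_in[OF \<Gamma>0.app_in[OF f(1)]] by simp
qed

lemma gam_add:
  assumes "h \<in> carrier G" "k \<in> carrier G"
  shows "gam (h \<oplus>\<^bsub>G\<^esub> k) = gam h \<oplus>\<^bsub>H\<^esub> gam k"
proof -
  note d = gam_dom[OF assms(1)] gam_dom[OF assms(2)]
  have "T \<cdot> (gam h \<oplus>\<^bsub>H\<^esub> gam k) = complex_of_real a \<odot>\<^bsub>H\<^esub> (gam h \<oplus>\<^bsub>H\<^esub> gam k)"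
    unfolding T.app_add[OF d] T_gam[OF assms(1)] T_gam[OF assms(2)]
    using assms by (intro H.ip_eqI) (simp_all add: H.ip_linear algebra_simps)
  from gam_unique[OF T.dom_add[OF d] this] show ?thesis
    unfolding \<Gamma>0.app_add[OF d] using assms by simp
qed

lemma gam_smult:
  assumes "h \<in> carrier G"
  shows "gam (c \<odot>\<^bsub>G\<^esub> h) = c \<odot>\<^bsub>H\<^esub> gam h"
proof -
  note d = gam_dom[OF assms(1)]
  have "T \<cdot> (c \<odot>\<^bsub>H\<^esub> gam h) = complex_of_real a \<odot>\<^bsub>H\<^esub> (c \<odot>\<^bsub>H\<^esub> gam h)"
    unfolding T.app_smult[OF d] T_gam[OF assms(1)]
    using assms by (intro H.ip_eqI) (simp_all add: H.ip_linear algebra_simps)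
  from gam_unique[OF T.dom_smult[OF d] this] show ?thesis
    unfolding \<Gamma>0.app_smult[OF d] using assms by simp
qed

section \<open>The adjoint of the gamma field; upper and lower bounds\<close>

lemma \<Gamma>1_res_in [simp]: "g \<in> carrier H \<Longrightarrow> \<Gamma>1 \<cdot> res g \<in> carrier G"
  by (rule \<Gamma>1.app_in) (rule res_dom)

lemma \<Gamma>1_gam_in [simp]: "h \<in> carrier G \<Longrightarrow> \<Gamma>1 \<cdot> gam h \<in> carrier G"
  by (rule \<Gamma>1.app_in) (rule gam_dom)

text \<open>Green's identity for res g and gam h: one boundary term vanishes because \<Gamma>0 (res
  g) = 0, and the terms with a cancel because a is real.\<close>

lemma \<Gamma>1_res_adj:
  assumes g: "g \<in> carrier H" and h: "h \<in> carrier G"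
  shows "ip G (\<Gamma>1 \<cdot> res g) h = ip H g (gam h)"
  using green[OF res_dom[OF g] gam_dom[OF h]] g h
  by (simp add: T_res T_gam H.ip_linear)

text \<open>Boundedness of \<Gamma>1 is given in the graph norm. Since T (res g) = g + a res g and
  \<open>res\<close> is bounded by 1/\<epsilon>, the graph norm of res g is controlled by
  \<parallel>g\<parallel>.\<close>

lemma graph_norm_res:
  assumes g: "g \<in> carrier H"
  shows "sqrt ((vnorm H (res g))\<^sup>2 + (vnorm H (T \<cdot> res g))\<^sup>2) \<le> (1 + (1 + \<bar>a\<bar>) / \<epsilon>) * vnorm H g"
proof -
  note t = T.app_in[OF res_dom[OF g]]
  have "sqrt ((vnorm H (res g))\<^sup>2 + (vnorm H (T \<cdot> res g))\<^sup>2) \<le> vnorm H (res g) + vnorm H (T \<cdot> res g)"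
    using g t by (intro sqrt_sum_squares_le_sum) auto
  also have "vnorm H (T \<cdot> res g) \<le> vnorm H g + \<bar>a\<bar> * vnorm H (res g)"
    unfolding T_res[OF g] using g H.vnorm_triangle[of g "complex_of_real a \<odot>\<^bsub>H\<^esub> res g"]
    by (simp add: H.vnorm_smult)
  also have "vnorm H (res g) + (vnorm H g + \<bar>a\<bar> * vnorm H (res g))
      = vnorm H g + (1 + \<bar>a\<bar>) * vnorm H (res g)" by (simp add: algebra_simps)
  also have "\<dots> \<le> vnorm H g + (1 + \<bar>a\<bar>) * (1 / \<epsilon> * vnorm H g)"
    using res_bound[OF g] by (intro add_left_mono mult_left_mono) auto
  finally show ?thesis by (simp add: algebra_simps add_divide_distrib)
qed

lemma \<Gamma>1_res_bounded:
  obtains C where "C > 0" "\<And>g. g \<in> carrier H \<Longrightarrow> vnorm G (\<Gamma>1 \<cdot> res g) \<le> C * vnorm H g"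
proof -
  obtain C where C: "\<forall>f\<in>dom T. vnorm G (\<Gamma>1 \<cdot> f) \<le> C * sqrt ((vnorm H f)\<^sup>2 + (vnorm H (T \<cdot> f))\<^sup>2)"
    using \<Gamma>1_bounded by blast
  let ?K = "1 + (1 + \<bar>a\<bar>) / \<epsilon>"
  have K: "?K > 0" using \<epsilon>_pos by (simp add: add_pos_nonneg)
  show thesis
  proof (rule that[of "(\<bar>C\<bar> + 1) * ?K"])
    fix g assume g: "g \<in> carrier H"
    let ?N = "sqrt ((vnorm H (res g))\<^sup>2 + (vnorm H (T \<cdot> res g))\<^sup>2)"
    have "vnorm G (\<Gamma>1 \<cdot> res g) \<le> C * ?N" using C res_dom[OF g] by blast
    also have "\<dots> \<le> (\<bar>C\<bar> + 1) * ?N" by (intro mult_right_mono) auto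
    also have "\<dots> \<le> (\<bar>C\<bar> + 1) * (?K * vnorm H g)"
      using graph_norm_res[OF g] by (intro mult_left_mono) auto
    finally show "vnorm G (\<Gamma>1 \<cdot> res g) \<le> (\<bar>C\<bar> + 1) * ?K * vnorm H g" by simp
  qed (use K in simp)
qed

text \<open>By duality: \<parallel>gam h\<parallel>^2 is the inner product of \<Gamma>1 (res (gam
  h)) with h, and after the bound for \<Gamma>1 res one factor \<parallel>gam h\<parallel>
  cancels.\<close>

lemma gam_bounded:
  obtains C where "C > 0" "\<And>h. h \<in> carrier G \<Longrightarrow> vnorm H (gam h) \<le> C * vnorm G h"
proof -
  obtain C where C: "C > 0" "\<And>g. g \<in> carrier H \<Longrightarrow> vnorm G (\<Gamma>1 \<cdot> res g) \<le> C * vnorm H g"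
    using \<Gamma>1_res_bounded by blast
  show thesis
  proof (rule that[OF C(1)])
    fix h assume h: "h \<in> carrier G"
    let ?g = "gam h"
    have "(vnorm H ?g)\<^sup>2 = cmod (ip G (\<Gamma>1 \<cdot> res ?g) h)"
      using h by (simp add: \<Gamma>1_res_adj H.ip_self norm_power)
    also have "\<dots> \<le> vnorm G (\<Gamma>1 \<cdot> res ?g) * vnorm G h"
      using h by (intro G.cauchy_schwarz) auto
    also have "\<dots> \<le> C * vnorm H ?g * vnorm G h"
      using h C(2) by (intro mult_right_mono) auto
    finally have "vnorm H ?g * vnorm H ?g \<le> vnorm H ?g * (C * vnorm G h)"
      by (simp add: power2_eq_square mult.commute mult.left_commute)
    thus "vnorm H ?g \<le> C * vnorm G h"
      using h C(1) H.vnorm_nonneg[OF gam_in[OF h]] G.vnorm_nonneg[OF h]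
      by (cases "vnorm H ?g = 0") (auto simp: mult_le_cancel_left)
  qed
qed

text \<open>On ker (T - a) the graph norm is at most (1 + |a|) times the norm, so the upper bound
  for \<Gamma>0 becomes a lower bound for \<open>gam\<close>. This is the source of the positivity
  of M'(a) and of the injectivity of R.\<close>

lemma gam_bounded_below:
  obtains c where "c > 0" "\<And>h. h \<in> carrier G \<Longrightarrow> c * vnorm G h \<le> vnorm H (gam h)"
proof -
  obtain C where C: "\<forall>f\<in>dom T. vnorm G (\<Gamma>0 \<cdot> f) \<le> C * sqrt ((vnorm H f)\<^sup>2 + (vnorm H (T \<cdot> f))\<^sup>2)"
    using \<Gamma>0_bounded by blast
  let ?K = "(\<bar>C\<bar> + 1) * (1 + \<bar>a\<bar>)"
  have K: "?K > 0" by (simp add: add_pos_nonneg)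
  show thesis
  proof (rule that[of "1 / ?K"])
    fix h assume h: "h \<in> carrier G"
    let ?N = "sqrt ((vnorm H (gam h))\<^sup>2 + (vnorm H (T \<cdot> gam h))\<^sup>2)"
    have "?N \<le> vnorm H (gam h) + vnorm H (T \<cdot> gam h)"
      using h T.app_in[OF gam_dom[OF h]] by (intro sqrt_sum_squares_le_sum) auto
    also have "\<dots> = (1 + \<bar>a\<bar>) * vnorm H (gam h)"
      using h by (simp add: T_gam H.vnorm_smult algebra_simps)
    finally have N: "?N \<le> (1 + \<bar>a\<bar>) * vnorm H (gam h)" .
    have "vnorm G h \<le> C * ?N" using C gam_dom[OF h] \<Gamma>0_gam[OF h] by metis
    also have "\<dots> \<le> (\<bar>C\<bar> + 1) * ?N" by (intro mult_right_mono) auto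
    also have "\<dots> \<le> (\<bar>C\<bar> + 1) * ((1 + \<bar>a\<bar>) * vnorm H (gam h))"
      using N by (intro mult_left_mono) auto
    finally have "vnorm G h \<le> ?K * vnorm H (gam h)" by simp
    thus "1 / ?K * vnorm G h \<le> vnorm H (gam h)" using K by (simp add: pos_divide_le_eq mult.commute)
  qed (use K in simp)
qed

end

section \<open>The derivative of the Weyl function\<close>

context hilbert_space
begin

lemma densely_defined_carrier: "dom S = carrier H \<Longrightarrow> densely_defined H S"
proof -
  have "vnorm H (x \<ominus> x) = 0" if "x \<in> carrier H" for x
    using that by (simp add: a_minus_def r_neg)
  thus "dom S = carrier H \<Longrightarrow> densely_defined H S"
    unfolding densely_defined_def by metis
qed

text \<open>Justifies the definite description in \<open>op_deriv\<close>. The difference of two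
  derivatives, multiplied by w - z, is a difference of two remainders.\<close>

lemma has_op_derivative_unique:
  assumes D: "has_op_derivative H F D z" and E: "has_op_derivative H F E z"
  shows "D = E"
proof (rule ext)
  have dom: "dom D = carrier H" "dom E = carrier H"
    and lin: "linear_operator H H D" "linear_operator H H E" "linear_operator H H (F z)"
    and domF: "dom (F z) = carrier H"
    using D E by (simp_all add: has_op_derivative_def bounded_operator_def)
  interpret D: linear_op H H D by (intro linear_op.intro linear_op_axioms.intro hilbert_space_axioms lin)
  interpret E: linear_op H H E by (intro linear_op.intro linear_op_axioms.intro hilbert_space_axioms lin)
  interpret Fz: linear_op H H "F z" by (intro linear_op.intro linear_op_axioms.intro hilbert_space_axioms lin)
  fix x
  show "D x = E x"
  proof (cases "x \<in> carrier H")
    case False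
    thus ?thesis using dom by (metis domIff)
  next
    case True
    have xD: "x \<in> dom D" and xE: "x \<in> dom E" and xF: "x \<in> dom (F z)"
      using True by (simp_all only: dom domF)
    note [simp] = True D.app_in[OF xD] E.app_in[OF xE] Fz.app_in[OF xF]
    let ?d = "D \<cdot> x \<ominus> E \<cdot> x"
    have "vnorm H ?d \<le> 0 + e" if e: "e > 0" for e
    proof -
      \<comment> \<open>Two remainders, each at most e' \<parallel>x\<parallel> after division by |w
        - z|, have to stay below e. The added 1 covers x = 0.\<close>
      define e' where "e' = e / (2 * (vnorm H x + 1))"
      have pos: "vnorm H x + 1 > 0" using vnorm_nonneg[OF True] by linarith
      have e': "e' > 0" using e pos by (simp add: e'_def)
      have "\<forall>\<^sub>F w in at z. w \<noteq> z \<and> bounded_operator H H (F w) \<and>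
          (\<forall>h\<in>carrier H. vnorm H ((F w \<cdot> h \<ominus> F z \<cdot> h) \<ominus> (w - z) \<odot> (D \<cdot> h)) \<le> e' * cmod (w - z) * vnorm H h) \<and>
          (\<forall>h\<in>carrier H. vnorm H ((F w \<cdot> h \<ominus> F z \<cdot> h) \<ominus> (w - z) \<odot> (E \<cdot> h)) \<le> e' * cmod (w - z) * vnorm H h)"
        using D E e' unfolding has_op_derivative_def
        by (intro eventually_conj eventually_neq_at_within) blast+
      then obtain w where w: "w \<noteq> z" "bounded_operator H H (F w)"
        "vnorm H ((F w \<cdot> x \<ominus> F z \<cdot> x) \<ominus> (w - z) \<odot> (D \<cdot> x)) \<le> e' * cmod (w - z) * vnorm H x"
        "vnorm H ((F w \<cdot> x \<ominus> F z \<cdot> x) \<ominus> (w - z) \<odot> (E \<cdot> x)) \<le> e' * cmod (w - z) * vnorm H x"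
        using eventually_happens'[OF at_neq_bot] True by blast
      interpret Fw: linear_op H H "F w"
        using w(2) by (intro linear_op.intro linear_op_axioms.intro hilbert_space_axioms)
          (simp_all add: bounded_operator_def)
      have "x \<in> dom (F w)" using w(2) True by (simp add: bounded_operator_def del: domIff)
      note [simp] = Fw.app_in[OF this]
      let ?u = "(F w \<cdot> x \<ominus> F z \<cdot> x) \<ominus> (w - z) \<odot> (E \<cdot> x)"
      let ?v = "(F w \<cdot> x \<ominus> F z \<cdot> x) \<ominus> (w - z) \<odot> (D \<cdot> x)"
      have "(w - z) \<odot> ?d = ?u \<ominus> ?v"
        by (rule ip_eqI) (simp_all add: ip_linear algebra_simps)
      hence "cmod (w - z) * vnorm H ?d = vnorm H (?u \<ominus> ?v)"
        using vnorm_smult[of ?d "w - z"] by simp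
      also have "\<dots> \<le> vnorm H ?u + vnorm H ?v"
        by (rule vnorm_triangle_minus) simp_all
      also have "\<dots> \<le> cmod (w - z) * (2 * (e' * vnorm H x))" using w(3,4) by (simp add: algebra_simps)
      finally have "vnorm H ?d \<le> 2 * (e' * vnorm H x)" using w(1) by (simp add: mult_le_cancel_left)
      also have "\<dots> \<le> e" using pos e by (simp add: e'_def field_simps)
      finally show ?thesis by simp
    qed
    hence "vnorm H ?d \<le> 0" by (rule field_le_epsilon)
    hence "?d = \<zero>" by (intro vnorm_le_zeroD) simp_all
    hence "D \<cdot> x = E \<cdot> x" using minus_eq_zeroD[of "D \<cdot> x" "E \<cdot> x"] by simp
    moreover obtain u where "D x = Some u" using domD[OF xD] by blast
    moreover obtain v where "E x = Some v" using domD[OF xE] by blast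
    ultimately show ?thesis by simp
  qed
qed

lemma op_deriv_eqI:
  assumes "has_op_derivative H F D z"
  shows "op_deriv H F z = D"
  unfolding op_deriv_def using assms has_op_derivative_unique by (intro the_equality) auto

end

section \<open>The candidate for the derivative at a\<close>

context triplet_gap
begin

text \<open>Undefined off the carrier, because \<open>positive_definite\<close> and
  \<open>factorizes\<close> compare operators as partial maps.\<close>

definition weyl_deriv :: "('b, 'b) operator" where
  "weyl_deriv = (\<lambda>h. if h \<in> carrier G then Some (\<Gamma>1 \<cdot> res (gam h)) else None)"

lemma dom_weyl_deriv [simp]: "dom weyl_deriv = carrier G"
  by (auto simp: weyl_deriv_def dom_def)

lemma weyl_deriv_app [simp]: "h \<in> carrier G \<Longrightarrow> weyl_deriv \<cdot> h = \<Gamma>1 \<cdot> res (gam h)"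
  by (simp add: weyl_deriv_def)

lemma weyl_deriv_ip:
  "\<lbrakk>h \<in> carrier G; k \<in> carrier G\<rbrakk> \<Longrightarrow> ip G (weyl_deriv \<cdot> h) k = ip H (gam h) (gam k)"
  by (simp add: \<Gamma>1_res_adj)

lemma weyl_deriv_bounded: "bounded_operator G G weyl_deriv"
proof -
  obtain C where C: "C > 0" "\<And>g. g \<in> carrier H \<Longrightarrow> vnorm G (\<Gamma>1 \<cdot> res g) \<le> C * vnorm H g"
    using \<Gamma>1_res_bounded by blast
  obtain K where K: "K > 0" "\<And>h. h \<in> carrier G \<Longrightarrow> vnorm H (gam h) \<le> K * vnorm G h"
    using gam_bounded by blast
  have "linear_operator G G weyl_deriv"
  proof (rule linear_operatorI[OF hilbert_G], unfold dom_weyl_deriv)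
    fix x y c assume x: "x \<in> carrier G"
    show "weyl_deriv \<cdot> (c \<odot>\<^bsub>G\<^esub> x) = c \<odot>\<^bsub>G\<^esub> weyl_deriv \<cdot> x"
      using x \<Gamma>1.app_smult[OF res_dom[OF gam_in[OF x]]] by (simp add: gam_smult res_smult)
    assume y: "y \<in> carrier G"
    show "weyl_deriv \<cdot> (x \<oplus>\<^bsub>G\<^esub> y) = weyl_deriv \<cdot> x \<oplus>\<^bsub>G\<^esub> weyl_deriv \<cdot> y"
      using x y \<Gamma>1.app_add[OF res_dom[OF gam_in[OF x]] res_dom[OF gam_in[OF y]]]
      by (simp add: gam_add res_add)
  qed simp_all
  moreover have "vnorm G (weyl_deriv \<cdot> h) \<le> C * K * vnorm G h" if h: "h \<in> carrier G" for h
  proof -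
    have "vnorm G (weyl_deriv \<cdot> h) \<le> C * vnorm H (gam h)" using h C(2) by simp
    also have "\<dots> \<le> C * (K * vnorm G h)" using K(2)[OF h] C(1) by (intro mult_left_mono) auto
    finally show ?thesis by simp
  qed
  ultimately show ?thesis unfolding bounded_operator_def by auto
qed

text \<open>The quadratic form of M'(a) is \<parallel>gam h\<parallel>^2, so a lower bound c for
  \<open>gam\<close> gives the constant c^2. Equality with the adjoint is equality of partial maps
  and includes the vectors outside the carrier, where both are undefined.\<close>

lemma weyl_deriv_positive_definite: "positive_definite G weyl_deriv"
proof -
  obtain c where c: "c > 0" "\<And>h. h \<in> carrier G \<Longrightarrow> c * vnorm G h \<le> vnorm H (gam h)"
    using gam_bounded_below by blast
  have "c\<^sup>2 * (vnorm G x)\<^sup>2 \<le> Re (ip G (weyl_deriv \<cdot> x) x)" if x: "x \<in> carrier G" for x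
  proof -
    have "(c * vnorm G x)\<^sup>2 \<le> (vnorm H (gam x))\<^sup>2"
      using c x by (intro power_mono) auto
    thus ?thesis using x weyl_deriv_ip[OF x x] H.vnorm_sq[OF gam_in[OF x]]
      by (simp add: power_mult_distrib)
  qed
  moreover have "op_adjoint G weyl_deriv = weyl_deriv"
  proof (rule ext)
    fix g
    note iff = G.op_adjoint_eq_Some_iff[OF G.densely_defined_carrier[OF dom_weyl_deriv] equalityD1[OF dom_weyl_deriv]]
    have sym: "ip G (weyl_deriv \<cdot> f) g = ip G f (weyl_deriv \<cdot> g)" if "f \<in> carrier G" "g \<in> carrier G" for f g
      using that weyl_deriv_ip[OF that] weyl_deriv_ip[OF that(2,1)]
        G.ip_commute[of f "weyl_deriv \<cdot> g"] H.ip_commute[of "gam f" "gam g"] by simp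
    show "op_adjoint G weyl_deriv g = weyl_deriv g"
    proof (cases "g \<in> carrier G")
      case True
      have "op_adjoint G weyl_deriv g = Some (weyl_deriv \<cdot> g)"
        unfolding iff using True sym[OF _ True] by simp
      also have "\<dots> = weyl_deriv g" using True by (simp add: weyl_deriv_def)
      finally show ?thesis .
    next
      case False
      hence "\<forall>h. op_adjoint G weyl_deriv g \<noteq> Some h" unfolding iff by simp
      hence "op_adjoint G weyl_deriv g = None" by (simp only: not_Some_eq)
      thus ?thesis using False by (simp add: weyl_deriv_def)
    qed
  qed
  ultimately show ?thesis unfolding positive_definite_def
    using weyl_deriv_bounded c(1) by (auto intro!: exI[of _ "c\<^sup>2"])
qed

section \<open>The Weyl function near a\<close>

lemma defect_space_iff: "f \<in> defect_space H S z \<longleftrightarrow> f \<in> dom T \<and> T \<cdot> f = z \<odot>\<^bsub>H\<^esub> f"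
  by (rule mem_defect_space_iff[OF hilbert_H])
    (use dd_closed_symmetric in \<open>simp_all add: dd_closed_symmetric_def\<close>)

text \<open>The gap supplies resolvent points on the real axis only, whereas the derivative is taken
  over complex z. By \<parallel>res\<parallel> \<le> 1/\<epsilon>, sending x to g + (z - a) res x
  contracts by 1/2 on the disc of radius \<epsilon>/2. The fixed point is the inverse of 1 - (z - a)
  res applied to g, and the factor 2 is 1/(1 - 1/2).\<close>

lemma perturbed_resolvent:
  assumes z: "cmod (z - complex_of_real a) \<le> \<epsilon> / 2" and g: "g \<in> carrier H"
  obtains x where "x \<in> carrier H" "x = g \<oplus>\<^bsub>H\<^esub> (z - complex_of_real a) \<odot>\<^bsub>H\<^esub> res x"
    "vnorm H x \<le> 2 * vnorm H g"
proof -
  let ?w = "z - complex_of_real a"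
  have half: "cmod ?w * vnorm H (res x) \<le> 1 / 2 * vnorm H x" if x: "x \<in> carrier H" for x
  proof -
    have "cmod ?w * vnorm H (res x) \<le> \<epsilon> / 2 * (1 / \<epsilon> * vnorm H x)"
      using z res_bound[OF x] x \<epsilon>_pos by (intro mult_mono) auto
    thus ?thesis using \<epsilon>_pos by simp
  qed
  obtain x where x: "x \<in> carrier H" "g \<oplus>\<^bsub>H\<^esub> ?w \<odot>\<^bsub>H\<^esub> res x = x"
  proof (rule H.fixed_point[of "\<lambda>x. g \<oplus>\<^bsub>H\<^esub> ?w \<odot>\<^bsub>H\<^esub> res x" "1 / 2"])
    fix x y assume xy: "x \<in> carrier H" "y \<in> carrier H"
    have "g \<oplus>\<^bsub>H\<^esub> ?w \<odot>\<^bsub>H\<^esub> res x \<ominus>\<^bsub>H\<^esub> (g \<oplus>\<^bsub>H\<^esub> ?w \<odot>\<^bsub>H\<^esub> res y) = ?w \<odot>\<^bsub>H\<^esub> res (x \<ominus>\<^bsub>H\<^esub> y)"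
      using g xy by (intro H.ip_eqI) (simp_all add: H.ip_linear res_minus algebra_simps)
    thus "vnorm H (g \<oplus>\<^bsub>H\<^esub> ?w \<odot>\<^bsub>H\<^esub> res x \<ominus>\<^bsub>H\<^esub> (g \<oplus>\<^bsub>H\<^esub> ?w \<odot>\<^bsub>H\<^esub> res y)) \<le> 1 / 2 * vnorm H (x \<ominus>\<^bsub>H\<^esub> y)"
      using half[of "x \<ominus>\<^bsub>H\<^esub> y"] xy by (simp add: H.vnorm_smult)
  qed (use g in auto)
  have "vnorm H x \<le> vnorm H g + 1 / 2 * vnorm H x"
    using H.vnorm_triangle[of g "?w \<odot>\<^bsub>H\<^esub> res x"] half[OF x(1)] g x by (simp add: H.vnorm_smult)
  hence "vnorm H x \<le> 2 * vnorm H g" by simp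
  thus thesis using that[of x] x by simp
qed

text \<open>If two elements have the same \<Gamma>0 value, their difference d lies in ker \<Gamma>0,
  hence d = res ((z - a) d) and \<parallel>d\<parallel> \<le> \<parallel>d\<parallel>/2.\<close>

lemma defect_inj:
  assumes z: "cmod (z - complex_of_real a) \<le> \<epsilon> / 2"
  shows "inj_on (app \<Gamma>0) (defect_space H S z)"
proof (rule inj_onI)
  fix f g assume "f \<in> defect_space H S z" "g \<in> defect_space H S z" and eq: "\<Gamma>0 \<cdot> f = \<Gamma>0 \<cdot> g"
  hence f: "f \<in> dom T" "T \<cdot> f = z \<odot>\<^bsub>H\<^esub> f" and g: "g \<in> dom T" "T \<cdot> g = z \<odot>\<^bsub>H\<^esub> g"
    unfolding defect_space_iff by blast+
  note [simp] = T.dom_in[OF f(1)] T.dom_in[OF g(1)]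
  let ?d = "f \<ominus>\<^bsub>H\<^esub> g"
  let ?w = "z - complex_of_real a"
  have d: "?d \<in> dom T" by (rule T.dom_minus[OF f(1) g(1)])
  have "\<Gamma>0 \<cdot> ?d = \<zero>\<^bsub>G\<^esub>"
    using \<Gamma>0.app_minus[OF f(1) g(1)] eq \<Gamma>0.app_in[OF g(1)] by (simp add: a_minus_def G.r_neg)
  from res_unique[OF d this]
  have "?d = res (T \<cdot> ?d \<ominus>\<^bsub>H\<^esub> complex_of_real a \<odot>\<^bsub>H\<^esub> ?d)" by simp
  also have "T \<cdot> ?d \<ominus>\<^bsub>H\<^esub> complex_of_real a \<odot>\<^bsub>H\<^esub> ?d = ?w \<odot>\<^bsub>H\<^esub> ?d"
    unfolding T.app_minus[OF f(1) g(1)] f(2) g(2)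
    by (rule H.ip_eqI) (simp_all add: H.ip_linear algebra_simps)
  finally have "vnorm H ?d \<le> 1 / \<epsilon> * (cmod ?w * vnorm H ?d)"
    using res_bound[of "?w \<odot>\<^bsub>H\<^esub> ?d"] by (simp add: H.vnorm_smult)
  also have "\<dots> \<le> 1 / \<epsilon> * (\<epsilon> / 2 * vnorm H ?d)"
    using z \<epsilon>_pos by (intro mult_left_mono mult_right_mono) auto
  finally have "vnorm H ?d \<le> 0" using \<epsilon>_pos by simp
  hence "?d = \<zero>\<^bsub>H\<^esub>" by (intro H.vnorm_le_zeroD) simp_all
  thus "f = g" using H.minus_eq_zeroD[of f g] by simp
qed

text \<open>By \<open>defect_inj\<close> the choice inside \<open>op_inverse\<close> can only return
  f, so M(z) may be computed from any known element of ker (T - z).\<close>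

lemma weyl_eq:
  assumes z: "cmod (z - complex_of_real a) \<le> \<epsilon> / 2"
    and f: "f \<in> dom T" "T \<cdot> f = z \<odot>\<^bsub>H\<^esub> f"
  shows "weyl_function H S \<Gamma>0 \<Gamma>1 z (\<Gamma>0 \<cdot> f) = Some (\<Gamma>1 \<cdot> f)"
proof -
  let ?N = "defect_space H S z"
  let ?g = "\<Gamma>0 |` ?N"
  have N: "?N \<subseteq> dom T" using defect_space_iff by blast
  have fN: "f \<in> ?N" using f defect_space_iff by blast
  have dom: "dom ?g = ?N" using N by auto
  have app: "?g \<cdot> x = \<Gamma>0 \<cdot> x" if "x \<in> ?N" for x using that by simp
  have "inj_on (app ?g) (dom ?g)"
    unfolding dom using defect_inj[OF z] app by (simp add: inj_on_def)
  from op_inverse_app[OF this, of f] have "op_inverse ?g (\<Gamma>0 \<cdot> f) = Some f"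
    unfolding dom app[OF fN] using fN by blast
  moreover have "\<Gamma>1 f = Some (\<Gamma>1 \<cdot> f)"
  proof -
    have "f \<in> dom \<Gamma>1" using f(1) by (simp only: dom_\<Gamma>1)
    then obtain y where "\<Gamma>1 f = Some y" by blast
    thus ?thesis by simp
  qed
  ultimately show ?thesis by (simp add: weyl_function_def map_comp_def)
qed

text \<open>The gamma field at z. For the fixed point x with right-hand side gam h, T - a
  annihilates gam h and undoes \<open>res\<close>, so (T - a) x = (z - a) x; and \<Gamma>0 sees only
  gam h.\<close>

lemma defect_element:
  assumes z: "cmod (z - complex_of_real a) \<le> \<epsilon> / 2" and h: "h \<in> carrier G"
  obtains x where "x \<in> dom T" "T \<cdot> x = z \<odot>\<^bsub>H\<^esub> x" "\<Gamma>0 \<cdot> x = h"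
    "x = gam h \<oplus>\<^bsub>H\<^esub> (z - complex_of_real a) \<odot>\<^bsub>H\<^esub> res x" "vnorm H x \<le> 2 * vnorm H (gam h)"
proof -
  let ?w = "z - complex_of_real a"
  obtain x where x: "x \<in> carrier H" "x = gam h \<oplus>\<^bsub>H\<^esub> ?w \<odot>\<^bsub>H\<^esub> res x" "vnorm H x \<le> 2 * vnorm H (gam h)"
    using perturbed_resolvent[OF z gam_in[OF h]] by blast
  note d = gam_dom[OF h] T.dom_smult[OF res_dom[OF x(1)], of ?w]
  have xT: "x \<in> dom T" using T.dom_add[OF d] x(2) by simp
  have "T \<cdot> (gam h \<oplus>\<^bsub>H\<^esub> ?w \<odot>\<^bsub>H\<^esub> res x) = z \<odot>\<^bsub>H\<^esub> (gam h \<oplus>\<^bsub>H\<^esub> ?w \<odot>\<^bsub>H\<^esub> res x)"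
  proof -
    have "T \<cdot> (gam h \<oplus>\<^bsub>H\<^esub> ?w \<odot>\<^bsub>H\<^esub> res x)
        = complex_of_real a \<odot>\<^bsub>H\<^esub> gam h \<oplus>\<^bsub>H\<^esub> ?w \<odot>\<^bsub>H\<^esub> (x \<oplus>\<^bsub>H\<^esub> complex_of_real a \<odot>\<^bsub>H\<^esub> res x)"
      unfolding T.app_add[OF d] T.app_smult[OF res_dom[OF x(1)]] T_gam[OF h] T_res[OF x(1)] ..
    also have "\<dots> = complex_of_real a \<odot>\<^bsub>H\<^esub> (gam h \<oplus>\<^bsub>H\<^esub> ?w \<odot>\<^bsub>H\<^esub> res x) \<oplus>\<^bsub>H\<^esub> ?w \<odot>\<^bsub>H\<^esub> x"
      using x(1) h by (intro H.ip_eqI) (simp_all add: H.ip_linear algebra_simps)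
    also have "\<dots> = z \<odot>\<^bsub>H\<^esub> x"
      unfolding x(2)[symmetric] using x(1) by (intro H.ip_eqI) (simp_all add: H.ip_linear algebra_simps)
    finally show ?thesis using x(2) by simp
  qed
  hence "T \<cdot> x = z \<odot>\<^bsub>H\<^esub> x" using x(2) by simp
  moreover have "\<Gamma>0 \<cdot> (gam h \<oplus>\<^bsub>H\<^esub> ?w \<odot>\<^bsub>H\<^esub> res x) = h"
    unfolding \<Gamma>0.app_add[OF d] \<Gamma>0.app_smult[OF res_dom[OF x(1)]] using x(1) h by simp
  hence "\<Gamma>0 \<cdot> x = h" using x(2) by simp
  ultimately show thesis using that[OF xT _ _ x(2,3)] by blast
qed

lemma weyl_bounded:
  assumes z: "cmod (z - complex_of_real a) \<le> \<epsilon> / 2"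
  shows "bounded_operator G G (weyl_function H S \<Gamma>0 \<Gamma>1 z)"
proof -
  let ?M = "weyl_function H S \<Gamma>0 \<Gamma>1 z"
  have ex: "\<exists>x. x \<in> dom T \<and> T \<cdot> x = z \<odot>\<^bsub>H\<^esub> x \<and> \<Gamma>0 \<cdot> x = h \<and> vnorm H x \<le> 2 * vnorm H (gam h)"
    if h: "h \<in> carrier G" for h
    using defect_element[OF z h] by metis
  have dom: "dom ?M = carrier G"
  proof
    show "dom ?M \<subseteq> carrier G"
    proof
      fix h assume "h \<in> dom ?M"
      then obtain x where "op_inverse (\<Gamma>0 |` defect_space H S z) h = Some x"
        by (auto simp: weyl_function_def map_comp_def split: option.splits)
      note x = op_inverse_SomeD[OF this]
      have "x \<in> defect_space H S z" using x(1) by auto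
      hence "x \<in> dom T" "\<Gamma>0 \<cdot> x = h" using x(2) defect_space_iff by auto
      thus "h \<in> carrier G" using \<Gamma>0.app_in by blast
    qed
    show "carrier G \<subseteq> dom ?M"
    proof
      fix h assume "h \<in> carrier G"
      then obtain x where "x \<in> dom T" "T \<cdot> x = z \<odot>\<^bsub>H\<^esub> x" "\<Gamma>0 \<cdot> x = h" using ex by blast
      with weyl_eq[OF z] have "?M h = Some (\<Gamma>1 \<cdot> x)" by blast
      thus "h \<in> dom ?M" by blast
    qed
  qed
  have lin: "linear_operator G G ?M"
  proof (rule linear_operatorI[OF hilbert_G], unfold dom)
    fix h k c assume h: "h \<in> carrier G"
    then obtain x where x: "x \<in> dom T" "T \<cdot> x = z \<odot>\<^bsub>H\<^esub> x" "\<Gamma>0 \<cdot> x = h" using ex by blast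
    note Mh = weyl_eq[OF z x(1,2), unfolded x(3)]
    note [simp] = T.dom_in[OF x(1)]
    show "?M \<cdot> h \<in> carrier G" unfolding Mh using \<Gamma>1.app_in[OF x(1)] by simp
    have "T \<cdot> (c \<odot>\<^bsub>H\<^esub> x) = z \<odot>\<^bsub>H\<^esub> (c \<odot>\<^bsub>H\<^esub> x)"
      unfolding T.app_smult[OF x(1)] x(2) by (rule H.ip_eqI) (simp_all add: H.ip_linear algebra_simps)
    from weyl_eq[OF z T.dom_smult[OF x(1)] this]
    show "?M \<cdot> (c \<odot>\<^bsub>G\<^esub> h) = c \<odot>\<^bsub>G\<^esub> ?M \<cdot> h"
      unfolding Mh \<Gamma>0.app_smult[OF x(1)] \<Gamma>1.app_smult[OF x(1)] x(3) by simp
    assume k: "k \<in> carrier G"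
    then obtain y where y: "y \<in> dom T" "T \<cdot> y = z \<odot>\<^bsub>H\<^esub> y" "\<Gamma>0 \<cdot> y = k" using ex by blast
    note Mk = weyl_eq[OF z y(1,2), unfolded y(3)]
    note [simp] = T.dom_in[OF y(1)]
    have "T \<cdot> (x \<oplus>\<^bsub>H\<^esub> y) = z \<odot>\<^bsub>H\<^esub> (x \<oplus>\<^bsub>H\<^esub> y)"
      unfolding T.app_add[OF x(1) y(1)] x(2) y(2)
      by (rule H.ip_eqI) (simp_all add: H.ip_linear algebra_simps)
    from weyl_eq[OF z T.dom_add[OF x(1) y(1)] this]
    show "?M \<cdot> (h \<oplus>\<^bsub>G\<^esub> k) = ?M \<cdot> h \<oplus>\<^bsub>G\<^esub> ?M \<cdot> k"
      unfolding Mh Mk \<Gamma>0.app_add[OF x(1) y(1)] \<Gamma>1.app_add[OF x(1) y(1)] x(3) y(3) by simp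
  qed simp_all
  obtain C where C: "\<forall>f\<in>dom T. vnorm G (\<Gamma>1 \<cdot> f) \<le> C * sqrt ((vnorm H f)\<^sup>2 + (vnorm H (T \<cdot> f))\<^sup>2)"
    using \<Gamma>1_bounded by blast
  obtain K where K: "K > 0" "\<And>h. h \<in> carrier G \<Longrightarrow> vnorm H (gam h) \<le> K * vnorm G h"
    using gam_bounded by blast
  have "vnorm G (?M \<cdot> h) \<le> \<bar>C\<bar> * ((1 + cmod z) * (2 * K)) * vnorm G h" if h: "h \<in> carrier G" for h
  proof -
    obtain x where x: "x \<in> dom T" "T \<cdot> x = z \<odot>\<^bsub>H\<^esub> x" "\<Gamma>0 \<cdot> x = h" "vnorm H x \<le> 2 * vnorm H (gam h)"
      using ex[OF h] by blast
    note [simp] = T.dom_in[OF x(1)]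
    let ?N = "sqrt ((vnorm H x)\<^sup>2 + (vnorm H (T \<cdot> x))\<^sup>2)"
    have "?M \<cdot> h = \<Gamma>1 \<cdot> x" using weyl_eq[OF z x(1,2), unfolded x(3)] by simp
    hence "vnorm G (?M \<cdot> h) \<le> C * ?N" using C x(1) by metis
    also have "\<dots> \<le> \<bar>C\<bar> * ?N" by (intro mult_right_mono) auto
    also have "\<dots> \<le> \<bar>C\<bar> * (vnorm H x + vnorm H (T \<cdot> x))"
      unfolding x(2) by (intro mult_left_mono sqrt_sum_squares_le_sum) auto
    also have "vnorm H x + vnorm H (T \<cdot> x) = (1 + cmod z) * vnorm H x"
      unfolding x(2) by (simp add: H.vnorm_smult algebra_simps)
    also have "\<bar>C\<bar> * ((1 + cmod z) * vnorm H x) \<le> \<bar>C\<bar> * ((1 + cmod z) * (2 * (K * vnorm G h)))"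
      using x(4) K(2)[OF h] by (intro mult_left_mono) auto
    finally show ?thesis by (simp add: mult.assoc)
  qed
  thus ?thesis unfolding bounded_operator_def using lin dom by blast
qed

lemma weyl_at:
  assumes h: "h \<in> carrier G"
  shows "weyl_function H S \<Gamma>0 \<Gamma>1 (complex_of_real a) h = Some (\<Gamma>1 \<cdot> gam h)"
  using weyl_eq[OF _ gam_dom[OF h] T_gam[OF h]] \<Gamma>0_gam[OF h] \<epsilon>_pos by simp

text \<open>With x in ker (T - w) and \<Gamma>0 x = h, M(w) h - M(a) h = (w - a) \<Gamma>1 (res x).
  Inserting x = gam h + (w - a) res x once more leaves the remainder (w - a)^2 \<Gamma>1 (res (res
  x)), which is quadratic in w - a with a constant independent of w.\<close>

lemma weyl_has_derivative:
  "has_op_derivative G (weyl_function H S \<Gamma>0 \<Gamma>1) weyl_deriv (complex_of_real a)"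
proof -
  let ?M = "weyl_function H S \<Gamma>0 \<Gamma>1"
  let ?a = "complex_of_real a"
  have near: "\<forall>\<^sub>F w in at ?a. cmod (w - ?a) \<le> d" if "d > 0" for d
    unfolding eventually_at using that by (intro exI[of _ d]) (auto simp: dist_norm)
  have half: "\<epsilon> / 2 > 0" using \<epsilon>_pos by simp
  obtain C where C: "C > 0" "\<And>g. g \<in> carrier H \<Longrightarrow> vnorm G (\<Gamma>1 \<cdot> res g) \<le> C * vnorm H g"
    using \<Gamma>1_res_bounded by blast
  obtain K where K: "K > 0" "\<And>h. h \<in> carrier G \<Longrightarrow> vnorm H (gam h) \<le> K * vnorm G h"
    using gam_bounded by blast
  \<comment> \<open>The factors bound, in turn, \<Gamma>1 res, \<open>res\<close>, and the passage
    from h to x.\<close>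
  define L where "L = C * (1 / \<epsilon> * (2 * K))"
  have L: "L > 0" using C K \<epsilon>_pos by (simp add: L_def)
  have main: "vnorm G ((?M w \<cdot> h \<ominus>\<^bsub>G\<^esub> ?M ?a \<cdot> h) \<ominus>\<^bsub>G\<^esub> (w - ?a) \<odot>\<^bsub>G\<^esub> (weyl_deriv \<cdot> h))
      \<le> L * cmod (w - ?a) * cmod (w - ?a) * vnorm G h"
    if w: "cmod (w - ?a) \<le> \<epsilon> / 2" and h: "h \<in> carrier G" for w h
  proof -
    let ?w = "w - ?a"
    obtain x where x: "x \<in> dom T" "T \<cdot> x = w \<odot>\<^bsub>H\<^esub> x" "\<Gamma>0 \<cdot> x = h"
      "x = gam h \<oplus>\<^bsub>H\<^esub> ?w \<odot>\<^bsub>H\<^esub> res x" "vnorm H x \<le> 2 * vnorm H (gam h)"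
      using defect_element[OF w h] by blast
    have xH [simp]: "x \<in> carrier H" by (rule T.dom_in[OF x(1)])
    note d = gam_dom[OF h] T.dom_smult[OF res_dom[OF xH], of ?w]
    have Mw: "?M w \<cdot> h = \<Gamma>1 \<cdot> x" using weyl_eq[OF w x(1,2)] x(3) by simp
    have "\<Gamma>1 \<cdot> (gam h \<oplus>\<^bsub>H\<^esub> ?w \<odot>\<^bsub>H\<^esub> res x) = \<Gamma>1 \<cdot> gam h \<oplus>\<^bsub>G\<^esub> ?w \<odot>\<^bsub>G\<^esub> (\<Gamma>1 \<cdot> res x)"
      unfolding \<Gamma>1.app_add[OF d] \<Gamma>1.app_smult[OF res_dom[OF xH]] ..
    hence G1x: "\<Gamma>1 \<cdot> x = \<Gamma>1 \<cdot> gam h \<oplus>\<^bsub>G\<^esub> ?w \<odot>\<^bsub>G\<^esub> (\<Gamma>1 \<cdot> res x)" using x(4) by simp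
    have rr: "res x \<in> carrier H" by simp
    have "res (gam h \<oplus>\<^bsub>H\<^esub> ?w \<odot>\<^bsub>H\<^esub> res x) = res (gam h) \<oplus>\<^bsub>H\<^esub> ?w \<odot>\<^bsub>H\<^esub> res (res x)"
      using h by (simp add: res_add res_smult)
    hence "res x = res (gam h) \<oplus>\<^bsub>H\<^esub> ?w \<odot>\<^bsub>H\<^esub> res (res x)" using x(4) by simp
    hence "\<Gamma>1 \<cdot> res x = \<Gamma>1 \<cdot> (res (gam h) \<oplus>\<^bsub>H\<^esub> ?w \<odot>\<^bsub>H\<^esub> res (res x))" by simp
    also have "\<dots> = \<Gamma>1 \<cdot> res (gam h) \<oplus>\<^bsub>G\<^esub> ?w \<odot>\<^bsub>G\<^esub> (\<Gamma>1 \<cdot> res (res x))"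
      unfolding \<Gamma>1.app_add[OF res_dom[OF gam_in[OF h]] T.dom_smult[OF res_dom[OF rr]]]
        \<Gamma>1.app_smult[OF res_dom[OF rr]] ..
    finally have G1r: "\<Gamma>1 \<cdot> res x = \<Gamma>1 \<cdot> res (gam h) \<oplus>\<^bsub>G\<^esub> ?w \<odot>\<^bsub>G\<^esub> (\<Gamma>1 \<cdot> res (res x))" .
    have "(?M w \<cdot> h \<ominus>\<^bsub>G\<^esub> ?M ?a \<cdot> h) \<ominus>\<^bsub>G\<^esub> ?w \<odot>\<^bsub>G\<^esub> (weyl_deriv \<cdot> h)
        = (?w * ?w) \<odot>\<^bsub>G\<^esub> (\<Gamma>1 \<cdot> res (res x))"
      unfolding Mw G1x G1r weyl_at[OF h] weyl_deriv_app[OF h] option.sel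
      using h by (intro G.ip_eqI) (simp_all add: G.ip_linear algebra_simps)
    hence "vnorm G ((?M w \<cdot> h \<ominus>\<^bsub>G\<^esub> ?M ?a \<cdot> h) \<ominus>\<^bsub>G\<^esub> ?w \<odot>\<^bsub>G\<^esub> (weyl_deriv \<cdot> h))
        = cmod ?w * cmod ?w * vnorm G (\<Gamma>1 \<cdot> res (res x))"
      by (simp add: G.vnorm_smult norm_mult)
    also have "vnorm G (\<Gamma>1 \<cdot> res (res x)) \<le> C * vnorm H (res x)" using C(2)[OF rr] .
    also have "\<dots> \<le> C * (1 / \<epsilon> * vnorm H x)"
      using res_bound[OF xH] C(1) by (intro mult_left_mono) auto
    also have "\<dots> \<le> C * (1 / \<epsilon> * (2 * (K * vnorm G h)))"
      using x(5) K(2)[OF h] C(1) \<epsilon>_pos by (intro mult_left_mono) auto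
    also have "\<dots> = L * vnorm G h" by (simp add: L_def)
    finally show ?thesis by (simp add: mult_left_mono mult.assoc mult.left_commute)
  qed
  show ?thesis unfolding has_op_derivative_def
  proof (intro conjI allI impI)
    show "bounded_operator G G weyl_deriv" by (rule weyl_deriv_bounded)
    show "bounded_operator G G (?M ?a)" by (rule weyl_bounded) (use \<epsilon>_pos in simp)
    show "\<forall>\<^sub>F w in at ?a. bounded_operator G G (?M w)"
      using near[OF half] by (rule eventually_mono) (rule weyl_bounded)
    fix e :: real assume e: "e > 0"
    have eL: "e / L > 0" using e L by simp
    from near[OF half] near[OF eL]
    show "\<forall>\<^sub>F w in at ?a. \<forall>h\<in>carrier G.
        vnorm G ((?M w \<cdot> h \<ominus>\<^bsub>G\<^esub> ?M ?a \<cdot> h) \<ominus>\<^bsub>G\<^esub> (w - ?a) \<odot>\<^bsub>G\<^esub> (weyl_deriv \<cdot> h))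
          \<le> e * cmod (w - ?a) * vnorm G h"
    proof eventually_elim
      case (elim w)
      show ?case
      proof
        fix h assume h: "h \<in> carrier G"
        have "L * cmod (w - ?a) \<le> e" using elim(2) L by (simp add: pos_le_divide_eq mult.commute)
        hence "L * cmod (w - ?a) * cmod (w - ?a) * vnorm G h \<le> e * cmod (w - ?a) * vnorm G h"
          using h by (intro mult_right_mono) auto
        thus "vnorm G ((?M w \<cdot> h \<ominus>\<^bsub>G\<^esub> ?M ?a \<cdot> h) \<ominus>\<^bsub>G\<^esub> (w - ?a) \<odot>\<^bsub>G\<^esub> (weyl_deriv \<cdot> h))
          \<le> e * cmod (w - ?a) * vnorm G h" using main[OF elim(1) h] by simp
      qed
    qed
  qed
qed

lemma op_deriv_weyl: "op_deriv G (weyl_function H S \<Gamma>0 \<Gamma>1) (complex_of_real a) = weyl_deriv"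
  by (rule G.op_deriv_eqI[OF weyl_has_derivative])

end

section \<open>Regularized boundary triplets\<close>

lemma boundary_tripletI:
  fixes H S
  defines "T \<equiv> op_adjoint H S"
  assumes "hilbert_space H" "dd_closed_symmetric H S" "equal_deficiency_indices H S"
    and "hilbert_space G" "linear_operator H G \<Gamma>0" "linear_operator H G \<Gamma>1"
    and "dom \<Gamma>0 = dom T" "dom \<Gamma>1 = dom T"
    and bound0: "\<And>f. f \<in> dom T \<Longrightarrow>
      vnorm G (\<Gamma>0 \<cdot> f) \<le> C0 * sqrt ((vnorm H f)\<^sup>2 + (vnorm H (T \<cdot> f))\<^sup>2)"
    and bound1: "\<And>f. f \<in> dom T \<Longrightarrow>
      vnorm G (\<Gamma>1 \<cdot> f) \<le> C1 * sqrt ((vnorm H f)\<^sup>2 + (vnorm H (T \<cdot> f))\<^sup>2)"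
    and "\<And>f g. \<lbrakk>f \<in> dom T; g \<in> dom T\<rbrakk> \<Longrightarrow> ip H (T \<cdot> f) g - ip H f (T \<cdot> g)
      = ip G (\<Gamma>1 \<cdot> f) (\<Gamma>0 \<cdot> g) - ip G (\<Gamma>0 \<cdot> f) (\<Gamma>1 \<cdot> g)"
    and "\<And>h0 h1. \<lbrakk>h0 \<in> carrier G; h1 \<in> carrier G\<rbrakk> \<Longrightarrow>
      \<exists>f\<in>dom T. \<Gamma>0 \<cdot> f = h0 \<and> \<Gamma>1 \<cdot> f = h1"
  shows "boundary_triplet H S G \<Gamma>0 \<Gamma>1"
proof -
  have "\<exists>C. \<forall>f\<in>dom T. vnorm G (\<Gamma>0 \<cdot> f) \<le> C * sqrt ((vnorm H f)\<^sup>2 + (vnorm H (T \<cdot> f))\<^sup>2)"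
    by (intro exI[of _ C0] ballI bound0)
  moreover have "\<exists>C. \<forall>f\<in>dom T. vnorm G (\<Gamma>1 \<cdot> f) \<le> C * sqrt ((vnorm H f)\<^sup>2 + (vnorm H (T \<cdot> f))\<^sup>2)"
    by (intro exI[of _ C1] ballI bound1)
  ultimately have "\<forall>\<Gamma>\<in>{\<Gamma>0, \<Gamma>1}. linear_operator H G \<Gamma> \<and> dom \<Gamma> = dom T \<and>
      (\<exists>C. \<forall>f\<in>dom T. vnorm G (\<Gamma> \<cdot> f) \<le> C * sqrt ((vnorm H f)\<^sup>2 + (vnorm H (T \<cdot> f))\<^sup>2))"
    using assms(6-9) by simp
  thus ?thesis
    unfolding boundary_triplet_def T_def[symmetric] using assms(2-5,12,13) by simp
qed

section \<open>The factor R and the adjoint of its inverse\<close>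

locale regularized_triplet = triplet_gap +
  fixes R :: "('b, 'b) operator"
  assumes fact: "factorizes G weyl_deriv R"
begin

lemma bounded_R: "bounded_operator G G R" and zero_resolvent: "0 \<in> resolvent_set G R"
  and weyl_deriv_factor: "weyl_deriv = op_adjoint G R \<circ>\<^sub>m R"
  using fact by (simp_all add: factorizes_def)

lemma dom_R: "dom R = carrier G" and linear_R: "linear_operator G G R"
  using bounded_R by (simp_all add: bounded_operator_def)

end

sublocale regularized_triplet \<subseteq> R: linear_op G G R
  rewrites "dom R = carrier G"
  by (intro linear_op.intro linear_op_axioms.intro hilbert_G linear_R) (rule dom_R)

context regularized_triplet
begin

lemma R_ip:
  assumes x: "x \<in> carrier G" and y: "y \<in> carrier G"
  shows "ip G (R \<cdot> x) (R \<cdot> y) = ip H (gam x) (gam y)"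
proof -
  have "y \<in> dom R" using y by (simp only: dom_R)
  then obtain v where v: "R y = Some v" by blast
  have "weyl_deriv y = Some (weyl_deriv \<cdot> y)" using y by (simp add: weyl_deriv_def)
  \<comment> \<open>The factorization is an equality of partial maps: as M'(a) is defined at y, the
    adjoint of R is defined at \<open>R \<cdot> y\<close>.\<close>
  hence "op_adjoint G R v = Some (weyl_deriv \<cdot> y)"
    using weyl_deriv_factor v by (simp add: map_comp_def)
  hence "ip G (R \<cdot> x) v = ip G x (weyl_deriv \<cdot> y)"
    using G.op_adjoint_eq_Some_iff[OF G.densely_defined_carrier[OF dom_R] equalityD1[OF dom_R]] x
    unfolding dom_R by blast
  also have "\<dots> = cnj (ip H (gam y) (gam x))"
    using x y weyl_deriv_ip[OF y x] G.ip_commute[of x "weyl_deriv \<cdot> y"] by simp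
  also have "\<dots> = ip H (gam x) (gam y)"
    using H.ip_commute[of "gam x" "gam y"] x y by simp
  finally show ?thesis using v by simp
qed

lemma vnorm_R: "x \<in> carrier G \<Longrightarrow> vnorm G (R \<cdot> x) = vnorm H (gam x)"
  by (simp add: vnorm_def R_ip)

lemma R_surj: "y \<in> carrier G \<Longrightarrow> \<exists>x\<in>carrier G. R \<cdot> x = y"
proof -
  assume y: "y \<in> carrier G"
  obtain x where x: "x \<in> carrier G" "R \<cdot> x \<ominus>\<^bsub>G\<^esub> 0 \<odot>\<^bsub>G\<^esub> x = y"
    using resolvent_setD(1)[OF hilbert_G zero_resolvent y] unfolding dom_R by blast
  have "R \<cdot> x \<ominus>\<^bsub>G\<^esub> 0 \<odot>\<^bsub>G\<^esub> x = R \<cdot> x"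
    using R.app_in[OF x(1)] x(1) by (intro G.ip_eqI) (simp_all add: G.ip_linear)
  thus ?thesis using x by metis
qed

text \<open>R x = R y forces gam (x - y) = 0 by \<open>vnorm_R\<close>, and \<open>gam\<close> is
  bounded below.\<close>

lemma R_inj: "inj_on (app R) (dom R)"
proof (rule inj_onI, unfold dom_R)
  fix x y assume x: "x \<in> carrier G" and y: "y \<in> carrier G" and eq: "R \<cdot> x = R \<cdot> y"
  note [simp] = x y R.app_in[OF x] R.app_in[OF y]
  have "R \<cdot> (x \<ominus>\<^bsub>G\<^esub> y) = \<zero>\<^bsub>G\<^esub>"
    unfolding R.app_minus[OF x y] eq by (simp add: a_minus_def G.r_neg)
  hence "vnorm H (gam (x \<ominus>\<^bsub>G\<^esub> y)) = 0" using vnorm_R[of "x \<ominus>\<^bsub>G\<^esub> y"] by simp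
  moreover obtain c where "c > 0" "\<And>h. h \<in> carrier G \<Longrightarrow> c * vnorm G h \<le> vnorm H (gam h)"
    using gam_bounded_below by blast
  ultimately have "vnorm G (x \<ominus>\<^bsub>G\<^esub> y) \<le> 0"
    by (metis G.minus_in mult_le_0_iff not_less x y)
  hence "x \<ominus>\<^bsub>G\<^esub> y = \<zero>\<^bsub>G\<^esub>" by (intro G.vnorm_le_zeroD) simp_all
  thus "x = y" using G.minus_eq_zeroD[of x y] by simp
qed

lemma inverse_R: "x \<in> carrier G \<Longrightarrow> op_inverse R (R \<cdot> x) = Some x"
  by (rule op_inverse_app[OF R_inj]) (simp only: dom_R)

lemma dom_inverse_R: "dom (op_inverse R) = carrier G"
proof -
  have "ran R = carrier G"
    unfolding ran_eq_image dom_R using R_surj R.app_in by blast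
  thus ?thesis by simp
qed

abbreviation L where "L \<equiv> op_adjoint G (op_inverse R)"

text \<open>R maps onto the carrier, so the test vectors in the definition of the adjoint can be
  written as R x; this eliminates the inverse.\<close>

lemma L_iff:
  "L g = Some k \<longleftrightarrow> g \<in> carrier G \<and> k \<in> carrier G \<and> (\<forall>x\<in>carrier G. ip G x g = ip G (R \<cdot> x) k)"
proof -
  have "(\<forall>f\<in>carrier G. ip G (op_inverse R \<cdot> f) g = ip G f k) \<longleftrightarrow>
      (\<forall>x\<in>carrier G. ip G x g = ip G (R \<cdot> x) k)" (is "?A \<longleftrightarrow> ?B")
  proof
    assume A: ?A
    show ?B
    proof
      fix x assume x: "x \<in> carrier G"
      from bspec[OF A R.app_in[OF x]] show "ip G x g = ip G (R \<cdot> x) k"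
        by (simp add: inverse_R[OF x])
    qed
  next
    assume B: ?B
    show ?A
    proof
      fix f assume "f \<in> carrier G"
      then obtain x where x: "x \<in> carrier G" "R \<cdot> x = f" using R_surj by blast
      show "ip G (op_inverse R \<cdot> f) g = ip G f k"
        using bspec[OF B x(1)] inverse_R[OF x(1)] x(2) by simp
    qed
  qed
  thus ?thesis
    unfolding G.op_adjoint_eq_Some_iff[OF G.densely_defined_carrier[OF dom_inverse_R]
        equalityD1[OF dom_inverse_R]] dom_inverse_R by simp
qed

text \<open>Everywhere defined, since \<open>(R\<^sup>-\<^sup>1)\<^sup>* = R (R\<^sup>* R)\<^sup>-\<^sup>1\<close>.\<close>

lemma dom_L: "dom L = carrier G"
proof
  show "dom L \<subseteq> carrier G" using L_iff by blast
  show "carrier G \<subseteq> dom L"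
  proof
    fix g assume g: "g \<in> carrier G"
    obtain C where C: "\<And>x. x \<in> carrier G \<Longrightarrow> vnorm G (weyl_deriv \<cdot> x) \<le> C * vnorm G x"
      using weyl_deriv_bounded unfolding bounded_operator_def by blast
    obtain c where c: "c > 0" "\<And>x. x \<in> carrier G \<Longrightarrow> c * (vnorm G x)\<^sup>2 \<le> Re (ip G (weyl_deriv \<cdot> x) x)"
      using weyl_deriv_positive_definite unfolding positive_definite_def by blast
    have lin: "linear_operator G G weyl_deriv"
      using weyl_deriv_bounded by (simp add: bounded_operator_def)
    interpret D: linear_op G G weyl_deriv
      by (intro linear_op.intro linear_op_axioms.intro hilbert_G lin)
    have minus: "weyl_deriv \<cdot> (x \<ominus>\<^bsub>G\<^esub> y) = weyl_deriv \<cdot> x \<ominus>\<^bsub>G\<^esub> weyl_deriv \<cdot> y"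
      if "x \<in> carrier G" "y \<in> carrier G" for x y
      by (rule D.app_minus) (simp_all only: dom_weyl_deriv that)
    have app: "weyl_deriv \<cdot> x \<in> carrier G" if "x \<in> carrier G" for x
      by (rule D.app_in) (simp only: dom_weyl_deriv that)
    obtain u where u: "u \<in> carrier G" "weyl_deriv \<cdot> u = g"
      by (rule G.surj_of_coercive[of "app weyl_deriv" C c g, OF app minus C c g])
    have "ip G x g = ip G (R \<cdot> x) (R \<cdot> u)" if x: "x \<in> carrier G" for x
    proof -
      have "ip G g x = ip G (R \<cdot> u) (R \<cdot> x)"
        unfolding R_ip[OF u(1) x] u(2)[symmetric] by (rule weyl_deriv_ip[OF u(1) x])
      thus ?thesis
        unfolding G.ip_commute[OF x g] G.ip_commute[OF R.app_in[OF x] R.app_in[OF u(1)]] by (rule arg_cong)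
    qed
    hence "L g = Some (R \<cdot> u)" unfolding L_iff using g R.app_in[OF u(1)] by blast
    thus "g \<in> dom L" by blast
  qed
qed

section \<open>The regularized boundary maps\<close>

definition B0 where "B0 = regularized_\<Gamma>0 R \<Gamma>0"
definition B1 where
  "B1 = regularized_\<Gamma>1 G R (weyl_function H S \<Gamma>0 \<Gamma>1 (complex_of_real a)) \<Gamma>0 \<Gamma>1"

abbreviation rhs where "rhs f \<equiv> T \<cdot> f \<ominus>\<^bsub>H\<^esub> complex_of_real a \<odot>\<^bsub>H\<^esub> f"

lemma rhs_in: "f \<in> dom T \<Longrightarrow> rhs f \<in> carrier H"
  using T.app_in T.dom_in by (simp del: domIff)

lemma \<Gamma>0_Some: "f \<in> dom T \<Longrightarrow> \<exists>k. \<Gamma>0 f = Some k"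
  and \<Gamma>1_Some: "f \<in> dom T \<Longrightarrow> \<exists>k. \<Gamma>1 f = Some k"
proof -
  assume f: "f \<in> dom T"
  have "f \<in> dom \<Gamma>0" using f by (simp only: dom_\<Gamma>0)
  thus "\<exists>k. \<Gamma>0 f = Some k" by blast
  have "f \<in> dom \<Gamma>1" using f by (simp only: dom_\<Gamma>1)
  thus "\<exists>k. \<Gamma>1 f = Some k" by blast
qed

lemma B0_Some:
  assumes f: "f \<in> dom T"
  shows "B0 f = Some (R \<cdot> (\<Gamma>0 \<cdot> f))"
proof -
  have "\<Gamma>0 \<cdot> f \<in> dom R" using \<Gamma>0.app_in[OF f] by (simp only: dom_R)
  then obtain k where k: "R (\<Gamma>0 \<cdot> f) = Some k" by blast
  obtain h where h: "\<Gamma>0 f = Some h" using \<Gamma>0_Some[OF f] by blast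
  show ?thesis using k unfolding B0_def regularized_\<Gamma>0_def map_comp_def h by simp
qed

text \<open>M(a) \<Gamma>0 f is the \<Gamma>1 value of the ker (T - a) component of f, so the
  subtraction leaves exactly the \<open>res\<close> component of
  \<open>decomposition\<close>.\<close>

lemma \<Gamma>1_minus_weyl:
  assumes f: "f \<in> dom T"
  shows "\<Gamma>1 \<cdot> f \<ominus>\<^bsub>G\<^esub> \<Gamma>1 \<cdot> gam (\<Gamma>0 \<cdot> f) = \<Gamma>1 \<cdot> res (rhs f)"
proof -
  note G0 = \<Gamma>0.app_in[OF f]
  note [simp] = \<Gamma>1_gam_in[OF G0] \<Gamma>1_res_in[OF rhs_in[OF f]]
  have "\<Gamma>1 \<cdot> f = \<Gamma>1 \<cdot> res (rhs f) \<oplus>\<^bsub>G\<^esub> \<Gamma>1 \<cdot> gam (\<Gamma>0 \<cdot> f)"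
    using \<Gamma>1.app_add[OF res_dom[OF rhs_in[OF f]] gam_dom[OF G0]] decomposition[OF f] by simp
  thus ?thesis by (simp, intro G.ip_eqI) (simp_all add: G.ip_linear)
qed

lemma B1_Some:
  assumes f: "f \<in> dom T"
  shows "B1 f = L (\<Gamma>1 \<cdot> res (rhs f))"
proof -
  let ?M = "weyl_function H S \<Gamma>0 \<Gamma>1 (complex_of_real a)"
  have comp: "(?M \<circ>\<^sub>m \<Gamma>0) f = Some (\<Gamma>1 \<cdot> gam (\<Gamma>0 \<cdot> f))"
  proof -
    obtain h where h: "\<Gamma>0 f = Some h" using \<Gamma>0_Some[OF f] by blast
    show ?thesis using weyl_at[OF \<Gamma>0.app_in[OF f]] unfolding map_comp_def h by simp
  qed
  have "f \<in> dom \<Gamma>1 \<inter> dom (?M \<circ>\<^sub>m \<Gamma>0)" using comp \<Gamma>1_Some[OF f] by blast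
  hence "op_minus G \<Gamma>1 (?M \<circ>\<^sub>m \<Gamma>0) f = Some (\<Gamma>1 \<cdot> f \<ominus>\<^bsub>G\<^esub> \<Gamma>1 \<cdot> gam (\<Gamma>0 \<cdot> f))"
    unfolding op_minus_def comp by simp
  thus ?thesis unfolding B1_def regularized_\<Gamma>1_def \<Gamma>1_minus_weyl[OF f] by (simp add: map_comp_def)
qed

lemma dom_B0: "dom B0 = dom T"
proof
  show "dom T \<subseteq> dom B0" using B0_Some by blast
  have "f \<in> dom \<Gamma>0" if "f \<in> dom B0" for f
    using that by (auto simp: B0_def regularized_\<Gamma>0_def map_comp_def split: option.splits simp del: dom_\<Gamma>0)
  thus "dom B0 \<subseteq> dom T" unfolding dom_\<Gamma>0 by blast
qed

lemma B1_SomeL: "f \<in> dom T \<Longrightarrow> \<exists>k. B1 f = Some k"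
proof -
  assume f: "f \<in> dom T"
  have "\<Gamma>1 \<cdot> res (rhs f) \<in> dom L" unfolding dom_L using \<Gamma>1_res_in[OF rhs_in[OF f]] .
  thus ?thesis unfolding B1_Some[OF f] by blast
qed

lemma dom_B1: "dom B1 = dom T"
proof
  show "dom T \<subseteq> dom B1" using B1_SomeL by blast
  have "f \<in> dom \<Gamma>1" if "f \<in> dom B1" for f
    using that by (auto simp: B1_def regularized_\<Gamma>1_def op_minus_def map_comp_def
        split: option.splits if_splits simp del: dom_\<Gamma>1)
  thus "dom B1 \<subseteq> dom T" unfolding dom_\<Gamma>1 by blast
qed

lemma B0_in: "f \<in> dom T \<Longrightarrow> B0 \<cdot> f \<in> carrier G"
  using B0_Some R.app_in \<Gamma>0.app_in by simp

text \<open>Against vectors R x the adjoint of the inverse cancels R, and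
  \<open>\<Gamma>1_res_adj\<close> does the rest. As R is onto, this weak form determines
  \<open>B1 \<cdot> f\<close>; linearity, Green's identity and the bound are all derived from
  it.\<close>

lemma B1_in: "f \<in> dom T \<Longrightarrow> B1 \<cdot> f \<in> carrier G"
  and B1_ip: "\<lbrakk>f \<in> dom T; x \<in> carrier G\<rbrakk> \<Longrightarrow> ip G (B1 \<cdot> f) (R \<cdot> x) = ip H (rhs f) (gam x)"
proof -
  assume f: "f \<in> dom T"
  obtain k where k: "B1 f = Some k" using B1_SomeL[OF f] by blast
  hence L: "L (\<Gamma>1 \<cdot> res (rhs f)) = Some k" using B1_Some[OF f] by simp
  note L' = L[unfolded L_iff]
  show "B1 \<cdot> f \<in> carrier G" using L' k by simp
  assume x: "x \<in> carrier G"
  have "ip G (R \<cdot> x) k = ip G x (\<Gamma>1 \<cdot> res (rhs f))" using L' x by metis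
  hence "ip G k (R \<cdot> x) = ip G (\<Gamma>1 \<cdot> res (rhs f)) x"
    using G.ip_commute[of k "R \<cdot> x"] G.ip_commute[of x "\<Gamma>1 \<cdot> res (rhs f)"] L' x R.app_in[OF x] by simp
  thus "ip G (B1 \<cdot> f) (R \<cdot> x) = ip H (rhs f) (gam x)"
    using \<Gamma>1_res_adj[OF rhs_in[OF f] x] k by simp
qed

lemma B1_eqI:
  assumes f: "f \<in> dom T" and h: "h \<in> carrier G"
    and eq: "\<And>x. x \<in> carrier G \<Longrightarrow> ip H (rhs f) (gam x) = ip G h (R \<cdot> x)"
  shows "B1 \<cdot> f = h"
proof (rule G.ip_eqI[OF B1_in[OF f] h])
  fix z assume "z \<in> carrier G"
  then obtain x where "x \<in> carrier G" "R \<cdot> x = z" using R_surj by blast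
  thus "ip G (B1 \<cdot> f) z = ip G h z" using B1_ip[OF f] eq by metis
qed

lemma linear_B0: "linear_operator H G B0"
proof (rule linear_operatorI[OF hilbert_H], unfold dom_B0)
  fix f g c assume f: "f \<in> dom T"
  show "f \<in> carrier H" using f by (rule T.dom_in)
  show "B0 \<cdot> f \<in> carrier G" by (rule B0_in[OF f])
  show "c \<odot>\<^bsub>H\<^esub> f \<in> dom T" by (rule T.dom_smult[OF f])
  show "B0 \<cdot> (c \<odot>\<^bsub>H\<^esub> f) = c \<odot>\<^bsub>G\<^esub> B0 \<cdot> f"
    unfolding B0_Some[OF f] B0_Some[OF T.dom_smult[OF f]] option.sel
    by (simp only: \<Gamma>0.app_smult[OF f] R.app_smult[OF \<Gamma>0.app_in[OF f]])
  assume g: "g \<in> dom T"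
  show "f \<oplus>\<^bsub>H\<^esub> g \<in> dom T" by (rule T.dom_add[OF f g])
  show "B0 \<cdot> (f \<oplus>\<^bsub>H\<^esub> g) = B0 \<cdot> f \<oplus>\<^bsub>G\<^esub> B0 \<cdot> g"
    unfolding B0_Some[OF f] B0_Some[OF g] B0_Some[OF T.dom_add[OF f g]] option.sel
    by (simp only: \<Gamma>0.app_add[OF f g] R.app_add[OF \<Gamma>0.app_in[OF f] \<Gamma>0.app_in[OF g]])
qed (rule T.dom_zero)

lemma linear_B1: "linear_operator H G B1"
proof (rule linear_operatorI[OF hilbert_H], unfold dom_B1)
  fix f g c assume f: "f \<in> dom T"
  note [simp] = T.dom_in[OF f] T.app_in[OF f] B1_in[OF f] R.app_in
  show "f \<in> carrier H" using f by (rule T.dom_in)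
  show "B1 \<cdot> f \<in> carrier G" by (rule B1_in[OF f])
  show d: "c \<odot>\<^bsub>H\<^esub> f \<in> dom T" by (rule T.dom_smult[OF f])
  show "B1 \<cdot> (c \<odot>\<^bsub>H\<^esub> f) = c \<odot>\<^bsub>G\<^esub> B1 \<cdot> f"
    by (rule B1_eqI[OF d])
      (simp_all add: G.ip_linear H.ip_linear B1_ip[OF f] T.app_smult[OF f] algebra_simps)
  assume g: "g \<in> dom T"
  note [simp] = T.dom_in[OF g] T.app_in[OF g] B1_in[OF g]
  show d: "f \<oplus>\<^bsub>H\<^esub> g \<in> dom T" by (rule T.dom_add[OF f g])
  show "B1 \<cdot> (f \<oplus>\<^bsub>H\<^esub> g) = B1 \<cdot> f \<oplus>\<^bsub>G\<^esub> B1 \<cdot> g"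
    by (rule B1_eqI[OF d])
      (simp_all add: G.ip_linear H.ip_linear B1_ip[OF f] B1_ip[OF g] T.app_add[OF f g] algebra_simps)
qed (rule T.dom_zero)

lemma green_B:
  assumes f: "f \<in> dom T" and g: "g \<in> dom T"
  shows "ip H (T \<cdot> f) g - ip H f (T \<cdot> g) = ip G (B1 \<cdot> f) (B0 \<cdot> g) - ip G (B0 \<cdot> f) (B1 \<cdot> g)"
proof -
  note [simp] = T.dom_in[OF f] T.app_in[OF f] T.dom_in[OF g] T.app_in[OF g]
    gam_in[OF \<Gamma>0.app_in[OF f]] gam_in[OF \<Gamma>0.app_in[OF g]]
  \<comment> \<open>Here gam (\<Gamma>0 q) = q - res (rhs q). Symmetry of \<open>res\<close> makes
    the terms with \<open>res\<close> cancel in the difference below, and the terms with a cancel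
    because a is real.\<close>
  have B10: "ip G (B1 \<cdot> p) (B0 \<cdot> q) = ip H (rhs p) q - ip H (rhs p) (res (rhs q))"
    if p: "p \<in> dom T" and q: "q \<in> dom T" for p q
  proof -
    note [simp] = rhs_in[OF p] gam_in[OF \<Gamma>0.app_in[OF q]] res_in[OF rhs_in[OF q]]
    have "ip H (rhs p) q = ip H (rhs p) (res (rhs q) \<oplus>\<^bsub>H\<^esub> gam (\<Gamma>0 \<cdot> q))"
      using decomposition[OF q] by simp
    also have "\<dots> = ip H (rhs p) (res (rhs q)) + ip H (rhs p) (gam (\<Gamma>0 \<cdot> q))"
      by (rule H.ip_add_right) simp_all
    finally show ?thesis
      using B1_ip[OF p \<Gamma>0.app_in[OF q]] B0_Some[OF q] by simp
  qed
  have "ip G (B0 \<cdot> f) (B1 \<cdot> g) = cnj (ip G (B1 \<cdot> g) (B0 \<cdot> f))"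
    by (rule G.ip_commute[OF B0_in[OF f] B1_in[OF g]])
  also have "\<dots> = ip H f (rhs g) - ip H (res (rhs f)) (rhs g)"
    unfolding B10[OF g f]
    using H.ip_commute[OF T.dom_in[OF f] rhs_in[OF g]]
      H.ip_commute[OF res_in[OF rhs_in[OF f]] rhs_in[OF g]] by simp
  finally have 01: "ip G (B0 \<cdot> f) (B1 \<cdot> g) = ip H f (rhs g) - ip H (rhs f) (res (rhs g))"
    using res_sym[OF rhs_in[OF f] rhs_in[OF g]] by simp
  have "ip G (B1 \<cdot> f) (B0 \<cdot> g) - ip G (B0 \<cdot> f) (B1 \<cdot> g) = ip H (rhs f) g - ip H f (rhs g)"
    unfolding B10[OF f g] 01 by simp
  also have "\<dots> = ip H (T \<cdot> f) g - ip H f (T \<cdot> g)"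
    by (simp add: H.ip_linear)
  finally show ?thesis by simp
qed

section \<open>Estimates in terms of a and \<epsilon> alone\<close>

lemma vnorm_rhs:
  assumes f: "f \<in> dom T"
  shows "vnorm H (rhs f) \<le> (1 + \<bar>a\<bar>) * sqrt ((vnorm H f)\<^sup>2 + (vnorm H (T \<cdot> f))\<^sup>2)"
proof -
  let ?N = "sqrt ((vnorm H f)\<^sup>2 + (vnorm H (T \<cdot> f))\<^sup>2)"
  note [simp] = T.dom_in[OF f] T.app_in[OF f]
  have "vnorm H (rhs f) \<le> vnorm H (T \<cdot> f) + \<bar>a\<bar> * vnorm H f"
    using H.vnorm_triangle_minus[of "T \<cdot> f" "complex_of_real a \<odot>\<^bsub>H\<^esub> f"] by (simp add: H.vnorm_smult)
  also have "\<dots> \<le> ?N + \<bar>a\<bar> * ?N"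
    by (intro add_mono mult_left_mono) simp_all
  finally show ?thesis by (simp add: algebra_simps)
qed

text \<open>With B1 f = R x, \<parallel>B1 f\<parallel>^2 is the inner product of (T - a) f with gam
  x, and \<parallel>gam x\<parallel> = \<parallel>B1 f\<parallel>. Hence \<parallel>B1 f\<parallel>
  \<le> \<parallel>(T - a) f\<parallel>: no constant of the given triplet enters.\<close>

lemma B1_bound:
  assumes f: "f \<in> dom T"
  shows "vnorm G (B1 \<cdot> f) \<le> (1 + \<bar>a\<bar>) * sqrt ((vnorm H f)\<^sup>2 + (vnorm H (T \<cdot> f))\<^sup>2)"
proof -
  let ?h = "B1 \<cdot> f"
  note [simp] = B1_in[OF f] rhs_in[OF f]
  obtain x where x: "x \<in> carrier G" "R \<cdot> x = ?h" using R_surj B1_in[OF f] by blast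
  have "complex_of_real ((vnorm G ?h)\<^sup>2) = ip H (rhs f) (gam x)"
    using B1_ip[OF f x(1)] x(2) G.ip_self[OF B1_in[OF f]] by simp
  hence "(vnorm G ?h)\<^sup>2 = cmod (ip H (rhs f) (gam x))"
    by (metis norm_of_real abs_power2)
  also have "\<dots> \<le> vnorm H (rhs f) * vnorm H (gam x)"
    using x(1) by (intro H.cauchy_schwarz) simp_all
  also have "vnorm H (gam x) = vnorm G ?h" using vnorm_R[OF x(1)] x(2) by simp
  finally have "vnorm G ?h * vnorm G ?h \<le> vnorm G ?h * vnorm H (rhs f)"
    by (simp add: power2_eq_square mult.commute)
  hence "vnorm G ?h \<le> vnorm H (rhs f)"
    using G.vnorm_nonneg[OF B1_in[OF f]] H.vnorm_nonneg[OF rhs_in[OF f]]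
    by (cases "vnorm G ?h = 0") (auto simp: mult_le_cancel_left simp del: domIff)
  thus ?thesis using vnorm_rhs[OF f] by linarith
qed

text \<open>By \<open>vnorm_R\<close>, \<parallel>B0 f\<parallel> is the norm of the
  \<open>gam\<close> part of f, which is f - res ((T - a) f).\<close>

lemma B0_bound:
  assumes f: "f \<in> dom T"
  shows "vnorm G (B0 \<cdot> f)
    \<le> (1 + 1 / \<epsilon> * (1 + \<bar>a\<bar>)) * sqrt ((vnorm H f)\<^sup>2 + (vnorm H (T \<cdot> f))\<^sup>2)"
proof -
  let ?N = "sqrt ((vnorm H f)\<^sup>2 + (vnorm H (T \<cdot> f))\<^sup>2)"
  let ?g = "gam (\<Gamma>0 \<cdot> f)"
  note [simp] = rhs_in[OF f] gam_in[OF \<Gamma>0.app_in[OF f]] T.dom_in[OF f] res_in[OF rhs_in[OF f]]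
  have "f \<ominus>\<^bsub>H\<^esub> res (rhs f) = (res (rhs f) \<oplus>\<^bsub>H\<^esub> ?g) \<ominus>\<^bsub>H\<^esub> res (rhs f)"
    using decomposition[OF f] by simp
  also have "\<dots> = ?g"
    by (intro H.ip_eqI) (simp_all add: H.ip_linear)
  finally have "vnorm H ?g = vnorm H (f \<ominus>\<^bsub>H\<^esub> res (rhs f))" by simp
  also have "\<dots> \<le> vnorm H f + vnorm H (res (rhs f))"
    by (rule H.vnorm_triangle_minus) simp_all
  also have "\<dots> \<le> ?N + 1 / \<epsilon> * ((1 + \<bar>a\<bar>) * ?N)"
  proof (rule add_mono)
    have "1 / \<epsilon> * vnorm H (rhs f) \<le> 1 / \<epsilon> * ((1 + \<bar>a\<bar>) * ?N)"
      using vnorm_rhs[OF f] \<epsilon>_pos by (intro mult_left_mono) auto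
    thus "vnorm H (res (rhs f)) \<le> 1 / \<epsilon> * ((1 + \<bar>a\<bar>) * ?N)"
      using res_bound[OF rhs_in[OF f]] by linarith
  qed simp
  finally show ?thesis
    using vnorm_R[OF \<Gamma>0.app_in[OF f]] B0_Some[OF f] by (simp add: algebra_simps)
qed

lemma B_surj:
  assumes h0: "h0 \<in> carrier G" and h1: "h1 \<in> carrier G"
  obtains f where "f \<in> dom T" "B0 \<cdot> f = h0" "B1 \<cdot> f = h1"
    "vnorm H f \<le> vnorm G h0 + 1 / \<epsilon> * vnorm G h1"
    "vnorm H (T \<cdot> f) \<le> \<bar>a\<bar> * (vnorm G h0 + 1 / \<epsilon> * vnorm G h1) + vnorm G h1"
proof -
  obtain x0 where x0: "x0 \<in> carrier G" "R \<cdot> x0 = h0" using R_surj[OF h0] by blast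
  obtain x1 where x1: "x1 \<in> carrier G" "R \<cdot> x1 = h1" using R_surj[OF h1] by blast
  let ?u = "gam x0" and ?g = "gam x1"
  let ?f = "res ?g \<oplus>\<^bsub>H\<^esub> ?u"
  have g: "?g \<in> carrier H" and u: "?u \<in> carrier H" using x0 x1 by simp_all
  note d = res_dom[OF g] gam_dom[OF x0(1)]
  note [simp] = g u res_in[OF g]
  have f: "?f \<in> dom T" by (rule T.dom_add[OF d])
  have "\<Gamma>0 \<cdot> ?f = x0" unfolding \<Gamma>0.app_add[OF d] using res_\<Gamma>0[OF g] x0(1) by simp
  hence 0: "B0 \<cdot> ?f = h0" using B0_Some[OF f] x0(2) by simp
  have Tf: "T \<cdot> ?f = ?g \<oplus>\<^bsub>H\<^esub> complex_of_real a \<odot>\<^bsub>H\<^esub> ?f"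
    unfolding T.app_add[OF d] T_gam[OF x0(1)] T_res[OF g]
    by (rule H.ip_eqI) (simp_all add: H.ip_linear algebra_simps)
  \<comment> \<open>Hence the inner product of rhs f with gam x equals that of R x1 = h1 with R x,
    which is the weak form of B1 f = h1.\<close>
  have "rhs ?f = ?g"
    unfolding Tf by (rule H.ip_eqI) (simp_all add: H.ip_linear)
  hence 1: "B1 \<cdot> ?f = h1"
    using R_ip[OF x1(1)] x1(2) by (intro B1_eqI[OF f h1]) simp
  have n0: "vnorm H ?u = vnorm G h0" and n1: "vnorm H ?g = vnorm G h1"
    using vnorm_R x0 x1 by auto
  have nf: "vnorm H ?f \<le> vnorm G h0 + 1 / \<epsilon> * vnorm G h1"
    using H.vnorm_triangle[of "res ?g" ?u] res_bound[OF g] n0 n1 by simp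
  have "vnorm H (T \<cdot> ?f) \<le> vnorm H ?g + \<bar>a\<bar> * vnorm H ?f"
    unfolding Tf using H.vnorm_triangle[of ?g "complex_of_real a \<odot>\<^bsub>H\<^esub> ?f"] by (simp add: H.vnorm_smult)
  also have "\<dots> \<le> vnorm G h1 + \<bar>a\<bar> * (vnorm G h0 + 1 / \<epsilon> * vnorm G h1)"
    unfolding n1 using nf by (intro add_left_mono mult_left_mono) auto
  finally show thesis using that[OF f 0 1 nf] by simp
qed

text \<open>One constant for f and T f, multiplying the sum of the norms of the data: in this form
  square summability of the data passes to f and T f in the direct sum.\<close>

lemma B_surj_uniform:
  assumes h0: "h0 \<in> carrier G" and h1: "h1 \<in> carrier G"
  shows "\<exists>f\<in>dom T. B0 \<cdot> f = h0 \<and> B1 \<cdot> f = h1 \<and>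
    vnorm H f \<le> (1 + \<bar>a\<bar>) * (1 + 1 / \<epsilon>) * (vnorm G h0 + vnorm G h1) \<and>
    vnorm H (T \<cdot> f) \<le> (1 + \<bar>a\<bar>) * (1 + 1 / \<epsilon>) * (vnorm G h0 + vnorm G h1)"
proof -
  obtain f where f: "f \<in> dom T" "B0 \<cdot> f = h0" "B1 \<cdot> f = h1"
    "vnorm H f \<le> vnorm G h0 + 1 / \<epsilon> * vnorm G h1"
    "vnorm H (T \<cdot> f) \<le> \<bar>a\<bar> * (vnorm G h0 + 1 / \<epsilon> * vnorm G h1) + vnorm G h1"
    using B_surj[OF h0 h1] by blast
  let ?x = "vnorm G h0" and ?y = "vnorm G h1" and ?e = "1 / \<epsilon>"
  have nn: "0 \<le> ?x" "0 \<le> ?y" "0 \<le> ?e" using h0 h1 \<epsilon>_pos by simp_all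
  let ?s = "(1 + ?e) * (?x + ?y)"
  have s: "?x + ?e * ?y \<le> ?s" "?y \<le> ?s" "0 \<le> ?s"
    using nn mult_nonneg_nonneg[OF nn(3,1)] mult_nonneg_nonneg[OF nn(3,2)]
    by (simp_all add: distrib_left distrib_right)
  have "vnorm H (T \<cdot> f) \<le> \<bar>a\<bar> * ?s + ?s"
    using f(5) mult_left_mono[OF s(1), of "\<bar>a\<bar>"] s(2) by linarith
  moreover have "vnorm H f \<le> \<bar>a\<bar> * ?s + ?s"
    using f(4) s(1) mult_nonneg_nonneg[OF abs_ge_zero[of a] s(3)] by linarith
  moreover have "\<bar>a\<bar> * ?s + ?s = (1 + \<bar>a\<bar>) * (1 + ?e) * (?x + ?y)" by (simp add: distrib_right)
  ultimately show ?thesis using f(1-3) by metis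
qed

lemma boundary_triplet_regularized: "boundary_triplet H S G B0 B1"
proof (rule boundary_tripletI[OF hilbert_H dd_closed_symmetric equal_deficiency_indices hilbert_G
      linear_B0 linear_B1 dom_B0 dom_B1 B0_bound B1_bound green_B])
  show "\<exists>f\<in>dom T. B0 \<cdot> f = h0 \<and> B1 \<cdot> f = h1" if "h0 \<in> carrier G" "h1 \<in> carrier G" for h0 h1
    using B_surj[OF that] by metis
qed

end

section \<open>Hilbert sums\<close>

context hilbert_space
begin

lemma tendsto_vnorm_minus:
  assumes "\<And>n. Y n \<in> carrier H" "y \<in> carrier H" "z \<in> carrier H"
    and "(\<lambda>n. vnorm H (Y n \<ominus> y)) \<longlonglongrightarrow> 0"
  shows "(\<lambda>n. vnorm H (z \<ominus> Y n)) \<longlonglongrightarrow> vnorm H (z \<ominus> y)"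
proof (rule LIM_zero_cancel, rule tendsto_0_le[OF assms(4)])
  have "\<bar>vnorm H (z \<ominus> Y n) - vnorm H (z \<ominus> y)\<bar> \<le> vnorm H (Y n \<ominus> y)" for n
    using vnorm_triangle3[of z y "Y n"] vnorm_triangle3[of z "Y n" y]
      vnorm_minus_commute[of y "Y n"] assms(1-3) by fastforce
  thus "\<forall>\<^sub>F n in sequentially. norm (vnorm H (z \<ominus> Y n) - vnorm H (z \<ominus> y))
      \<le> norm (vnorm H (Y n \<ominus> y)) * 1"
    using assms(1,2) by simp
qed

lemma vnorm_add_sq_le:
  assumes "x \<in> carrier H" "y \<in> carrier H"
  shows "(vnorm H (x \<oplus> y))\<^sup>2 \<le> 2 * (vnorm H x)\<^sup>2 + 2 * (vnorm H y)\<^sup>2"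
proof -
  have "(vnorm H (x \<oplus> y))\<^sup>2 \<le> (vnorm H x + vnorm H y)\<^sup>2"
    using assms by (intro power_mono vnorm_triangle) auto
  also have "\<dots> \<le> 2 * (vnorm H x)\<^sup>2 + 2 * (vnorm H y)\<^sup>2"
    using sum_squares_bound[of "vnorm H x" "vnorm H y"] by (simp add: power2_sum)
  finally show ?thesis .
qed

end

lemma hilbert_sum_carrier_iff: "f \<in> carrier (hilbert_sum H) \<longleftrightarrow>
    (\<forall>n. f n \<in> carrier (H n)) \<and> summable (\<lambda>n. (vnorm (H n) (f n))\<^sup>2)"
  by (simp add: hilbert_sum_def)

lemma hilbert_sum_zero: "\<zero>\<^bsub>hilbert_sum H\<^esub> = (\<lambda>n. \<zero>\<^bsub>H n\<^esub>)"
  and hilbert_sum_add: "f \<oplus>\<^bsub>hilbert_sum H\<^esub> g = (\<lambda>n. f n \<oplus>\<^bsub>H n\<^esub> g n)"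
  and hilbert_sum_smult: "c \<odot>\<^bsub>hilbert_sum H\<^esub> f = (\<lambda>n. c \<odot>\<^bsub>H n\<^esub> f n)"
  and hilbert_sum_ip: "ip (hilbert_sum H) f g = (\<Sum>n. ip (H n) (f n) (g n))"
  by (simp_all add: hilbert_sum_def)

section \<open>The Hilbert space structure of the direct sum\<close>

locale hilbert_family =
  fixes H :: "nat \<Rightarrow> 'a hilbert"
  assumes hilb: "\<And>n. hilbert_space (H n)"

sublocale hilbert_family \<subseteq> comp: hilbert_space "H n" for n
  by (rule hilb)

context hilbert_family
begin

abbreviation E where "E \<equiv> hilbert_sum H"

lemma sum_in [simp]: "f \<in> carrier E \<Longrightarrow> f n \<in> carrier (H n)"
  and sum_summable: "f \<in> carrier E \<Longrightarrow> summable (\<lambda>n. (vnorm (H n) (f n))\<^sup>2)"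
  unfolding hilbert_sum_carrier_iff by blast+

lemma family_eqI:
  assumes "\<And>n. f n \<in> carrier (H n)" "\<And>n. g n \<in> carrier (H n)"
    and "\<And>n z. z \<in> carrier (H n) \<Longrightarrow> ip (H n) (f n) z = ip (H n) (g n) z"
  shows "f = g"
  by (rule ext, rule comp.ip_eqI[OF assms])

lemma sum_carrierI:
  assumes "\<And>n. f n \<in> carrier (H n)" "summable t"
    and "\<And>n. (vnorm (H n) (f n))\<^sup>2 \<le> t n"
  shows "f \<in> carrier E"
proof -
  have "summable (\<lambda>n. (vnorm (H n) (f n))\<^sup>2)"
    by (rule summable_comparison_test'[OF assms(2), where N = 0]) (simp add: assms(3))
  thus ?thesis unfolding hilbert_sum_carrier_iff using assms(1) by blast
qed

lemma sum_zero_in: "\<zero>\<^bsub>E\<^esub> \<in> carrier E"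
  by (rule sum_carrierI[where t = "\<lambda>n. 0"]) (simp_all add: hilbert_sum_zero)

lemma sum_add_in:
  assumes "f \<in> carrier E" "g \<in> carrier E"
  shows "f \<oplus>\<^bsub>E\<^esub> g \<in> carrier E"
  unfolding hilbert_sum_add
proof (rule sum_carrierI)
  show "summable (\<lambda>n. 2 * (vnorm (H n) (f n))\<^sup>2 + 2 * (vnorm (H n) (g n))\<^sup>2)"
    using assms by (intro summable_add summable_mult sum_summable)
qed (use assms in \<open>auto intro: comp.vnorm_add_sq_le\<close>)

lemma sum_smult_in:
  assumes "f \<in> carrier E"
  shows "c \<odot>\<^bsub>E\<^esub> f \<in> carrier E"
  unfolding hilbert_sum_smult
proof (rule sum_carrierI)
  show "summable (\<lambda>n. (cmod c)\<^sup>2 * (vnorm (H n) (f n))\<^sup>2)"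
    using assms by (intro summable_mult sum_summable)
qed (use assms in \<open>auto simp: comp.vnorm_smult power_mult_distrib\<close>)

lemma abelian_group_sum: "abelian_group E"
proof (rule abelian_groupI)
  fix x assume x: "x \<in> carrier E"
  have "(-1) \<odot>\<^bsub>E\<^esub> x \<oplus>\<^bsub>E\<^esub> x = \<zero>\<^bsub>E\<^esub>"
    unfolding hilbert_sum_add hilbert_sum_smult hilbert_sum_zero
    using x by (intro family_eqI) (simp_all add: comp.ip_linear)
  thus "\<exists>y\<in>carrier E. y \<oplus>\<^bsub>E\<^esub> x = \<zero>\<^bsub>E\<^esub>" using sum_smult_in[OF x] by blast
next
  fix x y z assume x: "x \<in> carrier E" and y: "y \<in> carrier E"
  show "x \<oplus>\<^bsub>E\<^esub> y \<in> carrier E" by (rule sum_add_in[OF x y])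
  show "x \<oplus>\<^bsub>E\<^esub> y = y \<oplus>\<^bsub>E\<^esub> x"
    unfolding hilbert_sum_add using x y by (intro family_eqI) (simp_all add: comp.ip_linear)
  show "\<zero>\<^bsub>E\<^esub> \<oplus>\<^bsub>E\<^esub> x = x"
    unfolding hilbert_sum_add hilbert_sum_zero using x by (intro family_eqI) simp_all
  assume z: "z \<in> carrier E"
  show "x \<oplus>\<^bsub>E\<^esub> y \<oplus>\<^bsub>E\<^esub> z = x \<oplus>\<^bsub>E\<^esub> (y \<oplus>\<^bsub>E\<^esub> z)"
    unfolding hilbert_sum_add using x y z by (intro family_eqI) (simp_all add: comp.ip_linear)
qed (rule sum_zero_in)

lemma module_sum: "module complex_ring E"
proof (rule moduleI[OF cring_complex_ring abelian_group_sum])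
  fix a b :: complex and x y assume x: "x \<in> carrier E"
  show "a \<odot>\<^bsub>E\<^esub> x \<in> carrier E" by (rule sum_smult_in[OF x])
  show "(a \<oplus>\<^bsub>complex_ring\<^esub> b) \<odot>\<^bsub>E\<^esub> x = a \<odot>\<^bsub>E\<^esub> x \<oplus>\<^bsub>E\<^esub> b \<odot>\<^bsub>E\<^esub> x"
    using x comp.smult_l_distr by (simp add: hilbert_sum_smult hilbert_sum_add)
  show "(a \<otimes>\<^bsub>complex_ring\<^esub> b) \<odot>\<^bsub>E\<^esub> x = a \<odot>\<^bsub>E\<^esub> (b \<odot>\<^bsub>E\<^esub> x)"
    using x comp.smult_assoc1 by (simp add: hilbert_sum_smult)
  show "\<one>\<^bsub>complex_ring\<^esub> \<odot>\<^bsub>E\<^esub> x = x"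
    using x by (simp add: hilbert_sum_smult)
  assume y: "y \<in> carrier E"
  show "a \<odot>\<^bsub>E\<^esub> (x \<oplus>\<^bsub>E\<^esub> y) = a \<odot>\<^bsub>E\<^esub> x \<oplus>\<^bsub>E\<^esub> a \<odot>\<^bsub>E\<^esub> y"
    using x y comp.smult_r_distr by (simp add: hilbert_sum_smult hilbert_sum_add)
qed

text \<open>The structure sets addition componentwise, but \<open>\<ominus>\<close> goes through the
  group inverse, which must first be identified with multiplication by -1.\<close>

lemma sum_minus:
  assumes "f \<in> carrier E" "g \<in> carrier E"
  shows "f \<ominus>\<^bsub>E\<^esub> g = (\<lambda>n. f n \<ominus>\<^bsub>H n\<^esub> g n)"
proof -
  interpret E: module complex_ring E by (rule module_sum)
  have "(-1) \<odot>\<^bsub>E\<^esub> g \<oplus>\<^bsub>E\<^esub> g = \<zero>\<^bsub>E\<^esub>"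
    unfolding hilbert_sum_add hilbert_sum_smult hilbert_sum_zero
    using assms by (intro family_eqI) (simp_all add: comp.ip_linear)
  hence "\<ominus>\<^bsub>E\<^esub> g = (-1) \<odot>\<^bsub>E\<^esub> g"
    using assms sum_smult_in by (intro E.minus_equality)
  thus ?thesis unfolding a_minus_def[of E] hilbert_sum_add hilbert_sum_smult
    using assms by (intro family_eqI) (simp_all add: comp.ip_linear)
qed

lemma summable_ip:
  assumes "f \<in> carrier E" "g \<in> carrier E"
  shows "summable (\<lambda>n. ip (H n) (f n) (g n))"
proof (rule summable_comparison_test'[where N = 0])
  show "summable (\<lambda>n. (vnorm (H n) (f n))\<^sup>2 + (vnorm (H n) (g n))\<^sup>2)"
    using assms by (intro summable_add sum_summable)
  fix n
  let ?a = "vnorm (H n) (f n)" and ?b = "vnorm (H n) (g n)"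
  have "cmod (ip (H n) (f n) (g n)) \<le> ?a * ?b"
    using assms by (intro comp.cauchy_schwarz) auto
  also have "\<dots> \<le> ?a\<^sup>2 + ?b\<^sup>2"
  proof -
    have "0 \<le> ?a * ?b" using assms by (intro mult_nonneg_nonneg) auto
    thus ?thesis using sum_squares_bound[of ?a ?b] by linarith
  qed
  finally show "cmod (ip (H n) (f n) (g n)) \<le> ?a\<^sup>2 + ?b\<^sup>2" .
qed

lemma Re_sum_ip_self:
  assumes f: "f \<in> carrier E"
  shows "Re (ip E f f) = (\<Sum>n. (vnorm (H n) (f n))\<^sup>2)"
  unfolding hilbert_sum_ip using bounded_linear.suminf[OF bounded_linear_Re summable_ip[OF f f]] f
  by (simp add: comp.vnorm_sq)

lemma sum_vnorm_sq:
  assumes f: "f \<in> carrier E"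
  shows "(vnorm E f)\<^sup>2 = (\<Sum>n. (vnorm (H n) (f n))\<^sup>2)"
  using suminf_nonneg[OF sum_summable[OF f]] by (simp add: vnorm_def[of E] Re_sum_ip_self[OF f])

lemma sum_vnorm_nonneg: "f \<in> carrier E \<Longrightarrow> 0 \<le> vnorm E f"
  using suminf_nonneg[OF sum_summable] by (simp add: vnorm_def[of E] Re_sum_ip_self)

lemma vnorm_comp_le:
  assumes f: "f \<in> carrier E"
  shows "vnorm (H n) (f n) \<le> vnorm E f"
proof -
  have "(\<Sum>i\<in>{n}. (vnorm (H i) (f i))\<^sup>2) \<le> (\<Sum>n. (vnorm (H n) (f n))\<^sup>2)"
    by (rule sum_le_suminf[OF sum_summable[OF f]]) auto
  hence "(vnorm (H n) (f n))\<^sup>2 \<le> (vnorm E f)\<^sup>2" by (simp add: sum_vnorm_sq[OF f])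
  thus ?thesis using sum_vnorm_nonneg[OF f] by (rule power2_le_imp_le)
qed

text \<open>A bound on all partial sums gives membership and the norm bound at once, as needed for
  limits known so far only componentwise.\<close>

lemma sum_vnorm_le:
  assumes f: "\<And>n. f n \<in> carrier (H n)" and e: "0 \<le> e"
    and le: "\<And>N. (\<Sum>n<N. (vnorm (H n) (f n))\<^sup>2) \<le> e\<^sup>2"
  shows "f \<in> carrier E" "vnorm E f \<le> e"
proof -
  have s: "summable (\<lambda>n. (vnorm (H n) (f n))\<^sup>2)"
    by (rule bounded_imp_summable[of _ "e\<^sup>2"]) (use le in \<open>auto simp: lessThan_Suc_atMost[symmetric] simp del: sum.lessThan_Suc\<close>)
  show fE: "f \<in> carrier E" using f s by (simp add: hilbert_sum_carrier_iff)
  have "(vnorm E f)\<^sup>2 \<le> e\<^sup>2"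
    unfolding sum_vnorm_sq[OF fE] by (rule suminf_le_const[OF s le])
  thus "vnorm E f \<le> e" using e by (rule power2_le_imp_le)
qed

text \<open>Each component is a Cauchy sequence. The componentwise limit is compared with X k over
  finitely many summands, where l can tend to infinity, and the bound is uniform in the number J of
  summands.\<close>

lemma sum_complete:
  assumes X: "\<And>k. X k \<in> carrier E"
    and cauchy: "\<And>e. 0 < e \<Longrightarrow> \<exists>N. \<forall>k\<ge>N. \<forall>l\<ge>N. vnorm E (X k \<ominus>\<^bsub>E\<^esub> X l) < e"
  shows "\<exists>x\<in>carrier E. (\<lambda>k. vnorm E (X k \<ominus>\<^bsub>E\<^esub> x)) \<longlonglongrightarrow> 0"
proof -
  interpret E: module complex_ring E by (rule module_sum)
  have d: "X k \<ominus>\<^bsub>E\<^esub> X l \<in> carrier E" for k l using X by simp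
  have "\<exists>y\<in>carrier (H n). (\<lambda>k. vnorm (H n) (X k n \<ominus>\<^bsub>H n\<^esub> y)) \<longlonglongrightarrow> 0" for n
  proof (rule comp.complete)
    show "X k n \<in> carrier (H n)" for k using X by simp
    fix e :: real assume "e > 0"
    then obtain N where N: "\<forall>k\<ge>N. \<forall>l\<ge>N. vnorm E (X k \<ominus>\<^bsub>E\<^esub> X l) < e" using cauchy by blast
    have "vnorm (H n) (X k n \<ominus>\<^bsub>H n\<^esub> X l n) \<le> vnorm E (X k \<ominus>\<^bsub>E\<^esub> X l)" for k l
      using vnorm_comp_le[OF d, of n k l] by (simp add: sum_minus X)
    thus "\<exists>N. \<forall>k\<ge>N. \<forall>l\<ge>N. vnorm (H n) (X k n \<ominus>\<^bsub>H n\<^esub> X l n) < e"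
      using N le_less_trans by blast
  qed
  then obtain x where x: "\<And>n. x n \<in> carrier (H n)"
    "\<And>n. (\<lambda>k. vnorm (H n) (X k n \<ominus>\<^bsub>H n\<^esub> x n)) \<longlonglongrightarrow> 0" by metis
  have close: "\<exists>N. \<forall>k\<ge>N. (\<lambda>n. X k n \<ominus>\<^bsub>H n\<^esub> x n) \<in> carrier E \<and>
      vnorm E (\<lambda>n. X k n \<ominus>\<^bsub>H n\<^esub> x n) \<le> e" if e: "e > 0" for e
  proof -
    obtain N where N: "\<And>k l. k \<ge> N \<Longrightarrow> l \<ge> N \<Longrightarrow> vnorm E (X k \<ominus>\<^bsub>E\<^esub> X l) < e"
      using cauchy[OF e] by blast
    show ?thesis
    proof (intro exI[of _ N] allI impI)
      fix k assume k: "k \<ge> N"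
      let ?y = "\<lambda>n. X k n \<ominus>\<^bsub>H n\<^esub> x n"
      have le: "(\<Sum>n<J. (vnorm (H n) (?y n))\<^sup>2) \<le> e\<^sup>2" for J
      proof (rule LIMSEQ_le_const2)
        show "(\<lambda>l. \<Sum>n<J. (vnorm (H n) (X k n \<ominus>\<^bsub>H n\<^esub> X l n))\<^sup>2)
            \<longlonglongrightarrow> (\<Sum>n<J. (vnorm (H n) (?y n))\<^sup>2)"
          using X x by (intro tendsto_sum tendsto_power comp.tendsto_vnorm_minus) auto
        show "\<exists>N. \<forall>l\<ge>N. (\<Sum>n<J. (vnorm (H n) (X k n \<ominus>\<^bsub>H n\<^esub> X l n))\<^sup>2) \<le> e\<^sup>2"
        proof (intro exI[of _ N] allI impI)
          fix l assume l: "l \<ge> N"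
          have "(\<Sum>n<J. (vnorm (H n) (X k n \<ominus>\<^bsub>H n\<^esub> X l n))\<^sup>2) \<le> (vnorm E (X k \<ominus>\<^bsub>E\<^esub> X l))\<^sup>2"
            using sum_le_suminf[OF sum_summable[OF d], of "{..<J}" k l]
            by (simp add: sum_vnorm_sq[OF d]) (simp add: sum_minus X)
          also have "\<dots> \<le> e\<^sup>2"
            using N[OF k l] sum_vnorm_nonneg[OF d] by (intro power_mono) auto
          finally show "(\<Sum>n<J. (vnorm (H n) (X k n \<ominus>\<^bsub>H n\<^esub> X l n))\<^sup>2) \<le> e\<^sup>2" .
        qed
      qed
      have "?y n \<in> carrier (H n)" for n using X x(1) by simp
      from sum_vnorm_le[of ?y e, OF this _ le] e
      show "?y \<in> carrier E \<and> vnorm E ?y \<le> e" by simp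
    qed
  qed
  \<comment> \<open>One index suffices to put the limit into the space, because x = X k - (X k -
    x).\<close>
  obtain k where k: "(\<lambda>n. X k n \<ominus>\<^bsub>H n\<^esub> x n) \<in> carrier E" using close[of 1] by auto
  have "X k \<ominus>\<^bsub>E\<^esub> (\<lambda>n. X k n \<ominus>\<^bsub>H n\<^esub> x n) = x"
    unfolding sum_minus[OF X k] using X x(1) by (intro family_eqI) (simp_all add: comp.ip_linear)
  hence xE: "x \<in> carrier E" using E.minus_closed[OF X[of k] k] by simp
  have "(\<lambda>k. vnorm E (X k \<ominus>\<^bsub>E\<^esub> x)) \<longlonglongrightarrow> 0"
  proof (rule LIMSEQ_I)
    fix r :: real assume r: "r > 0"
    obtain N where "\<forall>k\<ge>N. vnorm E (X k \<ominus>\<^bsub>E\<^esub> x) \<le> r / 2"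
      using close[of "r / 2"] r by (auto simp: sum_minus X xE)
    thus "\<exists>N. \<forall>k\<ge>N. norm (vnorm E (X k \<ominus>\<^bsub>E\<^esub> x) - 0) < r"
      using r sum_vnorm_nonneg[OF E.minus_closed[OF X xE]] by (intro exI[of _ N]) force
  qed
  thus ?thesis using xE by blast
qed

lemma hilbert_space_sum: "hilbert_space E"
proof (intro hilbert_space.intro hilbert_space_axioms.intro)
  show "module complex_ring E" by (rule module_sum)
  fix x y z c
  show "ip E (x \<oplus>\<^bsub>E\<^esub> y) z = ip E x z + ip E y z"
    if "x \<in> carrier E" "y \<in> carrier E" "z \<in> carrier E"
    using that suminf_add[OF summable_ip summable_ip, of x z y z]
    by (simp add: hilbert_sum_ip hilbert_sum_add comp.ip_add)
  show "ip E (c \<odot>\<^bsub>E\<^esub> x) z = c * ip E x z" if "x \<in> carrier E" "z \<in> carrier E"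
    using that suminf_mult[OF summable_ip, of x z c]
    by (simp add: hilbert_sum_ip hilbert_sum_smult comp.ip_smult)
  show "ip E x y = cnj (ip E y x)" if "x \<in> carrier E" "y \<in> carrier E"
  proof -
    have "cnj (ip E y x) = (\<Sum>n. cnj (ip (H n) (y n) (x n)))"
      unfolding hilbert_sum_ip using summable_ip[OF that(2,1)]
      by (rule bounded_linear.suminf[OF bounded_linear_cnj])
    also have "\<dots> = ip E x y"
      unfolding hilbert_sum_ip using that comp.ip_commute[of "x _" _ "y _"] by (intro suminf_cong) simp
    finally show ?thesis by simp
  qed
  show "0 < Re (ip E x x)" if x: "x \<in> carrier E" "x \<noteq> \<zero>\<^bsub>E\<^esub>"
  proof -
    obtain n where "x n \<noteq> \<zero>\<^bsub>H n\<^esub>" using x(2) by (auto simp: hilbert_sum_zero)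
    hence "0 < (vnorm (H n) (x n))\<^sup>2" using comp.vnorm_eq_zero[of "x n" n] x(1) by simp
    thus ?thesis unfolding Re_sum_ip_self[OF x(1)]
      by (intro suminf_pos2[OF sum_summable[OF x(1)]]) auto
  qed
qed (rule sum_complete)

end

sublocale hilbert_family \<subseteq> E: hilbert_space "hilbert_sum H"
  by (rule hilbert_space_sum)

section \<open>Embeddings of the summands\<close>

context hilbert_family
begin

text \<open>The embedding of the n-th summand. It supplies the test vectors for adjoints and the
  bases of the defect spaces.\<close>

definition single :: "nat \<Rightarrow> 'a \<Rightarrow> nat \<Rightarrow> 'a" where
  "single n x = (\<lambda>m. if m = n then x else \<zero>\<^bsub>H m\<^esub>)"

lemma finite_support_in:
  assumes "\<And>n. f n \<in> carrier (H n)" "finite A" "\<And>n. n \<notin> A \<Longrightarrow> f n = \<zero>\<^bsub>H n\<^esub>"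
  shows "f \<in> carrier E"
  unfolding hilbert_sum_carrier_iff using assms(1,3) by (auto intro!: summable_finite[OF assms(2)])

lemma single_in [simp]: "x \<in> carrier (H n) \<Longrightarrow> single n x \<in> carrier E"
  by (rule finite_support_in[of _ "{n}"]) (auto simp: single_def)

lemma ip_single_right:
  assumes "f \<in> carrier E" "x \<in> carrier (H n)"
  shows "ip E f (single n x) = ip (H n) (f n) x"
proof -
  have "(\<Sum>m. ip (H m) (f m) (single n x m)) = (\<Sum>m\<in>{n}. ip (H m) (f m) (single n x m))"
    by (rule suminf_finite) (use assms in \<open>auto simp: single_def\<close>)
  thus ?thesis by (simp add: hilbert_sum_ip single_def)
qed

lemma ip_single_left:
  assumes "f \<in> carrier E" "x \<in> carrier (H n)"
  shows "ip E (single n x) f = ip (H n) x (f n)"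
  using assms E.ip_commute[of "single n x" f] comp.ip_commute[of x n "f n"] ip_single_right[of f x n]
  by simp

end

section \<open>Direct sums of operators\<close>

lemma op_sum_eq_Some_iff:
  "op_sum H K T f = Some g \<longleftrightarrow> f \<in> carrier (hilbert_sum H) \<and> (\<forall>n. f n \<in> dom (T n)) \<and>
     g = (\<lambda>n. T n \<cdot> (f n)) \<and> g \<in> carrier (hilbert_sum K)"
  by (auto simp: op_sum_def)

lemma dom_op_sum: "dom (op_sum H K T) = {f \<in> carrier (hilbert_sum H). (\<forall>n. f n \<in> dom (T n)) \<and>
     (\<lambda>n. T n \<cdot> (f n)) \<in> carrier (hilbert_sum K)}"
  by (auto simp: op_sum_def dom_def split: if_splits)

lemma app_op_sum: "f \<in> dom (op_sum H K T) \<Longrightarrow> op_sum H K T \<cdot> f = (\<lambda>n. T n \<cdot> (f n))"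
  unfolding dom_op_sum by (simp add: op_sum_def)

lemma map_eqI:
  assumes "\<And>x y. f x = Some y \<longleftrightarrow> g x = Some y"
  shows "f = g"
  by (rule ext) (metis assms not_None_eq)

locale operator_family =
  H: hilbert_family H + K: hilbert_family K
  for H :: "nat \<Rightarrow> 'a hilbert" and K :: "nat \<Rightarrow> 'b hilbert" and T :: "nat \<Rightarrow> ('a, 'b) operator" +
  assumes linear_comp: "\<And>n. linear_operator (H n) (K n) (T n)"

sublocale operator_family \<subseteq> T: linear_op "H n" "K n" "T n" for n
  by (intro linear_op.intro linear_op_axioms.intro H.hilb K.hilb linear_comp)

context operator_family
begin

abbreviation A where "A \<equiv> op_sum H K T"

lemma linear_op_sum: "linear_operator (hilbert_sum H) (hilbert_sum K) A"
proof (rule linear_operatorI[OF H.hilbert_space_sum])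
  fix f c assume f: "f \<in> dom A"
  hence fE: "f \<in> carrier (hilbert_sum H)" and fd: "\<And>n. f n \<in> dom (T n)"
    and Tf: "(\<lambda>n. T n \<cdot> (f n)) \<in> carrier (hilbert_sum K)"
    unfolding dom_op_sum by blast+
  show "f \<in> carrier (hilbert_sum H)" by (rule fE)
  show "A \<cdot> f \<in> carrier (hilbert_sum K)" unfolding app_op_sum[OF f] by (rule Tf)
  have eq: "(\<lambda>n. T n \<cdot> ((c \<odot>\<^bsub>hilbert_sum H\<^esub> f) n)) = c \<odot>\<^bsub>hilbert_sum K\<^esub> (\<lambda>n. T n \<cdot> (f n))"
    unfolding hilbert_sum_smult using T.app_smult[OF fd] by simp
  have d: "(c \<odot>\<^bsub>hilbert_sum H\<^esub> f) n \<in> dom (T n)" for n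
    unfolding hilbert_sum_smult by (rule T.dom_smult[OF fd])
  show cd: "c \<odot>\<^bsub>hilbert_sum H\<^esub> f \<in> dom A"
    unfolding dom_op_sum mem_Collect_eq eq
    using H.sum_smult_in[OF fE] K.sum_smult_in[OF Tf] d by blast
  show "A \<cdot> (c \<odot>\<^bsub>hilbert_sum H\<^esub> f) = c \<odot>\<^bsub>hilbert_sum K\<^esub> A \<cdot> f"
    unfolding app_op_sum[OF cd] app_op_sum[OF f] by (rule eq)
  fix g assume g: "g \<in> dom A"
  hence gE: "g \<in> carrier (hilbert_sum H)" and gd: "\<And>n. g n \<in> dom (T n)"
    and Tg: "(\<lambda>n. T n \<cdot> (g n)) \<in> carrier (hilbert_sum K)"
    unfolding dom_op_sum by blast+
  have eq: "(\<lambda>n. T n \<cdot> ((f \<oplus>\<^bsub>hilbert_sum H\<^esub> g) n))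
      = (\<lambda>n. T n \<cdot> (f n)) \<oplus>\<^bsub>hilbert_sum K\<^esub> (\<lambda>n. T n \<cdot> (g n))"
    unfolding hilbert_sum_add using T.app_add[OF fd gd] by simp
  have d: "(f \<oplus>\<^bsub>hilbert_sum H\<^esub> g) n \<in> dom (T n)" for n
    unfolding hilbert_sum_add by (rule T.dom_add[OF fd gd])
  show ad: "f \<oplus>\<^bsub>hilbert_sum H\<^esub> g \<in> dom A"
    unfolding dom_op_sum mem_Collect_eq eq
    using H.sum_add_in[OF fE gE] K.sum_add_in[OF Tf Tg] d by blast
  show "A \<cdot> (f \<oplus>\<^bsub>hilbert_sum H\<^esub> g) = A \<cdot> f \<oplus>\<^bsub>hilbert_sum K\<^esub> A \<cdot> g"
    unfolding app_op_sum[OF ad] app_op_sum[OF f] app_op_sum[OF g] by (rule eq)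
next
  have "(\<lambda>n. T n \<cdot> (\<zero>\<^bsub>hilbert_sum H\<^esub> n)) = \<zero>\<^bsub>hilbert_sum K\<^esub>"
    unfolding hilbert_sum_zero using T.app_zero by simp
  thus "\<zero>\<^bsub>hilbert_sum H\<^esub> \<in> dom A"
    unfolding dom_op_sum mem_Collect_eq
    using H.sum_zero_in K.sum_zero_in T.dom_zero by (simp add: hilbert_sum_zero[of H])
qed

lemma finite_support_dom:
  assumes f: "\<And>n. f n \<in> dom (T n)" and F: "finite F" "\<And>n. n \<notin> F \<Longrightarrow> f n = \<zero>\<^bsub>H n\<^esub>"
  shows "f \<in> dom (op_sum H K T)"
proof -
  have "f \<in> carrier (hilbert_sum H)"
    by (rule H.finite_support_in[OF T.dom_in[OF f] F])
  moreover have "(\<lambda>n. T n \<cdot> (f n)) \<in> carrier (hilbert_sum K)"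
    by (rule K.finite_support_in[OF T.app_in[OF f] F(1)]) (simp add: F(2))
  ultimately show ?thesis unfolding dom_op_sum using f by blast
qed

lemma single_dom:
  assumes "x \<in> dom (T n)"
  shows "H.single n x \<in> dom A"
proof (rule finite_support_dom[of _ "{n}"])
  show "H.single n x m \<in> dom (T m)" for m
    using assms T.dom_zero by (simp add: H.single_def del: domIff)
qed (simp_all add: H.single_def)

lemma app_single:
  assumes x: "x \<in> dom (T n)"
  shows "A \<cdot> H.single n x = K.single n (T n \<cdot> x)"
  unfolding app_op_sum[OF single_dom[OF x]] by (auto simp: H.single_def K.single_def)

end

section \<open>Density, closedness, symmetry and adjoint of the direct sum\<close>

context hilbert_family
begin

text \<open>Approximating every component gives no control over the sum of the \<parallel>S n (y
  n)\<parallel>^2. The approximant therefore has finite support: the tail of x is cut off and only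
  the first N components are approximated.\<close>

lemma densely_defined_op_sum:
  assumes lin: "\<And>n. linear_operator (H n) (H n) (S n)"
    and dense: "\<And>n. densely_defined (H n) (S n)"
  shows "densely_defined E (op_sum H H S)"
  unfolding densely_defined_def
proof (intro ballI allI impI)
  interpret S: operator_family H H S
    by (intro operator_family.intro operator_family_axioms.intro hilbert_family_axioms lin)
  fix x and e :: real assume x: "x \<in> carrier E" and e: "e > 0"
  define t where "t = (\<lambda>n. (vnorm (H n) (x n))\<^sup>2)"
  have t: "summable t" unfolding t_def by (rule sum_summable[OF x])
  have "e\<^sup>2 / 4 > 0" using e by simp
  from suminf_exist_split[OF this t] obtain N where N: "norm (\<Sum>i. t (i + N)) < e\<^sup>2 / 4"
    by blast
  \<comment> \<open>N components with error d each contribute at most e^2/4 to the squared error,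
    and the tail contributes less than e^2/4; N + 1 avoids division by zero.\<close>
  define d where "d = sqrt (e\<^sup>2 / (4 * (real N + 1)))"
  have d: "d > 0" using e by (simp add: d_def)
  have d2: "d\<^sup>2 = e\<^sup>2 / (4 * (real N + 1))" by (simp add: d_def)
  have "\<exists>y\<in>dom (S n). vnorm (H n) (x n \<ominus>\<^bsub>H n\<^esub> y) < d" for n
    using dense[of n] x d unfolding densely_defined_def by simp
  then obtain y where y: "\<And>n. y n \<in> dom (S n)" "\<And>n. vnorm (H n) (x n \<ominus>\<^bsub>H n\<^esub> y n) < d" by metis
  define z where "z n = (if n < N then y n else \<zero>\<^bsub>H n\<^esub>)" for n
  have zd: "z n \<in> dom (S n)" for n using y(1) S.T.dom_zero by (simp add: z_def del: domIff)
  have z: "z \<in> dom (op_sum H H S)"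
    by (rule S.finite_support_dom[OF zd, of "{..<N}"]) (auto simp: z_def)
  have zE: "z \<in> carrier E" using z unfolding dom_op_sum by blast
  let ?u = "\<lambda>n. (vnorm (H n) (x n \<ominus>\<^bsub>H n\<^esub> z n))\<^sup>2"
  note xz = E.minus_in[OF x zE]
  have u: "summable ?u" using sum_summable[OF xz] by (simp add: sum_minus x zE)
  have "(vnorm E (x \<ominus>\<^bsub>E\<^esub> z))\<^sup>2 = (\<Sum>n. ?u n)"
    using sum_vnorm_sq[OF xz] by (simp add: sum_minus x zE)
  also have "\<dots> = (\<Sum>i. ?u (i + N)) + (\<Sum>n<N. ?u n)"
    by (rule suminf_split_initial_segment[OF u])
  also have "(\<lambda>i. ?u (i + N)) = (\<lambda>i. t (i + N))"
    using x by (simp add: z_def t_def)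
  also have "(\<Sum>i. t (i + N)) < e\<^sup>2 / 4" using N by auto
  also have "(\<Sum>n<N. ?u n) \<le> (\<Sum>n<N. d\<^sup>2)"
    using x y zE by (intro sum_mono power_mono) (auto simp: z_def intro: less_imp_le comp.vnorm_nonneg S.T.dom_in)
  also have "(\<Sum>n<N. d\<^sup>2) \<le> e\<^sup>2 / 4"
    using zero_le_power2[of e] by (simp add: d2 field_simps)
  finally have "(vnorm E (x \<ominus>\<^bsub>E\<^esub> z))\<^sup>2 < e\<^sup>2 / 4 + e\<^sup>2 / 4" by simp
  hence "(vnorm E (x \<ominus>\<^bsub>E\<^esub> z))\<^sup>2 < e\<^sup>2"
    using zero_le_power2[of e] by linarith
  hence "vnorm E (x \<ominus>\<^bsub>E\<^esub> z) < e" by (rule power2_less_imp_less) (use e in simp)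
  thus "\<exists>y\<in>dom (op_sum H H S). vnorm E (x \<ominus>\<^bsub>E\<^esub> y) < e" using z by blast
qed

text \<open>Convergence in the sum implies convergence of each component, where closedness of S n
  applies. Square summability of the limiting image is already contained in y being an element of
  the sum.\<close>

lemma closed_operator_op_sum:
  assumes lin: "\<And>n. linear_operator (H n) (H n) (S n)"
    and closed: "\<And>n. closed_operator (H n) (S n)"
  shows "closed_operator E (op_sum H H S)"
  unfolding closed_operator_def
proof (intro ballI allI impI, elim conjE)
  interpret S: operator_family H H S
    by (intro operator_family.intro operator_family_axioms.intro hilbert_family_axioms lin)
  let ?A = "op_sum H H S"
  fix X x y assume x: "x \<in> carrier E" and y: "y \<in> carrier E" and X: "\<forall>k. X k \<in> dom ?A"
    and lim: "(\<lambda>k. vnorm E (X k \<ominus>\<^bsub>E\<^esub> x)) \<longlonglongrightarrow> 0"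
    and Alim: "(\<lambda>k. vnorm E (?A \<cdot> X k \<ominus>\<^bsub>E\<^esub> y)) \<longlonglongrightarrow> 0"
  have Xk: "X k \<in> dom ?A" for k using X by blast
  have XE: "X k \<in> carrier E" and Xd: "X k n \<in> dom (S n)"
    and SX: "(\<lambda>n. S n \<cdot> (X k n)) \<in> carrier E" for k n
    using Xk unfolding dom_op_sum by blast+
  have S: "S n (x n) = Some (y n)" for n
  proof -
    have "(\<lambda>k. vnorm (H n) (X k n \<ominus>\<^bsub>H n\<^esub> x n)) \<longlonglongrightarrow> 0"
    proof (rule tendsto_0_le[OF lim, of _ 1], intro always_eventually allI)
      fix k
      show "norm (vnorm (H n) (X k n \<ominus>\<^bsub>H n\<^esub> x n)) \<le> norm (vnorm E (X k \<ominus>\<^bsub>E\<^esub> x)) * 1"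
        using vnorm_comp_le[OF E.minus_in[OF XE x], of n k] by (simp add: sum_minus XE x)
    qed
    moreover have "(\<lambda>k. vnorm (H n) (S n \<cdot> (X k n) \<ominus>\<^bsub>H n\<^esub> y n)) \<longlonglongrightarrow> 0"
    proof (rule tendsto_0_le[OF Alim, of _ 1], intro always_eventually allI)
      fix k
      show "norm (vnorm (H n) (S n \<cdot> (X k n) \<ominus>\<^bsub>H n\<^esub> y n)) \<le> norm (vnorm E (?A \<cdot> X k \<ominus>\<^bsub>E\<^esub> y)) * 1"
        unfolding app_op_sum[OF Xk]
        using vnorm_comp_le[OF E.minus_in[OF SX y], of n k] comp.minus_in[OF S.T.app_in[OF Xd] sum_in[OF y]]
        by (simp add: sum_minus SX y)
    qed
    ultimately show ?thesis
      using closed[of n, unfolded closed_operator_def] x y Xd by (metis sum_in)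
  qed
  have "x n \<in> dom (S n)" for n using S by blast
  moreover have "(\<lambda>n. S n \<cdot> (x n)) = y" using S by simp
  ultimately show "?A x = Some y" unfolding op_sum_eq_Some_iff using x y by blast
qed

lemma symmetric_operator_op_sum:
  assumes "\<And>n. symmetric_operator (H n) (S n)"
  shows "symmetric_operator E (op_sum H H S)"
  unfolding symmetric_operator_def
proof (intro ballI)
  fix f g assume f: "f \<in> dom (op_sum H H S)" and g: "g \<in> dom (op_sum H H S)"
  have "f n \<in> dom (S n)" "g n \<in> dom (S n)" for n using f g unfolding dom_op_sum by blast+
  hence "ip (H n) (S n \<cdot> (f n)) (g n) = ip (H n) (f n) (S n \<cdot> (g n))" for n
    using assms[of n] unfolding symmetric_operator_def by blast
  thus "ip E (op_sum H H S \<cdot> f) g = ip E f (op_sum H H S \<cdot> g)"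
    unfolding app_op_sum[OF f] app_op_sum[OF g] hilbert_sum_ip by simp
qed

text \<open>Testing with vectors supported in one summand yields the componentwise adjoint
  relations; conversely these relations are summed termwise. The summability condition on the image
  is membership of h in the sum.\<close>

lemma op_adjoint_op_sum:
  assumes lin: "\<And>n. linear_operator (H n) (H n) (S n)"
    and dense: "\<And>n. densely_defined (H n) (S n)"
  shows "op_adjoint E (op_sum H H S) = op_sum H H (\<lambda>n. op_adjoint (H n) (S n))"
proof (rule map_eqI)
  interpret S: operator_family H H S
    by (intro operator_family.intro operator_family_axioms.intro hilbert_family_axioms lin)
  let ?A = "op_sum H H S"
  fix g h
  have domA: "dom ?A \<subseteq> carrier E" unfolding dom_op_sum by blast
  note iffE = E.op_adjoint_eq_Some_iff[OF densely_defined_op_sum[OF lin dense] domA]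
  have iff: "op_adjoint (H n) (S n) u = Some v \<longleftrightarrow> u \<in> carrier (H n) \<and> v \<in> carrier (H n) \<and>
    (\<forall>f\<in>dom (S n). ip (H n) (S n \<cdot> f) u = ip (H n) f v)" for n u v
    by (rule comp.op_adjoint_eq_Some_iff[OF dense]) (auto intro: S.T.dom_in)
  show "op_adjoint E ?A g = Some h \<longleftrightarrow> op_sum H H (\<lambda>n. op_adjoint (H n) (S n)) g = Some h"
  proof
    assume "op_adjoint E ?A g = Some h"
    hence g: "g \<in> carrier E" and h: "h \<in> carrier E"
      and eq: "\<And>f. f \<in> dom ?A \<Longrightarrow> ip E (?A \<cdot> f) g = ip E f h"
      unfolding iffE by blast+
    have *: "op_adjoint (H n) (S n) (g n) = Some (h n)" for n
      unfolding iff
    proof (intro conjI ballI)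
      fix f assume f: "f \<in> dom (S n)"
      show "ip (H n) (S n \<cdot> f) (g n) = ip (H n) f (h n)"
        using eq[OF S.single_dom[OF f]] g h S.T.dom_in[OF f] S.T.app_in[OF f]
        by (simp add: S.app_single[OF f] ip_single_left)
    qed (use g h in auto)
    have "g n \<in> dom (op_adjoint (H n) (S n))" for n using * by blast
    moreover have "(\<lambda>n. op_adjoint (H n) (S n) \<cdot> (g n)) = h" using * by simp
    ultimately show "op_sum H H (\<lambda>n. op_adjoint (H n) (S n)) g = Some h"
      unfolding op_sum_eq_Some_iff using g h by blast
  next
    assume "op_sum H H (\<lambda>n. op_adjoint (H n) (S n)) g = Some h"
    hence g: "g \<in> carrier E" and h: "h \<in> carrier E" and gd: "\<And>n. g n \<in> dom (op_adjoint (H n) (S n))"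
      and h_eq: "h = (\<lambda>n. op_adjoint (H n) (S n) \<cdot> (g n))"
      unfolding op_sum_eq_Some_iff by blast+
    have *: "op_adjoint (H n) (S n) (g n) = Some (h n)" for n
    proof -
      obtain v where "op_adjoint (H n) (S n) (g n) = Some v" using gd[of n] by blast
      thus ?thesis using h_eq by simp
    qed
    show "op_adjoint E ?A g = Some h"
      unfolding iffE
    proof (intro conjI ballI g h)
      fix f assume f: "f \<in> dom ?A"
      have "f n \<in> dom (S n)" for n using f unfolding dom_op_sum by blast
      hence "ip (H n) (S n \<cdot> (f n)) (g n) = ip (H n) (f n) (h n)" for n
        using *[of n] unfolding iff by blast
      thus "ip E (?A \<cdot> f) g = ip E f h" unfolding app_op_sum[OF f] hilbert_sum_ip by simp
    qed
  qed
qed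

lemma dd_closed_symmetric_op_sum:
  assumes dd: "\<And>n. dd_closed_symmetric (H n) (S n)"
  shows "dd_closed_symmetric E (op_sum H H S)"
proof -
  note dd' = dd[unfolded dd_closed_symmetric_def]
  interpret S: operator_family H H S
    by (intro operator_family.intro operator_family_axioms.intro hilbert_family_axioms) (use dd' in blast)
  show ?thesis unfolding dd_closed_symmetric_def
    using S.linear_op_sum densely_defined_op_sum closed_operator_op_sum symmetric_operator_op_sum dd'
    by (intro conjI) blast+
qed

end

section \<open>Direct sums of boundary triplets\<close>

context hilbert_family
begin

text \<open>For a family of componentwise eigenvectors the image is z f, so the summability
  condition in the domain of the adjoint follows from f being in the sum.\<close>

lemma defect_space_op_sum:
  assumes lin: "\<And>n. linear_operator (H n) (H n) (S n)"
    and dense: "\<And>n. densely_defined (H n) (S n)"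
  shows "defect_space E (op_sum H H S) z =
    {f \<in> carrier E. \<forall>n. f n \<in> defect_space (H n) (S n) z}"
proof -
  interpret S: operator_family H H S
    by (intro operator_family.intro operator_family_axioms.intro hilbert_family_axioms lin)
  let ?T = "\<lambda>n. op_adjoint (H n) (S n)"
  have "f \<in> defect_space E (op_sum H H S) z \<longleftrightarrow>
      f \<in> carrier E \<and> (\<forall>n. f n \<in> defect_space (H n) (S n) z)" for f
  proof -
    have "f \<in> defect_space E (op_sum H H S) z \<longleftrightarrow>
        f \<in> dom (op_sum H H ?T) \<and> op_sum H H ?T \<cdot> f = z \<odot>\<^bsub>E\<^esub> f"
      unfolding op_adjoint_op_sum[OF lin dense, symmetric]
      by (rule mem_defect_space_iff[OF hilbert_space_sum S.linear_op_sum densely_defined_op_sum[OF lin dense]])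
    also have "\<dots> \<longleftrightarrow> op_sum H H ?T f = Some (z \<odot>\<^bsub>E\<^esub> f)" by auto
    also have "\<dots> \<longleftrightarrow> f \<in> carrier E \<and> (\<forall>n. f n \<in> dom (?T n) \<and> ?T n \<cdot> f n = z \<odot>\<^bsub>H n\<^esub> f n)"
      unfolding op_sum_eq_Some_iff using sum_smult_in[of f z]
      by (auto simp: hilbert_sum_smult fun_eq_iff simp del: domIff)
    finally show ?thesis unfolding mem_defect_space_iff[OF hilb lin dense] by simp
  qed
  thus ?thesis by blast
qed

text \<open>A nonzero x excludes the only coincidence: all embeddings agree at zero.\<close>

lemma single_inject:
  assumes "x \<noteq> \<zero>\<^bsub>H n\<^esub>" "single n x = single m y"
  shows "n = m \<and> x = y"
proof -
  have "single n x n = single m y n" using assms(2) by simp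
  thus ?thesis using assms(1) by (auto simp: single_def split: if_splits)
qed

text \<open>Maximality is componentwise: a vector orthogonal to all embedded bases has each
  component orthogonal to the basis of its summand.\<close>

lemma orthonormal_basis_sum:
  assumes N: "\<And>n. N n \<subseteq> carrier (H n)" "\<And>n. \<zero>\<^bsub>H n\<^esub> \<in> N n"
    and B: "\<And>n. orthonormal_basis (H n) (N n) (B n)"
  shows "orthonormal_basis E {f \<in> carrier E. \<forall>n. f n \<in> N n} (\<Union>n. single n ` B n)"
  unfolding orthonormal_basis_def
proof (intro conjI ballI subsetI impI)
  have BN: "b \<in> N n" and Bc: "b \<in> carrier (H n)" if "b \<in> B n" for b n
    using that N(1)[of n] B[of n] unfolding orthonormal_basis_def by blast+
  have Bip: "ip (H n) b c = (if b = c then 1 else 0)" if "b \<in> B n" "c \<in> B n" for b c n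
    using that B[of n] unfolding orthonormal_basis_def by blast
  have Bnz: "b \<noteq> \<zero>\<^bsub>H n\<^esub>" if "b \<in> B n" for b n
    using Bip[OF that that] Bc[OF that] by auto
  {
    fix x assume "x \<in> (\<Union>n. single n ` B n)"
    then obtain n b where x: "x = single n b" "b \<in> B n" by blast
    show "x \<in> {f \<in> carrier E. \<forall>n. f n \<in> N n}"
      unfolding x(1) using single_in[OF Bc[OF x(2)]] BN[OF x(2)] N(2) by (simp add: single_def)
    fix y assume "y \<in> (\<Union>n. single n ` B n)"
    then obtain m c where y: "y = single m c" "c \<in> B m" by blast
    have "ip E x y = ip (H m) (single n b m) c"
      unfolding x(1) y(1) by (rule ip_single_right[OF single_in[OF Bc[OF x(2)]] Bc[OF y(2)]])
    also have "\<dots> = (if x = y then 1 else 0)"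
    proof (cases "n = m")
      case True
      have "x = y \<longleftrightarrow> b = c" using single_inject[OF Bnz[OF x(2)], of m c] True x(1) y(1) by auto
      thus ?thesis using Bip[of b m c] x(2) y(2) True by (simp add: single_def)
    next
      case False
      hence "x \<noteq> y" using single_inject[OF Bnz[OF x(2)], of m c] x(1) y(1) by auto
      thus ?thesis using False Bc[OF y(2)] by (simp add: single_def)
    qed
    finally show "ip E x y = (if x = y then 1 else 0)" .
  }
  fix f assume f: "f \<in> {f \<in> carrier E. \<forall>n. f n \<in> N n}"
    and orth: "\<forall>y\<in>(\<Union>n. single n ` B n). ip E f y = 0"
  have "f n = \<zero>\<^bsub>H n\<^esub>" for n
  proof -
    have "ip (H n) (f n) b = 0" if b: "b \<in> B n" for b
    proof -
      have "ip E f (single n b) = 0" using orth b by blast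
      thus ?thesis using ip_single_right[of f b n] f Bc[OF b] by simp
    qed
    thus ?thesis using B[of n] f unfolding orthonormal_basis_def by blast
  qed
  thus "f = \<zero>\<^bsub>E\<^esub>" by (auto simp: hilbert_sum_zero)
qed

text \<open>Without zero the embedded sets are disjoint, so their union is equipotent to the
  disjoint sum.\<close>

lemma single_Union_eqpoll:
  assumes "\<And>n. \<zero>\<^bsub>H n\<^esub> \<notin> B n"
  shows "(\<Union>n. single n ` B n) \<approx> Sigma UNIV B"
proof -
  have "inj_on (\<lambda>(n, b). single n b) (Sigma UNIV B)"
  proof (rule inj_onI, clarify)
    fix n b m c assume b: "b \<in> B n" and eq: "single n b = single m c"
    have "b \<noteq> \<zero>\<^bsub>H n\<^esub>" using assms b by metis
    thus "n = m \<and> b = c" using single_inject eq by blast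
  qed
  moreover have "(\<lambda>(n, b). single n b) ` Sigma UNIV B = (\<Union>n. single n ` B n)"
    by (auto simp: image_iff)
  ultimately have "bij_betw (\<lambda>(n, b). single n b) (Sigma UNIV B) (\<Union>n. single n ` B n)"
    by (simp add: bij_betw_def)
  thus ?thesis using eqpoll_def eqpoll_sym by blast
qed

text \<open>Bijections chosen between the two bases of each summand combine to a bijection of the
  disjoint sums, hence of the assembled bases.\<close>

lemma equal_deficiency_indices_op_sum:
  assumes lin: "\<And>n. linear_operator (H n) (H n) (S n)"
    and dense: "\<And>n. densely_defined (H n) (S n)"
    and defi: "\<And>n. equal_deficiency_indices (H n) (S n)"
  shows "equal_deficiency_indices E (op_sum H H S)"
proof -
  have "\<exists>B C. orthonormal_basis (H n) (defect_space (H n) (S n) \<i>) B \<and>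
      orthonormal_basis (H n) (defect_space (H n) (S n) (- \<i>)) C \<and> B \<approx> C" for n
    using defi[of n] unfolding equal_deficiency_indices_def .
  then obtain B C where
    B: "\<And>n. orthonormal_basis (H n) (defect_space (H n) (S n) \<i>) (B n)" and
    C: "\<And>n. orthonormal_basis (H n) (defect_space (H n) (S n) (- \<i>)) (C n)" and
    BC: "\<And>n. B n \<approx> C n" by metis
  have N: "defect_space (H n) (S n) z \<subseteq> carrier (H n)" "\<zero>\<^bsub>H n\<^esub> \<in> defect_space (H n) (S n) z" for n z
  proof -
    interpret T: linear_op "H n" "H n" "op_adjoint (H n) (S n)"
      by (intro linear_op.intro linear_op_axioms.intro hilb linear_op_adjoint lin dense)
    show "defect_space (H n) (S n) z \<subseteq> carrier (H n)"
      using mem_defect_space_iff[OF hilb lin dense] T.dom_in by blast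
    show "\<zero>\<^bsub>H n\<^esub> \<in> defect_space (H n) (S n) z"
      unfolding mem_defect_space_iff[OF hilb lin dense] using T.dom_zero by simp
  qed
  have nz: "\<zero>\<^bsub>H n\<^esub> \<notin> B'" if "orthonormal_basis (H n) (defect_space (H n) (S n) z) B'" for n z B'
  proof
    assume 0: "\<zero>\<^bsub>H n\<^esub> \<in> B'"
    have "\<forall>x\<in>B'. \<forall>y\<in>B'. ip (H n) x y = (if x = y then 1 else 0)"
      using that unfolding orthonormal_basis_def by blast
    from bspec[OF bspec[OF this 0] 0] show False by simp
  qed
  obtain \<phi> where \<phi>: "\<And>n. bij_betw (\<phi> n) (B n) (C n)" using BC unfolding eqpoll_def by metis
  have "bij_betw (\<lambda>(n, b). (n, \<phi> n b)) (Sigma UNIV B) (Sigma UNIV C)"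
    unfolding bij_betw_def
  proof
    show "inj_on (\<lambda>(n, b). (n, \<phi> n b)) (Sigma UNIV B)"
      using \<phi> unfolding bij_betw_def inj_on_def by auto
    have "C = (\<lambda>n. \<phi> n ` B n)" using bij_betw_imp_surj_on[OF \<phi>] by simp
    thus "(\<lambda>(n, b). (n, \<phi> n b)) ` Sigma UNIV B = Sigma UNIV C" by auto
  qed
  hence "Sigma UNIV B \<approx> Sigma UNIV C" unfolding eqpoll_def by blast
  hence "(\<Union>n. single n ` B n) \<approx> (\<Union>n. single n ` C n)"
    using single_Union_eqpoll[of B, OF nz[OF B]] single_Union_eqpoll[of C, OF nz[OF C]]
    by (meson eqpoll_sym eqpoll_trans)
  thus ?thesis
    unfolding equal_deficiency_indices_def defect_space_op_sum[OF lin dense]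
    using orthonormal_basis_sum[OF N B] orthonormal_basis_sum[OF N C] by blast
qed

end

section \<open>Direct sums of uniformly bounded boundary maps\<close>

locale boundary_map_family =
  H: hilbert_family H + G: hilbert_family G
  for H :: "nat \<Rightarrow> 'a hilbert" and G :: "nat \<Rightarrow> 'b hilbert" +
  fixes S :: "nat \<Rightarrow> ('a, 'a) operator" and \<Gamma> :: "nat \<Rightarrow> ('a, 'b) operator" and C :: real
  assumes linear_S: "\<And>n. linear_operator (H n) (H n) (S n)"
    and dense_S: "\<And>n. densely_defined (H n) (S n)"
    and linear_\<Gamma>: "\<And>n. linear_operator (H n) (G n) (\<Gamma> n)"
    and dom_\<Gamma>: "\<And>n. dom (\<Gamma> n) = dom (op_adjoint (H n) (S n))"
    and \<Gamma>_bound: "\<And>n f. f \<in> dom (op_adjoint (H n) (S n)) \<Longrightarrow> vnorm (G n) (\<Gamma> n \<cdot> f)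
      \<le> C * sqrt ((vnorm (H n) f)\<^sup>2 + (vnorm (H n) (op_adjoint (H n) (S n) \<cdot> f))\<^sup>2)"

sublocale boundary_map_family \<subseteq> S: operator_family H H S
  by (intro operator_family.intro operator_family_axioms.intro H.hilbert_family_axioms linear_S)
sublocale boundary_map_family \<subseteq> \<Gamma>: operator_family H G \<Gamma>
  by (intro operator_family.intro operator_family_axioms.intro H.hilbert_family_axioms
      G.hilbert_family_axioms linear_\<Gamma>)
sublocale boundary_map_family \<subseteq> T: operator_family H H "\<lambda>n. op_adjoint (H n) (S n)"
  by (intro operator_family.intro operator_family_axioms.intro H.hilbert_family_axioms
      linear_op_adjoint H.hilb linear_S dense_S)

context boundary_map_family
begin

abbreviation T where "T \<equiv> op_adjoint (hilbert_sum H) (op_sum H H S)"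

lemma T_eq: "T = op_sum H H (\<lambda>n. op_adjoint (H n) (S n))"
  by (rule H.op_adjoint_op_sum[OF linear_S dense_S])

lemma T_domD:
  assumes "f \<in> dom T"
  shows "f \<in> carrier (hilbert_sum H)" "f n \<in> dom (op_adjoint (H n) (S n))"
    "(\<lambda>n. op_adjoint (H n) (S n) \<cdot> f n) \<in> carrier (hilbert_sum H)"
    "T \<cdot> f = (\<lambda>n. op_adjoint (H n) (S n) \<cdot> f n)"
  using assms app_op_sum[OF assms[unfolded T_eq]] unfolding T_eq dom_op_sum by blast+

text \<open>The constant C common to all n turns the componentwise bounds into a summable majorant,
  so the sum of the maps is defined on the whole domain of the adjoint. No sign is assumed for C,
  hence the absolute value.\<close>

lemma \<Gamma>_sum:
  assumes f: "f \<in> dom T"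
  shows "(\<lambda>n. \<Gamma> n \<cdot> f n) \<in> carrier (hilbert_sum G)"
    and "vnorm (hilbert_sum G) (\<lambda>n. \<Gamma> n \<cdot> f n)
      \<le> \<bar>C\<bar> * sqrt ((vnorm (hilbert_sum H) f)\<^sup>2 + (vnorm (hilbert_sum H) (T \<cdot> f))\<^sup>2)"
proof -
  note f' = T_domD[OF f]
  let ?t = "\<lambda>n. (vnorm (H n) (f n))\<^sup>2 + (vnorm (H n) (op_adjoint (H n) (S n) \<cdot> f n))\<^sup>2"
  have t: "summable ?t"
    by (intro summable_add H.sum_summable f'(1) H.sum_summable[OF f'(3)])
  have le: "(vnorm (G n) (\<Gamma> n \<cdot> f n))\<^sup>2 \<le> C\<^sup>2 * ?t n" for n
  proof -
    have fd: "f n \<in> dom (\<Gamma> n)" unfolding dom_\<Gamma> by (rule f'(2))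
    have "(vnorm (G n) (\<Gamma> n \<cdot> f n))\<^sup>2 \<le> (C * sqrt (?t n))\<^sup>2"
      using \<Gamma>_bound[OF f'(2)] G.comp.vnorm_nonneg[OF \<Gamma>.T.app_in[OF fd]] by (intro power_mono)
    thus ?thesis by (simp add: power_mult_distrib)
  qed
  have in_G: "\<Gamma> n \<cdot> f n \<in> carrier (G n)" for n
    by (rule \<Gamma>.T.app_in) (unfold dom_\<Gamma>, rule f'(2))
  show c: "(\<lambda>n. \<Gamma> n \<cdot> f n) \<in> carrier (hilbert_sum G)"
    by (rule G.sum_carrierI[OF in_G summable_mult[OF t, of "C\<^sup>2"] le])
  have "(vnorm (hilbert_sum G) (\<lambda>n. \<Gamma> n \<cdot> f n))\<^sup>2 \<le> (\<Sum>n. C\<^sup>2 * ?t n)"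
    unfolding G.sum_vnorm_sq[OF c]
    by (rule suminf_le[OF le G.sum_summable[OF c] summable_mult[OF t]])
  also have "\<dots> = C\<^sup>2 * ((vnorm (hilbert_sum H) f)\<^sup>2 + (vnorm (hilbert_sum H) (T \<cdot> f))\<^sup>2)"
    unfolding f'(4) H.sum_vnorm_sq[OF f'(1)] H.sum_vnorm_sq[OF f'(3)] suminf_mult[OF t]
    by (simp add: suminf_add[OF H.sum_summable[OF f'(1)] H.sum_summable[OF f'(3)]])
  finally have "sqrt ((vnorm (hilbert_sum G) (\<lambda>n. \<Gamma> n \<cdot> f n))\<^sup>2)
      \<le> sqrt (C\<^sup>2 * ((vnorm (hilbert_sum H) f)\<^sup>2 + (vnorm (hilbert_sum H) (T \<cdot> f))\<^sup>2))"
    by (rule real_sqrt_le_mono)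
  thus "vnorm (hilbert_sum G) (\<lambda>n. \<Gamma> n \<cdot> f n)
      \<le> \<bar>C\<bar> * sqrt ((vnorm (hilbert_sum H) f)\<^sup>2 + (vnorm (hilbert_sum H) (T \<cdot> f))\<^sup>2)"
    using G.sum_vnorm_nonneg[OF c] by (simp add: real_sqrt_mult)
qed

lemma boundary_map_sum_Some:
  assumes f: "f \<in> dom T"
  shows "boundary_map_sum H S G \<Gamma> f = Some (\<lambda>n. \<Gamma> n \<cdot> f n)"
proof -
  have "op_sum H G \<Gamma> f = Some (\<lambda>n. \<Gamma> n \<cdot> f n)"
    unfolding op_sum_eq_Some_iff dom_\<Gamma> using T_domD[OF f] \<Gamma>_sum(1)[OF f] by blast
  thus ?thesis unfolding boundary_map_sum_def using f by (simp only: restrict_in)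
qed

lemma dom_boundary_map_sum: "dom (boundary_map_sum H S G \<Gamma>) = dom T"
proof
  show "dom T \<subseteq> dom (boundary_map_sum H S G \<Gamma>)" using boundary_map_sum_Some by blast
  show "dom (boundary_map_sum H S G \<Gamma>) \<subseteq> dom T" unfolding boundary_map_sum_def dom_restrict by blast
qed

lemma boundary_map_sum_eq:
  assumes f: "f \<in> dom T"
  shows "f \<in> dom (op_sum H G \<Gamma>)" "boundary_map_sum H S G \<Gamma> \<cdot> f = op_sum H G \<Gamma> \<cdot> f"
proof -
  have "op_sum H G \<Gamma> f = Some (\<lambda>n. \<Gamma> n \<cdot> f n)"
    unfolding op_sum_eq_Some_iff dom_\<Gamma> using T_domD[OF f] \<Gamma>_sum(1)[OF f] by blast
  thus "f \<in> dom (op_sum H G \<Gamma>)" "boundary_map_sum H S G \<Gamma> \<cdot> f = op_sum H G \<Gamma> \<cdot> f"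
    using boundary_map_sum_Some[OF f] by auto
qed

lemma linear_boundary_map_sum:
  "linear_operator (hilbert_sum H) (hilbert_sum G) (boundary_map_sum H S G \<Gamma>)"
proof (rule linear_operatorI[OF H.hilbert_space_sum], unfold dom_boundary_map_sum)
  interpret A: linear_op "hilbert_sum H" "hilbert_sum H" T
    unfolding T_eq
    by (intro linear_op.intro linear_op_axioms.intro H.hilbert_space_sum T.linear_op_sum)
  interpret \<Gamma>s: linear_op "hilbert_sum H" "hilbert_sum G" "op_sum H G \<Gamma>"
    by (intro linear_op.intro linear_op_axioms.intro H.hilbert_space_sum G.hilbert_space_sum
        \<Gamma>.linear_op_sum)
  show "\<zero>\<^bsub>hilbert_sum H\<^esub> \<in> dom T" by (rule A.dom_zero)
  fix f g c assume f: "f \<in> dom T"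
  show "f \<in> carrier (hilbert_sum H)" by (rule A.dom_in[OF f])
  show cf: "c \<odot>\<^bsub>hilbert_sum H\<^esub> f \<in> dom T" by (rule A.dom_smult[OF f])
  show "boundary_map_sum H S G \<Gamma> \<cdot> f \<in> carrier (hilbert_sum G)"
    unfolding boundary_map_sum_eq(2)[OF f] by (rule \<Gamma>s.app_in[OF boundary_map_sum_eq(1)[OF f]])
  show "boundary_map_sum H S G \<Gamma> \<cdot> (c \<odot>\<^bsub>hilbert_sum H\<^esub> f)
      = c \<odot>\<^bsub>hilbert_sum G\<^esub> boundary_map_sum H S G \<Gamma> \<cdot> f"
    unfolding boundary_map_sum_eq(2)[OF f] boundary_map_sum_eq(2)[OF cf]
    by (rule \<Gamma>s.app_smult[OF boundary_map_sum_eq(1)[OF f]])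
  assume g: "g \<in> dom T"
  show fg: "f \<oplus>\<^bsub>hilbert_sum H\<^esub> g \<in> dom T" by (rule A.dom_add[OF f g])
  show "boundary_map_sum H S G \<Gamma> \<cdot> (f \<oplus>\<^bsub>hilbert_sum H\<^esub> g)
      = boundary_map_sum H S G \<Gamma> \<cdot> f \<oplus>\<^bsub>hilbert_sum G\<^esub> boundary_map_sum H S G \<Gamma> \<cdot> g"
    unfolding boundary_map_sum_eq(2)[OF f] boundary_map_sum_eq(2)[OF g] boundary_map_sum_eq(2)[OF fg]
    by (rule \<Gamma>s.app_add[OF boundary_map_sum_eq(1)[OF f] boundary_map_sum_eq(1)[OF g]])
qed

end

text \<open>Bounds uniform in n give the summed maps their full domain and boundedness; solutions of
  the boundary problem bounded uniformly in n give surjectivity. Green's identity is summed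
  termwise, all series involved being convergent.\<close>

lemma boundary_triplet_sum:
  fixes H :: "nat \<Rightarrow> 'a hilbert" and G :: "nat \<Rightarrow> 'b hilbert"
    and S :: "nat \<Rightarrow> ('a, 'a) operator" and \<Gamma>0 \<Gamma>1 :: "nat \<Rightarrow> ('a, 'b) operator"
  defines "T \<equiv> \<lambda>n. op_adjoint (H n) (S n)"
  assumes bt: "\<And>n. boundary_triplet (H n) (S n) (G n) (\<Gamma>0 n) (\<Gamma>1 n)"
    and bound0: "\<And>n f. f \<in> dom (T n) \<Longrightarrow> vnorm (G n) (\<Gamma>0 n \<cdot> f)
      \<le> C0 * sqrt ((vnorm (H n) f)\<^sup>2 + (vnorm (H n) (T n \<cdot> f))\<^sup>2)"
    and bound1: "\<And>n f. f \<in> dom (T n) \<Longrightarrow> vnorm (G n) (\<Gamma>1 n \<cdot> f)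
      \<le> C1 * sqrt ((vnorm (H n) f)\<^sup>2 + (vnorm (H n) (T n \<cdot> f))\<^sup>2)"
    and surj: "\<And>n h0 h1. \<lbrakk>h0 \<in> carrier (G n); h1 \<in> carrier (G n)\<rbrakk> \<Longrightarrow>
      \<exists>f\<in>dom (T n). \<Gamma>0 n \<cdot> f = h0 \<and> \<Gamma>1 n \<cdot> f = h1 \<and>
        vnorm (H n) f \<le> C * (vnorm (G n) h0 + vnorm (G n) h1) \<and>
        vnorm (H n) (T n \<cdot> f) \<le> C * (vnorm (G n) h0 + vnorm (G n) h1)"
  shows "boundary_triplet (hilbert_sum H) (op_sum H H S) (hilbert_sum G)
    (boundary_map_sum H S G \<Gamma>0) (boundary_map_sum H S G \<Gamma>1)"
proof -
  interpret tr: triplet "H n" "S n" "G n" "\<Gamma>0 n" "\<Gamma>1 n" for n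
    by (rule triplet.intro) (rule bt)
  have lin: "linear_operator (H n) (H n) (S n)" and dense: "densely_defined (H n) (S n)" for n
    using tr.dd_closed_symmetric[of n] by (simp_all add: dd_closed_symmetric_def)
  interpret Hf: hilbert_family H by (rule hilbert_family.intro) (rule tr.hilbert_H)
  interpret Gf: hilbert_family G by (rule hilbert_family.intro) (rule tr.hilbert_G)
  interpret B0: boundary_map_family H G S \<Gamma>0 C0
    by (intro boundary_map_family.intro boundary_map_family_axioms.intro Hf.hilbert_family_axioms
        Gf.hilbert_family_axioms lin dense tr.linear_\<Gamma>0 tr.dom_\<Gamma>0 bound0[unfolded T_def])
  interpret B1: boundary_map_family H G S \<Gamma>1 C1
    by (intro boundary_map_family.intro boundary_map_family_axioms.intro Hf.hilbert_family_axioms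
        Gf.hilbert_family_axioms lin dense tr.linear_\<Gamma>1 tr.dom_\<Gamma>1 bound1[unfolded T_def])
  let ?A = "op_adjoint (hilbert_sum H) (op_sum H H S)"
  show ?thesis
  proof (rule boundary_tripletI[where ?C0.0 = "\<bar>C0\<bar>" and ?C1.0 = "\<bar>C1\<bar>"])
    show "hilbert_space (hilbert_sum H)" by (rule Hf.hilbert_space_sum)
    show "hilbert_space (hilbert_sum G)" by (rule Gf.hilbert_space_sum)
    show "dd_closed_symmetric (hilbert_sum H) (op_sum H H S)"
      by (rule Hf.dd_closed_symmetric_op_sum) (rule tr.dd_closed_symmetric)
    show "equal_deficiency_indices (hilbert_sum H) (op_sum H H S)"
      by (rule Hf.equal_deficiency_indices_op_sum[OF lin dense]) (rule tr.equal_deficiency_indices)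
    show "linear_operator (hilbert_sum H) (hilbert_sum G) (boundary_map_sum H S G \<Gamma>0)"
      by (rule B0.linear_boundary_map_sum)
    show "linear_operator (hilbert_sum H) (hilbert_sum G) (boundary_map_sum H S G \<Gamma>1)"
      by (rule B1.linear_boundary_map_sum)
    show "dom (boundary_map_sum H S G \<Gamma>0) = dom ?A" by (rule B0.dom_boundary_map_sum)
    show "dom (boundary_map_sum H S G \<Gamma>1) = dom ?A" by (rule B1.dom_boundary_map_sum)
    fix f assume f: "f \<in> dom ?A"
    show "vnorm (hilbert_sum G) (boundary_map_sum H S G \<Gamma>0 \<cdot> f)
        \<le> \<bar>C0\<bar> * sqrt ((vnorm (hilbert_sum H) f)\<^sup>2 + (vnorm (hilbert_sum H) (?A \<cdot> f))\<^sup>2)"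
      unfolding B0.boundary_map_sum_Some[OF f] option.sel by (rule B0.\<Gamma>_sum(2)[OF f])
    show "vnorm (hilbert_sum G) (boundary_map_sum H S G \<Gamma>1 \<cdot> f)
        \<le> \<bar>C1\<bar> * sqrt ((vnorm (hilbert_sum H) f)\<^sup>2 + (vnorm (hilbert_sum H) (?A \<cdot> f))\<^sup>2)"
      unfolding B1.boundary_map_sum_Some[OF f] option.sel by (rule B1.\<Gamma>_sum(2)[OF f])
    fix g assume g: "g \<in> dom ?A"
    note f' = B0.T_domD[OF f] and g' = B0.T_domD[OF g]
    let ?T = "\<lambda>n. op_adjoint (H n) (S n)"
    have "ip (hilbert_sum H) (?A \<cdot> f) g - ip (hilbert_sum H) f (?A \<cdot> g)
        = (\<Sum>n. ip (H n) (?T n \<cdot> f n) (g n) - ip (H n) (f n) (?T n \<cdot> g n))"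
      unfolding f'(4) g'(4) hilbert_sum_ip
      by (rule suminf_diff[OF Hf.summable_ip[OF f'(3) g'(1)] Hf.summable_ip[OF f'(1) g'(3)]])
    also have "\<dots> = (\<Sum>n. ip (G n) (\<Gamma>1 n \<cdot> f n) (\<Gamma>0 n \<cdot> g n) - ip (G n) (\<Gamma>0 n \<cdot> f n) (\<Gamma>1 n \<cdot> g n))"
      by (intro suminf_cong tr.green f'(2) g'(2))
    also have "\<dots> = ip (hilbert_sum G) (boundary_map_sum H S G \<Gamma>1 \<cdot> f) (boundary_map_sum H S G \<Gamma>0 \<cdot> g)
        - ip (hilbert_sum G) (boundary_map_sum H S G \<Gamma>0 \<cdot> f) (boundary_map_sum H S G \<Gamma>1 \<cdot> g)"
      unfolding B0.boundary_map_sum_Some[OF f] B1.boundary_map_sum_Some[OF f]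
        B0.boundary_map_sum_Some[OF g] B1.boundary_map_sum_Some[OF g] option.sel hilbert_sum_ip
      by (rule suminf_diff[symmetric, OF Gf.summable_ip[OF B1.\<Gamma>_sum(1)[OF f] B0.\<Gamma>_sum(1)[OF g]]
            Gf.summable_ip[OF B0.\<Gamma>_sum(1)[OF f] B1.\<Gamma>_sum(1)[OF g]]])
    finally show "ip (hilbert_sum H) (?A \<cdot> f) g - ip (hilbert_sum H) f (?A \<cdot> g)
        = ip (hilbert_sum G) (boundary_map_sum H S G \<Gamma>1 \<cdot> f) (boundary_map_sum H S G \<Gamma>0 \<cdot> g)
          - ip (hilbert_sum G) (boundary_map_sum H S G \<Gamma>0 \<cdot> f) (boundary_map_sum H S G \<Gamma>1 \<cdot> g)" .
  next
    let ?A = "op_adjoint (hilbert_sum H) (op_sum H H S)"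
    fix h0 h1 assume h0: "h0 \<in> carrier (hilbert_sum G)" and h1: "h1 \<in> carrier (hilbert_sum G)"
    have "\<exists>f. f \<in> dom (T n) \<and> \<Gamma>0 n \<cdot> f = h0 n \<and> \<Gamma>1 n \<cdot> f = h1 n \<and>
        vnorm (H n) f \<le> C * (vnorm (G n) (h0 n) + vnorm (G n) (h1 n)) \<and>
        vnorm (H n) (T n \<cdot> f) \<le> C * (vnorm (G n) (h0 n) + vnorm (G n) (h1 n))" for n
      using surj[OF Gf.sum_in[OF h0] Gf.sum_in[OF h1]] by blast
    then obtain f where f: "\<And>n. f n \<in> dom (T n)" "\<And>n. \<Gamma>0 n \<cdot> f n = h0 n" "\<And>n. \<Gamma>1 n \<cdot> f n = h1 n"
      "\<And>n. vnorm (H n) (f n) \<le> C * (vnorm (G n) (h0 n) + vnorm (G n) (h1 n))"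
      "\<And>n. vnorm (H n) (T n \<cdot> f n) \<le> C * (vnorm (G n) (h0 n) + vnorm (G n) (h1 n))"
      by metis
    have fH: "f n \<in> carrier (H n)" and TfH: "T n \<cdot> f n \<in> carrier (H n)" for n
      using f(1)[of n] unfolding T_def by (rule tr.T.dom_in, rule tr.T.app_in)
    \<comment> \<open>The majorant comes from (u + v)^2 \<le> 2 u^2 + 2 v^2. It dominates the
      squared norms of both \<open>f n\<close> and \<open>T n \<cdot> f n\<close>, so the chosen
      family lies in the domain of the adjoint.\<close>
    let ?t = "\<lambda>n. C\<^sup>2 * (2 * (vnorm (G n) (h0 n))\<^sup>2 + 2 * (vnorm (G n) (h1 n))\<^sup>2)"
    have t: "summable ?t"
      by (intro summable_mult summable_add Gf.sum_summable h0 h1)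
    have sq: "x\<^sup>2 \<le> ?t n" if "0 \<le> x" "x \<le> C * (vnorm (G n) (h0 n) + vnorm (G n) (h1 n))" for x n
    proof -
      let ?a = "vnorm (G n) (h0 n)" and ?b = "vnorm (G n) (h1 n)"
      have "x\<^sup>2 \<le> (C * (?a + ?b))\<^sup>2" using that by (intro power_mono)
      also have "\<dots> = C\<^sup>2 * (?a + ?b)\<^sup>2" by (simp add: power_mult_distrib)
      also have "\<dots> \<le> C\<^sup>2 * (2 * ?a\<^sup>2 + 2 * ?b\<^sup>2)"
        using sum_squares_bound[of ?a ?b] by (intro mult_left_mono) (simp_all add: power2_sum)
      finally show ?thesis .
    qed
    have fE: "f \<in> carrier (hilbert_sum H)"
      by (rule Hf.sum_carrierI[OF fH t sq[OF tr.H.vnorm_nonneg[OF fH] f(4)]])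
    have TfE: "(\<lambda>n. T n \<cdot> f n) \<in> carrier (hilbert_sum H)"
      by (rule Hf.sum_carrierI[OF TfH t sq[OF tr.H.vnorm_nonneg[OF TfH] f(5)]])
    have fd: "f \<in> dom ?A"
      unfolding B0.T_eq dom_op_sum mem_Collect_eq using fE TfE f(1) unfolding T_def by blast
    have "boundary_map_sum H S G \<Gamma>0 \<cdot> f = h0" "boundary_map_sum H S G \<Gamma>1 \<cdot> f = h1"
      unfolding B0.boundary_map_sum_Some[OF fd] B1.boundary_map_sum_Some[OF fd] using f(2,3) by auto
    thus "\<exists>f\<in>dom ?A. boundary_map_sum H S G \<Gamma>0 \<cdot> f = h0 \<and> boundary_map_sum H S G \<Gamma>1 \<cdot> f = h1"
      using fd by blast
  qed
qed

text \<open>As \<open>op_deriv\<close> is a definite description, the first part also asserts that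
  the derivative exists. The last part gives the form of the adjoint of the summed operator, since
  \<open>boundary_triplet\<close> refers to that adjoint.\<close>

theorem corollary3p14:
  fixes H :: "nat \<Rightarrow> 'a hilbert" and S :: "nat \<Rightarrow> ('a, 'a) operator"
    and G :: "nat \<Rightarrow> 'b hilbert" and \<Gamma>0 \<Gamma>1 :: "nat \<Rightarrow> ('a, 'b) operator"
    and M :: "nat \<Rightarrow> complex \<Rightarrow> ('b, 'b) operator"
    and a \<epsilon> :: real
  assumes "\<And>n. hilbert_space (H n)"
    and "\<And>n. dd_closed_symmetric (H n) (S n)"
    and "\<And>n. equal_deficiency_indices (H n) (S n)"
    and "\<epsilon> > 0"
    and "complex_of_real ` {a - \<epsilon> <..< a + \<epsilon>} \<subseteq> (\<Inter>n. regular_points (H n) (S n))"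
    and "\<And>n. boundary_triplet (H n) (S n) (G n) (\<Gamma>0 n) (\<Gamma>1 n)"
    and "\<And>n. complex_of_real ` {a - \<epsilon> <..< a + \<epsilon>}
               \<subseteq> resolvent_set (H n) (op0 (H n) (S n) (G n) (\<Gamma>0 n))"
    and "\<And>n. M n = weyl_function (H n) (S n) (\<Gamma>0 n) (\<Gamma>1 n)"
  shows
    "(\<forall>n. has_op_derivative (G n) (M n) (op_deriv (G n) (M n) a) a \<and>
          positive_definite (G n) (op_deriv (G n) (M n) a)) \<and>
     (\<forall>n R. factorizes (G n) (op_deriv (G n) (M n) a) R \<longrightarrow>
        boundary_triplet (H n) (S n) (G n)
          (regularized_\<Gamma>0 R (\<Gamma>0 n))
          (regularized_\<Gamma>1 (G n) R (M n a) (\<Gamma>0 n) (\<Gamma>1 n))) \<and>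
     (\<forall>R. (\<forall>n. factorizes (G n) (op_deriv (G n) (M n) a) (R n)) \<longrightarrow>
        op_adjoint (hilbert_sum H) (op_sum H H S) = op_sum H H (\<lambda>n. op_adjoint (H n) (S n)) \<and>
        boundary_triplet (hilbert_sum H) (op_sum H H S) (hilbert_sum G)
          (boundary_map_sum H S G (\<lambda>n. regularized_\<Gamma>0 (R n) (\<Gamma>0 n)))
          (boundary_map_sum H S G
             (\<lambda>n. regularized_\<Gamma>1 (G n) (R n) (M n a) (\<Gamma>0 n) (\<Gamma>1 n))))"
proof -
  interpret gap: triplet_gap "H n" "S n" "G n" "\<Gamma>0 n" "\<Gamma>1 n" a \<epsilon> for n
    by (intro triplet_gap.intro triplet.intro triplet_gap_axioms.intro assms)
  have M: "M n = weyl_function (H n) (S n) (\<Gamma>0 n) (\<Gamma>1 n)" for n by (rule assms(8))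
  have D: "op_deriv (G n) (M n) (complex_of_real a) = gap.weyl_deriv n" for n
    unfolding M by (rule gap.op_deriv_weyl)
  have reg: "regularized_triplet (H n) (S n) (G n) (\<Gamma>0 n) (\<Gamma>1 n) a \<epsilon> R"
    if "factorizes (G n) (op_deriv (G n) (M n) (complex_of_real a)) R" for n R
    using that unfolding D
    by (intro regularized_triplet.intro regularized_triplet_axioms.intro gap.triplet_gap_axioms)
  show ?thesis
  proof (intro conjI allI impI)
    fix n
    show "has_op_derivative (G n) (M n) (op_deriv (G n) (M n) (complex_of_real a)) (complex_of_real a)"
      unfolding D unfolding M by (rule gap.weyl_has_derivative)
    show "positive_definite (G n) (op_deriv (G n) (M n) (complex_of_real a))"
      unfolding D by (rule gap.weyl_deriv_positive_definite)
    fix R assume "factorizes (G n) (op_deriv (G n) (M n) (complex_of_real a)) R"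
    then interpret regularized_triplet "H n" "S n" "G n" "\<Gamma>0 n" "\<Gamma>1 n" a \<epsilon> R by (rule reg)
    show "boundary_triplet (H n) (S n) (G n) (regularized_\<Gamma>0 R (\<Gamma>0 n))
        (regularized_\<Gamma>1 (G n) R (M n (complex_of_real a)) (\<Gamma>0 n) (\<Gamma>1 n))"
      using boundary_triplet_regularized unfolding M B0_def B1_def .
  next
    fix R assume R: "\<forall>n. factorizes (G n) (op_deriv (G n) (M n) (complex_of_real a)) (R n)"
    interpret reg: regularized_triplet "H n" "S n" "G n" "\<Gamma>0 n" "\<Gamma>1 n" a \<epsilon> "R n" for n
      by (rule reg) (use R in blast)
    interpret Hf: hilbert_family H by (rule hilbert_family.intro) (rule assms(1))
    show "op_adjoint (hilbert_sum H) (op_sum H H S) = op_sum H H (\<lambda>n. op_adjoint (H n) (S n))"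
      by (rule Hf.op_adjoint_op_sum) (use assms(2) in \<open>simp_all add: dd_closed_symmetric_def\<close>)
    have B0: "regularized_\<Gamma>0 (R n) (\<Gamma>0 n) = reg.B0 n" for n by (simp only: reg.B0_def)
    have B1: "regularized_\<Gamma>1 (G n) (R n) (M n (complex_of_real a)) (\<Gamma>0 n) (\<Gamma>1 n) = reg.B1 n" for n
      by (simp only: M reg.B1_def)
    \<comment> \<open>The bounds hold with 1 + (1 + |a|)/\<epsilon> for the first map, 1 + |a| for
      the second and (1 + |a|) (1 + 1/\<epsilon>) for surjectivity, the same for all n.\<close>
    show "boundary_triplet (hilbert_sum H) (op_sum H H S) (hilbert_sum G)
        (boundary_map_sum H S G (\<lambda>n. regularized_\<Gamma>0 (R n) (\<Gamma>0 n)))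
        (boundary_map_sum H S G
          (\<lambda>n. regularized_\<Gamma>1 (G n) (R n) (M n (complex_of_real a)) (\<Gamma>0 n) (\<Gamma>1 n)))"
      unfolding B0 B1
      by (rule boundary_triplet_sum[OF reg.boundary_triplet_regularized reg.B0_bound reg.B1_bound
            reg.B_surj_uniform])
  qed
qed

end
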